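(* Let $1\le p<n$ be integers. The initial subalgebra $\mathrm{in}_{<_{\mathrm{ss}}}\tilde{\mathcal P}$ is isomorphic to $A_{\tilde Q,\varnothing}(\tilde Q,\prec)$ as an $\mathbb N_0$-graded algebra, with the isomorphism given by $$\mathrm{in}_{<_{\mathrm{ss}}}D_I^{(k)}\mapsto(-1)^{\binom p2+r(p-1)}\,s\,\mathbf y^{v_{\tilde Q,\varnothing}(\varphi_{\mathrm{ss}}(I^{(k)}))}\qquad(I^{(k)}\in\tilde{\mathcal I}_{\mathrm{ss}}),$$ where $r\in[0,p-1]$ and $k\equiv r\pmod p$.
   Context: Notation: $\mathbb N_0=\{0,1,2,\dots\}$, and $[a,b]$ denotes the set of integers $x$ with $a\le x\le b$. Fix integers $1\le p<n$. Semi-infinite Plücker algebra. Consider variables $z_{i,j}^{(k)}$ with $i\in[1,p]$, $j\in[1,n]$, $k\in\mathbb N_0$. Let $z_{i,j}(t)=\sum_{k\ge 0} z_{i,j}^{(k)}t^k$ and let $Z(t)$ be the $p\times n$ matrix with entries $z_{i,j}(t)$. For a $p$-tuple $I=(\alpha_1,\dots,\alpha_p)$ of integers in $[1,n]$ let $Z_I(t)$ be the $p\times p$ matrix whose $j$th column is the $\alpha_j$th column of $Z(t)$; let $D_I(t)=\det Z_I(t)$ and let $D_I^{(k)}$ be the coefficient of $t^k$ in $D_I(t)$. The semi-infinite Plücker algebra $\tilde{\mathcal P}$ is the subalgebra of $\mathbb C[\{z_{i,j}^{(k)}\}]$ generated by all $D_I^{(k)}$, $\mathbb N_0$-graded with every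 $D_I^{(k)}$ in degree $1$ (total degree divided by $p$); its initial subalgebras are graded in the same way. $\tilde{\mathcal I}_{\mathrm{ss}}$ is the set of all symbols $I^{(k)}$ with $I$ a (strictly) increasing $p$-tuple of integers in $[1,n]$ and $k\in\mathbb N_0$. Initial subalgebras. For a monomial order $<$, $\mathrm{in}_<(f)$ is the $<$-maximal term of $f$ (with its coefficient), and $\mathrm{in}_<A$ is the linear span of all $\mathrm{in}_<(f)$, $f\in A$. Given an ordering $x_1,x_2,\dots$ of the variables, the degree reverse lexicographic order is: $\prod x_i^{a_i}<\prod x_i^{b_i}$ iff $\sum a_i<\sum b_i$, or $\sum a_i=\sum b_i$ and the last non-zero entry of $a-b$ is positive. The order $<_{\mathrm{ss}}$ is the degree reverse lexicographic order on $\mathbb C[\{z_{i,j}^{(k)}\}]$ for the ordering of the $z_{i,j}^{(k)}$ first by $k$, then by $i$, then by $j$ (all increasingly). The poset $(\tilde Q,\prec)$ consists of elements $q_{i,j}$ with integers $i\ge1$, $j\ge p+1$, $j-i\in[0,n-1]$, where $q_{i_1,j_1}\preceq q_{i_2,j_2}$ iff at least one of: (i) $i_1\le i_2$ and $j_1\le j_2$; (ii) $i_1+p\le i_2$; (iii) $j_1+n-p\le j_2$. $\mathcal J(\tilde Q)$ is the set of finite order ideals (finite down-closed subsets). For $I^{(k)}\in\tilde{\mathcal I}_{\mathrm{ss}}$ with $I=(\alpha_1,\dots,\alpha_p)$, $\varphi_{\mathrm{ss}}(I^{(k)})\in\mathcal J(\tilde Q)$ is the subset containing all $q_{i,j}\in\tilde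 Q$ with $i\le k$, and, for every $i\in[k+1,k+p]$, those $q_{i,j}\in\tilde Q$ for which $j\le i+\alpha_{p+1-(i-k)}-1$ (and no other elements). For $J\in\mathcal J(\tilde Q)$, $v_{\tilde Q,\varnothing}(J)\in\mathbb R^{\tilde Q}$ is the indicator vector of $J$, and $\mathbf y^u=\prod_q y_q^{u_q}$. In the polynomial ring $\mathbb C[\{y_q\}_{q\in\tilde Q}][s]$, graded by degree in $s$, $A_{\tilde Q,\varnothing}(\tilde Q,\prec)$ is the subalgebra generated by the monomials $s\,\mathbf y^{v_{\tilde Q,\varnothing}(J)}$, $J\in\mathcal J(\tilde Q)$. *)

theory Defs
  imports
    "HOL-Library.Poly_Mapping"
    "HOL-Library.Indicator_Function"
    "HOL-Computational_Algebra.Formal_Power_Series"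
    "HOL-Computational_Algebra.Polynomial"
    "HOL-Number_Theory.Cong"
    "Jordan_Normal_Form.Determinant"
begin

section \<open>Complex polynomial algebras\<close>

text \<open>
  A monomial is a finitely supported exponent vector, a polynomial a finitely supported
  function from monomials to complex numbers.
\<close>

type_synonym 'v monom = "'v \<Rightarrow>\<^sub>0 nat"
type_synonym 'v mpoly = "'v monom \<Rightarrow>\<^sub>0 complex"

definition const :: "complex \<Rightarrow> 'v mpoly"
  where "const c = Poly_Mapping.single 0 c"

definition var :: "'v \<Rightarrow> 'v mpoly"
  where "var v = Poly_Mapping.single (Poly_Mapping.single v 1) 1"

definition mpoly_scale :: "complex \<Rightarrow> 'v mpoly \<Rightarrow> 'v mpoly"
  where "mpoly_scale c f = const c * f"

global_interpretation mpoly: vector_space "mpoly_scale :: complex \<Rightarrow> 'v mpoly \<Rightarrow> 'v mpoly"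
  defines mpoly_span = mpoly.span
  by unfold_locales
    (simp_all add: mpoly_scale_def const_def algebra_simps single_add mult_single
       flip: mult.assoc)

definition total_degree :: "'v monom \<Rightarrow> nat"
  where "total_degree m = (\<Sum>v\<in>Poly_Mapping.keys m. Poly_Mapping.lookup m v)"

definition homogeneous :: "nat \<Rightarrow> 'v mpoly set"
  where "homogeneous d = {f. \<forall>m\<in>Poly_Mapping.keys f. total_degree m = d}"

text \<open>The unital subalgebra generated by \<open>S\<close>, for a complex algebra with scalar
  multiplication \<open>scale\<close>.\<close>

inductive_set subalgebra_generated :: "(complex \<Rightarrow> 'a \<Rightarrow> 'a) \<Rightarrow> 'a set \<Rightarrow> 'a::ring_1 set"
  for scale :: "complex \<Rightarrow> 'a \<Rightarrow> 'a" and S :: "'a set"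
  where
    gen: "x \<in> S \<Longrightarrow> x \<in> subalgebra_generated scale S"
  | one: "1 \<in> subalgebra_generated scale S"
  | add: "\<lbrakk>x \<in> subalgebra_generated scale S; y \<in> subalgebra_generated scale S\<rbrakk>
      \<Longrightarrow> x + y \<in> subalgebra_generated scale S"
  | mult: "\<lbrakk>x \<in> subalgebra_generated scale S; y \<in> subalgebra_generated scale S\<rbrakk>
      \<Longrightarrow> x * y \<in> subalgebra_generated scale S"
  | scale: "x \<in> subalgebra_generated scale S \<Longrightarrow> scale c x \<in> subalgebra_generated scale S"

text \<open>\<open>grA d\<close> and \<open>grB d\<close> are the degree \<open>d\<close> components of the ambient algebras; the subalgebras
  \<open>A\<close> and \<open>B\<close> carry the induced gradings.\<close>

definition graded_algebra_iso ::
  "(complex \<Rightarrow> 'a \<Rightarrow> 'a) \<Rightarrow> (nat \<Rightarrow> 'a set) \<Rightarrow> 'a::ring_1 set \<Rightarrow>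
   (complex \<Rightarrow> 'b \<Rightarrow> 'b) \<Rightarrow> (nat \<Rightarrow> 'b set) \<Rightarrow> 'b::ring_1 set \<Rightarrow> ('a \<Rightarrow> 'b) \<Rightarrow> bool"
  where "graded_algebra_iso scaleA grA A scaleB grB B \<psi> \<longleftrightarrow>
    bij_betw \<psi> A B \<and>
    \<psi> 1 = 1 \<and>
    (\<forall>x\<in>A. \<forall>y\<in>A. \<psi> (x + y) = \<psi> x + \<psi> y) \<and>
    (\<forall>x\<in>A. \<forall>y\<in>A. \<psi> (x * y) = \<psi> x * \<psi> y) \<and>
    (\<forall>c. \<forall>x\<in>A. \<psi> (scaleA c x) = scaleB c (\<psi> x)) \<and>
    (\<forall>d. \<psi> ` (A \<inter> grA d) = B \<inter> grB d)"

section \<open>Initial subalgebras\<close>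

text \<open>A monomial order is represented by its strict part \<open>lt\<close>.\<close>

definition initial_term :: "('v monom \<Rightarrow> 'v monom \<Rightarrow> bool) \<Rightarrow> 'v mpoly \<Rightarrow> 'v mpoly"
  where "initial_term lt f =
    (if f = 0 then 0 else
      let m = (THE m. m \<in> Poly_Mapping.keys f \<and>
                 (\<forall>m'\<in>Poly_Mapping.keys f. m' = m \<or> lt m' m))
      in Poly_Mapping.single m (Poly_Mapping.lookup f m))"

definition initial_subalgebra ::
  "('v monom \<Rightarrow> 'v monom \<Rightarrow> bool) \<Rightarrow> 'v mpoly set \<Rightarrow> 'v mpoly set"
  where "initial_subalgebra lt A = mpoly_span (initial_term lt ` A)"

text \<open>Degree reverse lexicographic order for the ordering \<open>vless\<close> of the variables: in equal
  degree, \<open>a\<close> is smaller than \<open>b\<close> iff the last non-zero entry of \<open>a - b\<close> is positive.\<close>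

definition degrevlex_less :: "('v \<Rightarrow> 'v \<Rightarrow> bool) \<Rightarrow> 'v monom \<Rightarrow> 'v monom \<Rightarrow> bool"
  where "degrevlex_less vless a b \<longleftrightarrow>
    total_degree a < total_degree b \<or>
    total_degree a = total_degree b \<and>
      (\<exists>v. Poly_Mapping.lookup a v > Poly_Mapping.lookup b v \<and>
        (\<forall>w. vless v w \<longrightarrow> Poly_Mapping.lookup a w = Poly_Mapping.lookup b w))"

section \<open>The semi-infinite Pluecker algebra\<close>

text \<open>
  \<open>(i, j, k)\<close> stands for the variable $z_{i,j}^{(k)}$. All triples of naturals are admitted as
  variables, but only those with $i \in [1,p]$ and $j \in [1,n]$ occur in the subalgebra
  \<open>pluecker_algebra p n\<close> below.
\<close>

type_synonym zvar = "nat \<times> nat \<times> nat"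

fun zvar_less :: "zvar \<Rightarrow> zvar \<Rightarrow> bool"
  where "zvar_less (i, j, k) (i', j', k') \<longleftrightarrow>
    k < k' \<or> k = k' \<and> (i < i' \<or> i = i' \<and> j < j')"

definition ss_less :: "zvar monom \<Rightarrow> zvar monom \<Rightarrow> bool"
  where "ss_less = degrevlex_less zvar_less"

definition z_series :: "nat \<Rightarrow> nat \<Rightarrow> zvar mpoly fps"
  where "z_series i j = Abs_fps (\<lambda>k. var (i, j, k))"

text \<open>A tuple $(\alpha_1,\dots,\alpha_p)$ is the list with $\alpha_m$ at position $m - 1$; likewise
  \<open>Matrix.mat\<close> counts rows and columns from 0.\<close>

definition Z_mat :: "nat \<Rightarrow> nat list \<Rightarrow> zvar mpoly fps mat"
  where "Z_mat p I = Matrix.mat p p (\<lambda>(i, j). z_series (i + 1) (I ! j))"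

definition D_coeff :: "nat \<Rightarrow> nat list \<Rightarrow> nat \<Rightarrow> zvar mpoly"
  where "D_coeff p I k = fps_nth (Determinant.det (Z_mat p I)) k"

definition tuples :: "nat \<Rightarrow> nat \<Rightarrow> nat list set"
  where "tuples p n = {I. length I = p \<and> set I \<subseteq> {1..n}}"

definition increasing_tuples :: "nat \<Rightarrow> nat \<Rightarrow> nat list set"
  where "increasing_tuples p n = {I \<in> tuples p n. sorted_wrt (<) I}"

definition pluecker_algebra :: "nat \<Rightarrow> nat \<Rightarrow> zvar mpoly set"
  where "pluecker_algebra p n =
    subalgebra_generated mpoly_scale {D_coeff p I k | I k. I \<in> tuples p n}"

text \<open>The grading in which every \<open>D_coeff p I k\<close> has degree 1.\<close>

definition pluecker_degree :: "nat \<Rightarrow> nat \<Rightarrow> zvar mpoly set"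
  where "pluecker_degree p d = homogeneous (p * d)"

section \<open>The poset and its algebra\<close>

definition Q_set :: "nat \<Rightarrow> nat \<Rightarrow> (nat \<times> nat) set"
  where "Q_set p n = {(i, j). 1 \<le> i \<and> p + 1 \<le> j \<and> int j - int i \<in> {0..int n - 1}}"

definition Q_le :: "nat \<Rightarrow> nat \<Rightarrow> nat \<times> nat \<Rightarrow> nat \<times> nat \<Rightarrow> bool"
  where "Q_le p n = (\<lambda>(i1, j1) (i2, j2).
    (i1 \<le> i2 \<and> j1 \<le> j2) \<or> i1 + p \<le> i2 \<or> int j1 + int n - int p \<le> int j2)"

definition finite_order_ideals :: "'q set \<Rightarrow> ('q \<Rightarrow> 'q \<Rightarrow> bool) \<Rightarrow> 'q set set"
  where "finite_order_ideals Q qle =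
    {J. J \<subseteq> Q \<and> finite J \<and> (\<forall>x\<in>J. \<forall>y\<in>Q. qle y x \<longrightarrow> y \<in> J)}"

text \<open>\<open>I ! (p - (i - k))\<close> is $\alpha_{p+1-(i-k)}$.\<close>

definition phi_ss :: "nat \<Rightarrow> nat \<Rightarrow> nat list \<Rightarrow> nat \<Rightarrow> (nat \<times> nat) set"
  where "phi_ss p n I k =
    {(i, j) \<in> Q_set p n. i \<le> k \<or>
      (i \<in> {k + 1..k + p} \<and> j \<le> i + I ! (p - (i - k)) - 1)}"

text \<open>\<open>Abs_poly_mapping\<close> is only meaningful on finitely supported functions, so \<open>J\<close> has to be
  finite here.\<close>

definition indicator_monom :: "'q set \<Rightarrow> 'q monom"
  where "indicator_monom J = Abs_poly_mapping (indicator J)"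

lemma lookup_indicator_monom:
  "finite J \<Longrightarrow> Poly_Mapping.lookup (indicator_monom J) = indicator J"
  unfolding indicator_monom_def
  by (rule lookup_Abs_poly_mapping, rule finite_subset[of _ J]) (auto simp: indicator_def)

text \<open>The polynomial ring $\mathbb{C}[\{y_q\}][s]$, as univariate polynomials in $s$ over
  $\mathbb{C}[\{y_q\}]$.\<close>

definition ys_scale :: "complex \<Rightarrow> 'q mpoly poly \<Rightarrow> 'q mpoly poly"
  where "ys_scale c f = Polynomial.smult (const c) f"

definition s_degree :: "nat \<Rightarrow> 'q mpoly poly set"
  where "s_degree d = {Polynomial.monom a d | a. True}"

definition s_y_monom :: "'q set \<Rightarrow> 'q mpoly poly"
  where "s_y_monom J = Polynomial.monom (Poly_Mapping.single (indicator_monom J) 1) 1"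

definition order_ideal_algebra :: "'q set \<Rightarrow> ('q \<Rightarrow> 'q \<Rightarrow> bool) \<Rightarrow> 'q mpoly poly set"
  where "order_ideal_algebra Q qle =
    subalgebra_generated ys_scale (s_y_monom ` finite_order_ideals Q qle)"

end

theory Submission
  imports Defs
begin

text \<open>
  Write a variable $z_{i,j}^{(k)}$ in the global row $g = pk + i$. In the expansion of
  $D_I^{(k)}$ the largest term spreads $k$ over the rows as evenly as possible: up to sign it is
  the product of one variable in each global row $g \in [k+1, k+p]$, and the variable in row
  $g$ has column $\alpha_{p+1-(g-k)}$. These columns are the heights of the rows of the order
  ideal $\varphi_{ss}(I^{(k)})$, so comparing height counts shows that products of initial
  terms and products of the monomials $s\,y^{J}$ satisfy the same binomial relations.

  It remains to see that the $D_I^{(k)}$ form a SAGBI basis. If the ideals of $I^{(k)}$ and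
  $J^{(l)}$ with $d = l - k \ge 0$ are incomparable, then $\alpha_x > \beta_{x+d}$ for some $x$.
  Antisymmetrising $D_I(t) D_J(u)$ over the $p + d + 1$ columns
  $\beta_1 < \dots < \beta_{x+d} < \alpha_x < \dots < \alpha_p$ gives a series that vanishes to
  order $d + 1$ on $t = u$. Hence its coefficients on the antidiagonal $a + b = k + l$ satisfy
  $d + 1$ Vandermonde relations, which express the coefficient at $(k, l)$ through those at
  $(a, b)$ with $|a - b| > d$. Iterating, products over multichains of ideals span the Pluecker
  algebra; a multichain is determined by its height counts, so these products have distinct
  initial terms.
\<close>

section \<open>Degree reverse lexicographic leading monomials\<close>

text \<open>Vanishing on \<open>t = u\<close> is handled with a single series variable: the Euler
  operator \<open>fps_XD\<close> acts \<open>s \<le> d\<close> times on the first determinant only,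
  and then both factors use the same variable. The coefficient of degree \<open>k + l\<close> is a
  moment, weighting position \<open>a\<close> by \<open>a ^ s\<close>. The number of moments fits
  the purpose. The \<open>d\<close> positions \<open>a\<close> with \<open>k < a \<le> l\<close>
  (the last being the mirror image of \<open>k\<close>) give products that need not be more spread
  than the given one; a polynomial of degree \<open>d\<close> vanishes at all of them but not at
  \<open>k\<close>. At \<open>a = k\<close> there remain permutations that mix the two factors; they
  lower the column sum of the first one, so the weight of a generator has to see its columns besides
  \<open>k\<close>. Rewriting moves weight from the lighter to the heavier factor with a fixed
  total, so the sum of squared weights grows and the process ends. The two kinds of monomials do not
  record the same data: an ideal monomial sees all rows, an initial monomial only the
  \<open>p\<close> rows of a window. The counts of the full rows before the window are recovered by
  stepping through the rows with period \<open>p\<close>.\<close>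

declare zvar_less.simps [simp del]

lemma zvar_less_irrefl: "\<not> zvar_less v v"
  by (cases v) (auto simp: zvar_less.simps)

lemma zvar_less_trans: "zvar_less u v \<Longrightarrow> zvar_less v w \<Longrightarrow> zvar_less u w"
  by (cases u; cases v; cases w) (auto simp: zvar_less.simps)

lemma zvar_less_total: "u \<noteq> v \<Longrightarrow> zvar_less u v \<or> zvar_less v u"
  by (cases u; cases v) (auto simp: zvar_less.simps)

text \<open>Supplies the last variable at which two monomials differ, where the reverse
  lexicographic comparison is decided.\<close>

lemma finite_zvar_max:
  assumes "finite V" "V \<noteq> {}"
  shows "\<exists>v\<in>V. \<forall>w. zvar_less v w \<longrightarrow> w \<notin> V"
  using assms
proof (induction rule: finite_ne_induct)
  case (singleton x)
  then show ?case by (auto simp: zvar_less_irrefl)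
next
  case (insert x F)
  then obtain v where v: "v \<in> F" "\<forall>w. zvar_less v w \<longrightarrow> w \<notin> F" by blast
  show ?case
  proof (cases "zvar_less v x")
    case True
    have "\<forall>w. zvar_less x w \<longrightarrow> w \<notin> insert x F"
      using True v(2) zvar_less_irrefl zvar_less_trans by blast
    then show ?thesis by blast
  qed (use v in blast)
qed

lemma total_degree_eq_sum:
  assumes "finite K" "Poly_Mapping.keys m \<subseteq> K"
  shows "total_degree m = (\<Sum>v\<in>K. Poly_Mapping.lookup m v)"
  unfolding total_degree_def
  by (rule sum.mono_neutral_left) (use assms in \<open>auto simp: in_keys_iff\<close>)

lemma total_degree_add: "total_degree (a + b) = total_degree a + total_degree b"
proof -
  let ?K = "Poly_Mapping.keys a \<union> Poly_Mapping.keys b \<union> Poly_Mapping.keys (a + b)"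
  have "total_degree m = (\<Sum>v\<in>?K. Poly_Mapping.lookup m v)" if "Poly_Mapping.keys m \<subseteq> ?K" for m
    by (rule total_degree_eq_sum) (use that in auto)
  then show ?thesis by (simp add: lookup_add sum.distrib subset_eq)
qed

lemma total_degree_zero [simp]: "total_degree 0 = 0"
  by (simp add: total_degree_def)

lemma total_degree_single [simp]: "total_degree (Poly_Mapping.single v c) = c"
  by (simp add: total_degree_def)

lemma ss_less_irrefl: "\<not> ss_less a a"
  by (simp add: ss_less_def degrevlex_less_def)

lemma ss_less_trans:
  assumes "ss_less a b" "ss_less b c"
  shows "ss_less a c"
proof -
  consider "total_degree a < total_degree c"
    | "total_degree a = total_degree b" "total_degree b = total_degree c"
    using assms by (force simp: ss_less_def degrevlex_less_def)
  then show ?thesis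
  proof cases
    case 2
    then obtain v w where v: "Poly_Mapping.lookup a v > Poly_Mapping.lookup b v"
        "\<And>u. zvar_less v u \<Longrightarrow> Poly_Mapping.lookup a u = Poly_Mapping.lookup b u"
      and w: "Poly_Mapping.lookup b w > Poly_Mapping.lookup c w"
        "\<And>u. zvar_less w u \<Longrightarrow> Poly_Mapping.lookup b u = Poly_Mapping.lookup c u"
      using assms by (auto simp: ss_less_def degrevlex_less_def)
    \<comment> \<open>The comparison of \<open>a\<close> with \<open>c\<close> is decided at the
      later of the two deciding variables.\<close>
    consider "v = w" | "zvar_less v w" | "zvar_less w v"
      using zvar_less_total by blast
    then have "\<exists>u. Poly_Mapping.lookup a u > Poly_Mapping.lookup c u \<and>
        (\<forall>x. zvar_less u x \<longrightarrow> Poly_Mapping.lookup a x = Poly_Mapping.lookup c x)"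
    proof cases
      case 1
      then show ?thesis using v w by (intro exI[of _ v]) auto
    next
      case 2
      then have "Poly_Mapping.lookup a w = Poly_Mapping.lookup b w"
        "\<And>u. zvar_less w u \<Longrightarrow> Poly_Mapping.lookup a u = Poly_Mapping.lookup b u"
        using v(2) zvar_less_trans by blast+
      then show ?thesis using w by (intro exI[of _ w]) auto
    next
      case 3
      then have "Poly_Mapping.lookup b v = Poly_Mapping.lookup c v"
        "\<And>u. zvar_less v u \<Longrightarrow> Poly_Mapping.lookup b u = Poly_Mapping.lookup c u"
        using w(2) zvar_less_trans by blast+
      then show ?thesis using v by (intro exI[of _ v]) auto
    qed
    then show ?thesis using 2 by (simp add: ss_less_def degrevlex_less_def)
  qed (simp add: ss_less_def degrevlex_less_def)
qed

lemma ss_less_total: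
  assumes "a \<noteq> b"
  shows "ss_less a b \<or> ss_less b a"
proof -
  let ?V = "{v. Poly_Mapping.lookup a v \<noteq> Poly_Mapping.lookup b v}"
  have "finite ?V"
    by (rule finite_subset[of _ "Poly_Mapping.keys a \<union> Poly_Mapping.keys b"]) (auto simp: in_keys_iff)
  moreover have "?V \<noteq> {}" using assms by (auto intro: poly_mapping_eqI)
  ultimately obtain v where "v \<in> ?V" "\<forall>w. zvar_less v w \<longrightarrow> w \<notin> ?V"
    using finite_zvar_max by blast
  then have "(Poly_Mapping.lookup a v > Poly_Mapping.lookup b v \<or>
      Poly_Mapping.lookup b v > Poly_Mapping.lookup a v) \<and>
      (\<forall>w. zvar_less v w \<longrightarrow> Poly_Mapping.lookup a w = Poly_Mapping.lookup b w)"
    by auto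
  then show ?thesis unfolding ss_less_def degrevlex_less_def
    by (metis linorder_less_linear)
qed

lemma ss_less_add: "ss_less a b \<Longrightarrow> ss_less (a + c) (b + c)"
  by (auto simp: ss_less_def degrevlex_less_def total_degree_add lookup_add)

text \<open>A relational form of the choice made by \<open>THE\<close> in
  \<open>initial_term\<close>, which can be carried through products and sums.\<close>

definition leading_monom :: "zvar monom \<Rightarrow> zvar mpoly \<Rightarrow> bool"
  where "leading_monom m f \<longleftrightarrow>
    m \<in> Poly_Mapping.keys f \<and> (\<forall>m'\<in>Poly_Mapping.keys f. m' = m \<or> ss_less m' m)"

lemma finite_ss_max:
  assumes "finite M" "M \<noteq> {}"
  shows "\<exists>m\<in>M. \<forall>m'\<in>M. m' = m \<or> ss_less m' m"
  using assms
proof (induction rule: finite_ne_induct)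
  case (insert x F)
  then obtain m where m: "m \<in> F" "\<forall>m'\<in>F. m' = m \<or> ss_less m' m" by blast
  show ?case
  proof (cases "ss_less m x")
    case True
    then have "\<forall>m'\<in>insert x F. m' = x \<or> ss_less m' x" using m(2) by (auto intro: ss_less_trans)
    then show ?thesis by blast
  next
    case False
    then have "\<forall>m'\<in>insert x F. m' = m \<or> ss_less m' m" using m(2) ss_less_total[of m x] by auto
    then show ?thesis using m(1) by blast
  qed
qed simp

lemma leading_monom_exists: "f \<noteq> 0 \<Longrightarrow> \<exists>m. leading_monom m f"
  using finite_ss_max[of "Poly_Mapping.keys f"] by (auto simp: leading_monom_def)

lemma initial_term_leading:
  assumes "leading_monom m f"
  shows "initial_term ss_less f = Poly_Mapping.single m (Poly_Mapping.lookup f m)"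
proof -
  have "(THE m. m \<in> Poly_Mapping.keys f \<and> (\<forall>m'\<in>Poly_Mapping.keys f. m' = m \<or> ss_less m' m)) = m"
    using assms unfolding leading_monom_def
    by (intro the_equality) (blast, metis ss_less_irrefl ss_less_trans)
  moreover have "f \<noteq> 0" using assms by (auto simp: leading_monom_def)
  ultimately show ?thesis by (simp add: initial_term_def)
qed

text \<open>Splitting off both leading terms writes the product as one monomial plus a remainder
  \<open>r\<close> whose monomials are all strictly smaller, because the order is compatible with
  adding exponents. The top coefficient is a product of nonzero complex numbers.\<close>

lemma leading_monom_mult:
  assumes f: "leading_monom a f" and g: "leading_monom b g"
  shows "leading_monom (a + b) (f * g)"
    and "Poly_Mapping.lookup (f * g) (a + b) = Poly_Mapping.lookup f a * Poly_Mapping.lookup g b"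
proof -
  let ?c = "Poly_Mapping.lookup f a" and ?d = "Poly_Mapping.lookup g b"
  define f' where "f' = f - Poly_Mapping.single a ?c"
  define g' where "g' = g - Poly_Mapping.single b ?d"
  have f': "ss_less m a" if "m \<in> Poly_Mapping.keys f'" for m
  proof -
    have "m \<noteq> a" "m \<in> Poly_Mapping.keys f"
      using that by (auto simp: f'_def in_keys_iff lookup_minus lookup_single when_def split: if_splits)
    then show ?thesis using f by (auto simp: leading_monom_def)
  qed
  have g': "ss_less m b" if "m \<in> Poly_Mapping.keys g'" for m
  proof -
    have "m \<noteq> b" "m \<in> Poly_Mapping.keys g"
      using that by (auto simp: g'_def in_keys_iff lookup_minus lookup_single when_def split: if_splits)
    then show ?thesis using g by (auto simp: leading_monom_def)
  qed
  define r where "r = Poly_Mapping.single a ?c * g' + f' * g"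
  have fg: "f * g = Poly_Mapping.single (a + b) (?c * ?d) + r"
    unfolding r_def f'_def g'_def by (simp add: algebra_simps mult_single)
  have r: "ss_less m (a + b)" if m: "m \<in> Poly_Mapping.keys r" for m
  proof -
    consider "m \<in> Poly_Mapping.keys (Poly_Mapping.single a ?c * g')" | "m \<in> Poly_Mapping.keys (f' * g)"
      using m Poly_Mapping.keys_add[of "Poly_Mapping.single a ?c * g'" "f' * g"] unfolding r_def by blast
    then show ?thesis
    proof cases
      case 1
      then obtain y where "m = a + y" "y \<in> Poly_Mapping.keys g'"
        using keys_mult[of "Poly_Mapping.single a ?c" g'] by (auto split: if_splits)
      then show ?thesis using ss_less_add[OF g', of y a] by (simp add: add.commute)
    next
      case 2
      then obtain x y where xy: "m = x + y" "x \<in> Poly_Mapping.keys f'" "y \<in> Poly_Mapping.keys g"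
        using keys_mult[of f' g] by auto
      have "ss_less (x + y) (a + y)" using ss_less_add f' xy by blast
      moreover have "y = b \<or> ss_less (a + y) (a + b)"
        using g xy(3) ss_less_add[of y b a] by (auto simp: leading_monom_def add.commute)
      ultimately show ?thesis using xy(1) ss_less_trans by blast
    qed
  qed
  have "Poly_Mapping.lookup r (a + b) = 0"
    using r ss_less_irrefl by (metis in_keys_iff)
  then show eq: "Poly_Mapping.lookup (f * g) (a + b) = ?c * ?d"
    by (simp add: fg lookup_add)
  have "?c \<noteq> 0" "?d \<noteq> 0" using f g by (auto simp: leading_monom_def in_keys_iff)
  moreover have "Poly_Mapping.keys (f * g) \<subseteq> {a + b} \<union> Poly_Mapping.keys r"
    unfolding fg by (rule order.trans[OF Poly_Mapping.keys_add]) auto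
  ultimately show "leading_monom (a + b) (f * g)"
    using eq r unfolding leading_monom_def in_keys_iff[of "a + b"] by auto
qed

lemma mpoly_scale_eq: "mpoly_scale c (f :: 'v mpoly) = Poly_Mapping.map ((*) c) f"
  by (simp add: mpoly_scale_def const_def mult_map_scale_conv_mult)

lemma lookup_mpoly_scale [simp]:
  "Poly_Mapping.lookup (mpoly_scale c f) m = c * Poly_Mapping.lookup f m"
  by (simp add: mpoly_scale_eq Poly_Mapping.map.rep_eq when_def)

lemma mpoly_scale_mult_left: "mpoly_scale c f * g = mpoly_scale c (f * g)"
  by (simp add: mpoly_scale_def mult.assoc)

text \<open>Distinct leading monomials cannot cancel, so the greatest of them leads the combination.
  With a spanning set of this kind, all initial terms of an algebra are known.\<close>

lemma leading_monom_sum: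
  assumes "finite X" "X \<noteq> {}" and c: "\<And>S. S \<in> X \<Longrightarrow> c S \<noteq> 0"
    and lead: "\<And>S. S \<in> X \<Longrightarrow> leading_monom (lm S) (P S)" and inj: "inj_on lm X"
  shows "\<exists>S\<in>X. leading_monom (lm S) (\<Sum>S\<in>X. mpoly_scale (c S) (P S))"
proof -
  obtain S where S: "S \<in> X" "\<And>T. T \<in> X \<Longrightarrow> lm T = lm S \<or> ss_less (lm T) (lm S)"
    using finite_ss_max[of "lm ` X"] assms(1,2) by auto
  let ?f = "\<Sum>S\<in>X. mpoly_scale (c S) (P S)"
  have lo: "Poly_Mapping.lookup ?f m = (\<Sum>S\<in>X. c S * Poly_Mapping.lookup (P S) m)" for m
    by (simp add: lookup_sum)
  have T0: "Poly_Mapping.lookup (P T) (lm S) = 0" if "T \<in> X" "T \<noteq> S" for T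
  proof -
    have "ss_less (lm T) (lm S)" using S that inj by (metis inj_onD)
    then have "lm S \<notin> Poly_Mapping.keys (P T)"
      using lead[OF that(1)] ss_less_trans ss_less_irrefl unfolding leading_monom_def by metis
    then show ?thesis by (simp add: in_keys_iff)
  qed
  have "Poly_Mapping.lookup ?f (lm S) = c S * Poly_Mapping.lookup (P S) (lm S)"
    unfolding lo using T0 S(1) assms(1) by (subst sum.remove[of _ S]) auto
  also have "\<dots> \<noteq> 0" using c lead S(1) by (auto simp: leading_monom_def in_keys_iff)
  finally have "lm S \<in> Poly_Mapping.keys ?f" by (simp add: in_keys_iff)
  moreover have "m = lm S \<or> ss_less m (lm S)" if "m \<in> Poly_Mapping.keys ?f" for m
  proof -
    have "(\<Sum>S\<in>X. c S * Poly_Mapping.lookup (P S) m) \<noteq> 0"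
      using that lo by (simp add: in_keys_iff)
    then obtain T where "T \<in> X" "Poly_Mapping.lookup (P T) m \<noteq> 0"
      by (metis (no_types, lifting) mult_zero_right sum.neutral)
    then show ?thesis using lead S(2) ss_less_trans unfolding leading_monom_def
      by (metis in_keys_iff)
  qed
  ultimately show ?thesis using S(1) by (auto simp: leading_monom_def)
qed

section \<open>Initial terms of the generators\<close>

text \<open>Columns are given by a function instead of a list, so that permuting them is composition
  of functions.\<close>

definition coldet :: "nat \<Rightarrow> (nat \<Rightarrow> nat) \<Rightarrow> zvar mpoly fps"
  where "coldet p c = Determinant.det (Matrix.mat p p (\<lambda>(i, j). z_series (i + 1) (c j)))"

lemma D_coeff_coldet: "D_coeff p I k = fps_nth (coldet p ((!) I)) k"
  by (simp add: D_coeff_def Z_mat_def coldet_def)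

section \<open>Monomials of the determinant expansion\<close>

lemma coldet_expand:
  "coldet p c = (\<Sum>\<tau> | \<tau> permutes {0..<p}.
     of_int (sign \<tau>) * (\<Prod>i = 0..<p. z_series (i + 1) (c (\<tau> i))))"
proof -
  have "(\<Prod>i = 0..<p. Matrix.mat p p (\<lambda>(i, j). z_series (i + 1) (c j)) $$ (i, \<tau> i)) =
      (\<Prod>i = 0..<p. z_series (i + 1) (c (\<tau> i)))" if "\<tau> permutes {0..<p}" for \<tau>
    using that by (intro prod.cong) (auto simp: permutes_in_image dest: permutes_in_image[of \<tau>])
  then show ?thesis by (simp add: coldet_def det_def)
qed

definition row_monom :: "nat \<Rightarrow> (nat \<Rightarrow> nat) \<Rightarrow> (nat \<Rightarrow> nat) \<Rightarrow> zvar monom"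
  where "row_monom p c \<kappa> = (\<Sum>i = 0..<p. Poly_Mapping.single (i + 1, c i, \<kappa> i) 1)"

text \<open>The factors lie in pairwise different rows, so the monomial is square-free and
  determined by its set of variables.\<close>

lemma lookup_row_monom:
  "Poly_Mapping.lookup (row_monom p c \<kappa>) v = (if v \<in> (\<lambda>i. (i + 1, c i, \<kappa> i)) ` {0..<p} then 1 else 0)"
proof -
  have "Poly_Mapping.lookup (row_monom p c \<kappa>) v = (\<Sum>i = 0..<p. (if (i + 1, c i, \<kappa> i) = v then 1 else 0))"
    unfolding row_monom_def lookup_sum lookup_single when_def by (rule sum.cong) auto
  also have "\<dots> = card {i \<in> {0..<p}. (i + 1, c i, \<kappa> i) = v}"
    by (simp add: sum.If_cases Int_def)
  also have "\<dots> = (if v \<in> (\<lambda>i. (i + 1, c i, \<kappa> i)) ` {0..<p} then 1 else 0)"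
  proof (cases "v \<in> (\<lambda>i. (i + 1, c i, \<kappa> i)) ` {0..<p}")
    case True
    then obtain j where j: "j < p" "v = (j + 1, c j, \<kappa> j)" by auto
    then have "{i \<in> {0..<p}. (i + 1, c i, \<kappa> i) = v} = {j}" by auto
    then show ?thesis using True by simp
  next
    case False
    then have "{i \<in> {0..<p}. (i + 1, c i, \<kappa> i) = v} = {}" by auto
    then show ?thesis using False by simp
  qed
  finally show ?thesis .
qed

lemma total_degree_sum: "total_degree (\<Sum>i\<in>A. f i) = (\<Sum>i\<in>A. total_degree (f i))"
  by (induction A rule: infinite_finite_induct) (auto simp: total_degree_add)

lemma total_degree_row_monom: "total_degree (row_monom p c \<kappa>) = p"
  by (simp add: row_monom_def total_degree_sum)

lemma row_monom_inj:
  assumes "row_monom p c \<kappa> = row_monom p c' \<kappa>'" "i < p"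
  shows "c i = c' i" "\<kappa> i = \<kappa>' i"
proof -
  have "Poly_Mapping.lookup (row_monom p c' \<kappa>') (i + 1, c i, \<kappa> i) = 1"
    using assms(2) by (subst assms(1)[symmetric]) (simp add: lookup_row_monom)
  then show "c i = c' i" "\<kappa> i = \<kappa>' i" by (auto simp: lookup_row_monom split: if_splits)
qed

lemma prod_var: "(\<Prod>i\<in>A. var (f i)) = Poly_Mapping.single (\<Sum>i\<in>A. Poly_Mapping.single (f i) 1) 1"
  by (induction A rule: infinite_finite_induct) (auto simp: var_def mult_single)

lemma lookup_of_int_mult:
  "Poly_Mapping.lookup (of_int c * f :: 'v mpoly) m = of_int c * Poly_Mapping.lookup f m"
proof -
  have "(of_int c :: 'v mpoly) = const (of_int c)"
    unfolding const_def by (simp flip: single_of_int)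
  then show ?thesis by (metis lookup_mpoly_scale mpoly_scale_def)
qed

text \<open>A term of the expansion is a permutation together with a distribution of
  \<open>k\<close> over the \<open>p\<close> rows; \<open>natpermute k p\<close> consists of the
  lists of length \<open>p\<close> with sum \<open>k\<close>.\<close>

lemma lookup_coldet:
  assumes "1 \<le> p"
  shows "Poly_Mapping.lookup (fps_nth (coldet p c) k) m =
    (\<Sum>\<tau> | \<tau> permutes {0..<p}. of_int (sign \<tau>) *
      (\<Sum>v\<in>natpermute k p. if row_monom p (\<lambda>i. c (\<tau> i)) ((!) v) = m then 1 else 0))"
proof -
  have eq: "{0..<p} = {0..p - 1}" using assms by auto
  have "fps_nth (\<Prod>i = 0..<p. z_series (i + 1) (g i)) k =
      (\<Sum>v\<in>natpermute k p. Poly_Mapping.single (row_monom p g ((!) v)) 1)" for g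
  proof -
    have "fps_nth (\<Prod>i = 0..p - 1. z_series (i + 1) (g i)) k =
        (\<Sum>v\<in>natpermute k (p - 1 + 1). \<Prod>j = 0..p - 1. fps_nth (z_series (j + 1) (g j)) (v ! j))"
      by (rule fps_prod_nth)
    also have "\<dots> = (\<Sum>v\<in>natpermute k p. Poly_Mapping.single (row_monom p g ((!) v)) 1)"
      using assms by (simp add: z_series_def prod_var row_monom_def eq)
    finally show ?thesis unfolding eq .
  qed
  moreover have "fps_nth (of_int a * f) k = of_int a * fps_nth f k" for a and f :: "zvar mpoly fps"
    by (simp flip: fps_of_int)
  ultimately show ?thesis
    by (simp add: coldet_expand fps_sum_nth lookup_sum lookup_of_int_mult lookup_single when_def)
qed

text \<open>Global rows: the pair of local row \<open>i\<close> and exponent \<open>\<kappa>\<close> is encoded as \<open>p * \<kappa> + i\<close>, so that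
  the variables are ordered by global row and then by column.\<close>

lemma zvar_less_global:
  assumes "i < p" "i' < p"
  shows "zvar_less (i + 1, c, \<kappa>) (i' + 1, c', \<kappa>') \<longleftrightarrow>
    p * \<kappa> + i < p * \<kappa>' + i' \<or> p * \<kappa> + i = p * \<kappa>' + i' \<and> c < c'"
proof -
  have 1: "p * \<kappa> + i < p * \<kappa>' + i'" if "\<kappa> < \<kappa>'" "i < p" for \<kappa> \<kappa>' i i'
  proof -
    have "p * \<kappa> + p \<le> p * \<kappa>'" using mult_le_mono2[of "Suc \<kappa>" \<kappa>' p] that(1) by simp
    then show ?thesis using that(2) by simp
  qed
  show ?thesis
  proof (cases \<kappa> \<kappa>' rule: linorder_cases)
    case less
    then show ?thesis using 1[OF less assms(1), of i'] by (simp add: zvar_less.simps)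
  next
    case equal
    then show ?thesis by (auto simp: zvar_less.simps)
  next
    case greater
    then show ?thesis using 1[OF greater assms(2), of i] by (simp add: zvar_less.simps)
  qed
qed

text \<open>The global rows from \<open>k + 1\<close> to \<open>k + p\<close> represent each residue
  modulo \<open>p\<close> once, so each local row meets exactly one of them. Counting columns and
  local rows from 0, column \<open>l\<close> belongs to global row \<open>k + p - l\<close>; solving
  \<open>p * e + i + 1 = k + p - l\<close> with \<open>l < p\<close> is division of
  \<open>k + p - 1 - i\<close> by \<open>p\<close>, with quotient \<open>lead_exp\<close> and
  remainder \<open>lead_perm\<close>.\<close>

definition lead_perm :: "nat \<Rightarrow> nat \<Rightarrow> nat \<Rightarrow> nat"
  where "lead_perm p k i = (if i < p then (k + p - 1 - i) mod p else i)"

definition lead_exp :: "nat \<Rightarrow> nat \<Rightarrow> nat \<Rightarrow> nat"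
  where "lead_exp p k i = (k + p - 1 - i) div p"

lemma lead_perm_exp: "i < p \<Longrightarrow> p * lead_exp p k i + lead_perm p k i = k + p - 1 - i"
  by (simp add: lead_perm_def lead_exp_def)

lemma lead_perm_lt: "i < p \<Longrightarrow> lead_perm p k i < p"
  by (simp add: lead_perm_def)

definition gen_monom :: "nat \<Rightarrow> nat list \<times> nat \<Rightarrow> zvar monom"
  where "gen_monom p = (\<lambda>(I, k). row_monom p (\<lambda>i. I ! lead_perm p k i) (lead_exp p k))"

lemma lead_perm_permutes: "lead_perm p k permutes {0..<p}"
proof (rule bij_imp_permutes)
  have "inj_on (lead_perm p k) {0..<p}"
  proof (rule inj_onI)
    fix i j assume ij: "i \<in> {0..<p}" "j \<in> {0..<p}" "lead_perm p k i = lead_perm p k j"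
    then have "[k + p - 1 - i = k + p - 1 - j] (mod p)" by (simp add: lead_perm_def cong_def)
    moreover have "i + (k + p - 1 - i) = j + (k + p - 1 - j)" using ij by auto
    ultimately have "[i + (k + p - 1 - i) = j + (k + p - 1 - i)] (mod p)"
      by (metis cong_add_lcancel_nat cong_sym)
    then have "[i = j] (mod p)" using cong_add_rcancel_nat by blast
    then show "i = j" using ij by (simp add: cong_def)
  qed
  moreover have "lead_perm p k ` {0..<p} \<subseteq> {0..<p}" by (auto simp: lead_perm_lt)
  ultimately show "bij_betw (lead_perm p k) {0..<p} {0..<p}"
    by (simp add: bij_betw_def endo_inj_surj)
qed (simp add: lead_perm_def)

text \<open>Sum the division identity over all rows: the remainders run through \<open>0\<close>,
  ..., \<open>p - 1\<close>, so what is left for the quotients is \<open>k\<close>.\<close>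

lemma sum_lead_exp:
  assumes "1 \<le> p"
  shows "(\<Sum>i = 0..<p. lead_exp p k i) = k"
proof -
  have "(\<Sum>i = 0..<p. p * lead_exp p k i + lead_perm p k i + i) = (\<Sum>i = 0..<p. k + p - 1)"
    by (rule sum.cong) (use lead_perm_exp[of _ p k] in auto)
  moreover have "(\<Sum>i = 0..<p. lead_perm p k i) = (\<Sum>i = 0..<p. i)"
    using sum.permute[OF lead_perm_permutes, of id p k] by simp
  moreover have "2 * (\<Sum>i = 0..<p. i) = p * (p - 1)"
    by (induction p) (auto simp: algebra_simps)
  ultimately have "p * (\<Sum>i = 0..<p. lead_exp p k i) + p * (p - 1) = p * (k + p - 1)"
    unfolding sum.distrib sum_distrib_left[symmetric] by simp
  also have "\<dots> = p * k + p * (p - 1)" using assms by (simp add: algebra_simps)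
  finally show ?thesis using assms by simp
qed

text \<open>Look at the last variable \<open>v\<close> in which the two monomials differ. If it
  belonged to \<open>gen_monom\<close>, no row of the competitor could have a larger exponent than
  in \<open>gen_monom\<close>; equal sums would make all exponents agree, and then the column in the
  row of \<open>v\<close> leads to a contradiction. So \<open>v\<close> belongs to the competitor,
  which is therefore smaller.\<close>

lemma row_monom_le_gen_monom:
  assumes p: "1 \<le> p" and I: "length I = p" "sorted_wrt (<) I"
    and \<tau>: "\<tau> permutes {0..<p}" and \<kappa>: "(\<Sum>i = 0..<p. \<kappa> i) = k"
  shows "row_monom p (\<lambda>i. I ! \<tau> i) \<kappa> = gen_monom p (I, k) \<or>
    ss_less (row_monom p (\<lambda>i. I ! \<tau> i) \<kappa>) (gen_monom p (I, k))"
proof -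
  define S where "S = (\<lambda>i. (i + 1, I ! \<tau> i, \<kappa> i)) ` {0..<p}"
  define T where "T = (\<lambda>i. (i + 1, I ! lead_perm p k i, lead_exp p k i)) ` {0..<p}"
  let ?e = "lead_exp p k" and ?l = "lead_perm p k"
  have memS: "(i + 1, c, e) \<in> S \<longleftrightarrow> i < p \<and> c = I ! \<tau> i \<and> e = \<kappa> i" for i c e
    by (auto simp: S_def)
  have memT: "(i + 1, c, e) \<in> T \<longleftrightarrow> i < p \<and> c = I ! ?l i \<and> e = ?e i" for i c e
    by (auto simp: T_def)
  have \<tau>p: "\<tau> i < p" if "i < p" for i using permutes_in_image[OF \<tau>, of i] that by simp
  have gT: "p * ?e i + i = k + p - 1 - ?l i" if "i < p" for i
    using lead_perm_exp[OF that, of k] that by simp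
  show ?thesis
  proof (cases "S = T")
    case True
    then have "row_monom p (\<lambda>i. I ! \<tau> i) \<kappa> = gen_monom p (I, k)"
      by (intro poly_mapping_eqI) (simp add: gen_monom_def lookup_row_monom S_def T_def)
    then show ?thesis ..
  next
    case False
    let ?V = "(S - T) \<union> (T - S)"
    have "finite ?V" "?V \<noteq> {}" using False by (auto simp: S_def T_def)
    then obtain v where v: "v \<in> ?V" "\<And>w. zvar_less v w \<Longrightarrow> w \<in> S \<longleftrightarrow> w \<in> T"
      using finite_zvar_max[of ?V] by blast
    have "v \<notin> T - S"
    proof
      assume vT: "v \<in> T - S"
      then obtain i0 where i0: "i0 < p" "v = (i0 + 1, I ! ?l i0, ?e i0)" by (auto simp: T_def)
      have agree: "\<kappa> i = ?e i \<and> I ! \<tau> i = I ! ?l i"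
        if "i < p" "p * ?e i + i > p * ?e i0 + i0" for i
      proof -
        have "zvar_less v (i + 1, I ! ?l i, ?e i)"
          unfolding i0(2) using that i0(1) by (subst zvar_less_global) auto
        then have "(i + 1, I ! ?l i, ?e i) \<in> S" using v(2) memT that(1) by blast
        then show ?thesis using memS by metis
      qed
      \<comment> \<open>The global rows of \<open>gen_monom\<close> fill a window of length
        \<open>p\<close>, so one more unit of exponent in row \<open>i\<close> would push the
        variable past the end of the window and hence beyond \<open>v\<close>.\<close>
      have le: "\<kappa> i \<le> ?e i" if i: "i < p" for i
      proof (cases "p * ?e i + i > p * ?e i0 + i0")
        case False
        have "p * \<kappa> i + i \<le> p * ?e i0 + i0"
        proof (rule ccontr)
          assume gt: "\<not> ?thesis"
          then have "zvar_less v (i + 1, I ! \<tau> i, \<kappa> i)"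
            unfolding i0(2) using i i0(1) by (subst zvar_less_global) auto
          then have "(i + 1, I ! \<tau> i, \<kappa> i) \<in> T" using v(2) memS i by blast
          then have "\<kappa> i = ?e i" using memT by blast
          then show False using gt False by simp
        qed
        also have "\<dots> \<le> k + p - 1" using gT[OF i0(1)] by simp
        also have "k + p - 1 < p * ?e i + i + p"
          using gT[OF i] lead_perm_lt[OF i, of k] by simp
        finally have "p * \<kappa> i < p * (?e i + 1)" by simp
        then have "\<kappa> i < ?e i + 1" by (simp only: nat_mult_less_cancel_disj)
        then show ?thesis by simp
      qed (use agree i in auto)
      have "(\<Sum>i = 0..<p. \<kappa> i) = (\<Sum>i = 0..<p. ?e i)"
        using \<kappa> sum_lead_exp[OF p] by simp
      then have eq: "\<kappa> i = ?e i" if "i < p" for i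
        using sum_mono_inv[of \<kappa> "{0..<p}" ?e i] le that by auto
      have ne: "I ! \<tau> i0 \<noteq> I ! ?l i0"
        using vT memS[of i0] i0 eq by auto
      have mono: "I ! a < I ! b \<longleftrightarrow> a < b" if "a < p" "b < p" for a b
        using that I by (metis linorder_neqE_nat order.asym sorted_wrt_nth_less)
      show False
      proof (cases "I ! \<tau> i0 > I ! ?l i0")
        case True
        then have "zvar_less v (i0 + 1, I ! \<tau> i0, \<kappa> i0)"
          unfolding i0(2) using i0(1) eq by (subst zvar_less_global) auto
        then have "(i0 + 1, I ! \<tau> i0, \<kappa> i0) \<in> T" using v(2) memS i0(1) by blast
        then show False using ne memT by metis
      next
        case False
        then have lt: "\<tau> i0 < ?l i0"
          using ne mono \<tau>p lead_perm_lt i0(1) by (meson linorder_neqE_nat)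
        \<comment> \<open>In \<open>gen_monom\<close> this smaller column sits in a later global
          row, where both monomials already agree; the competitor would use it twice.\<close>
        have "\<tau> i0 \<in> ?l ` {0..<p}"
          using permutes_image[OF lead_perm_permutes] \<tau>p i0(1) by simp
        then obtain i where i: "i < p" "?l i = \<tau> i0" by auto
        have "p * ?e i + i > p * ?e i0 + i0"
          using gT[OF i(1)] gT[OF i0(1)] lt i(2) lead_perm_lt[OF i0(1), of k] by simp
        then have "I ! \<tau> i = I ! \<tau> i0" using agree[OF i(1)] i(2) by simp
        then have "\<tau> i = \<tau> i0"
          using mono[of "\<tau> i" "\<tau> i0"] mono[of "\<tau> i0" "\<tau> i"] \<tau>p i i0 by auto
        then have "i = i0" using permutes_inj[OF \<tau>] by (meson injD)
        then show False using i(2) lt by simp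
      qed
    qed
    then have "v \<in> S - T" using v(1) by blast
    moreover have "Poly_Mapping.lookup (row_monom p (\<lambda>i. I ! \<tau> i) \<kappa>) w = (if w \<in> S then 1 else 0)" for w
      unfolding S_def by (rule lookup_row_monom)
    moreover have "Poly_Mapping.lookup (gen_monom p (I, k)) w = (if w \<in> T then 1 else 0)" for w
      unfolding T_def gen_monom_def prod.case by (rule lookup_row_monom)
    moreover have "total_degree (gen_monom p (I, k)) = p"
      by (simp add: gen_monom_def total_degree_row_monom)
    ultimately have "ss_less (row_monom p (\<lambda>i. I ! \<tau> i) \<kappa>) (gen_monom p (I, k))"
      unfolding ss_less_def degrevlex_less_def using v(2)
      by (intro disjI2 conjI exI[of _ v]) (simp_all add: total_degree_row_monom)
    then show ?thesis ..
  qed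
qed

section \<open>Signs of the leading permutations\<close>

lemma sign_cyclic_shift:
  "1 \<le> p \<Longrightarrow> (\<lambda>i. if i < p then (i + 1) mod p else i) permutes {0..<p} \<and>
    sign (\<lambda>i. if i < p then (i + 1) mod p else i) = (-1) ^ (p - 1)"
proof (induction p rule: nat_induct_at_least)
  case base
  have "(\<lambda>i::nat. if i < 1 then (i + 1) mod 1 else i) = id" by auto
  then show ?case by (simp add: permutes_id)
next
  case (Suc p)
  let ?c = "\<lambda>p i. if i < p then (i + 1) mod p else i"
  \<comment> \<open>Only two values change: \<open>p - 1\<close>, which used to wrap to
    \<open>0\<close>, now goes to \<open>p\<close>, and \<open>p\<close> wraps to
    \<open>0\<close>.\<close>
  have eq: "?c (Suc p) = transpose 0 p \<circ> ?c p"
    using Suc.hyps by (auto simp: fun_eq_iff transpose_def mod_Suc)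
  have 1: "?c p permutes {0..<Suc p}"
    using Suc.IH by (meson permutes_subset atLeastLessThan_iff less_SucI subsetI)
  have 2: "transpose 0 p permutes {0..<Suc p}" by (rule permutes_swap_id) auto
  have "sign (transpose 0 p \<circ> ?c p) = sign (transpose 0 p) * sign (?c p)"
    using 1 2 by (intro sign_compose) (auto intro: permutes_imp_permutation)
  also have "\<dots> = (-1) ^ p" using Suc by (cases p) (auto simp: sign_swap_id)
  finally show ?case using permutes_compose[OF 1 2] unfolding eq by simp
qed

text \<open>Reversing \<open>p + 1\<close> points is reversing the first \<open>p\<close> and then
  rotating all of them, and \<open>Suc p choose 2\<close> is
  \<open>(p choose 2) + p\<close>.\<close>

lemma sign_reversal:
  "(\<lambda>i. if i < p then p - 1 - i else i) permutes {0..<p} \<and>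
    sign (\<lambda>i. if i < p then p - 1 - i else i) = (-1) ^ (p choose 2)"
proof (induction p)
  case 0
  then show ?case by (simp add: permutes_id numeral_2_eq_2 flip: id_def)
next
  case (Suc p)
  let ?r = "\<lambda>p i. if i < p then p - 1 - i else i"
  let ?c = "\<lambda>i. if i < Suc p then (i + 1) mod Suc p else i"
  have eq: "?r (Suc p) = ?c \<circ> ?r p"
    by (auto simp: fun_eq_iff not_less less_Suc_eq_le dest: le_antisym)
  have 1: "?r p permutes {0..<Suc p}"
    using Suc.IH by (meson permutes_subset atLeastLessThan_iff less_SucI subsetI)
  have 2: "?c permutes {0..<Suc p}" "sign ?c = (-1) ^ p"
    using sign_cyclic_shift[of "Suc p"] by simp_all
  have "sign (?c \<circ> ?r p) = sign ?c * sign (?r p)"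
    using 1 2 by (intro sign_compose) (auto intro: permutes_imp_permutation)
  also have "\<dots> = (-1) ^ (Suc p choose 2)"
    using Suc 2(2) by (simp add: numeral_2_eq_2 power_add)
  finally show ?case using permutes_compose[OF 1 2(1)] unfolding eq by simp
qed

text \<open>Raising \<open>k\<close> by one composes the permutation with the cyclic shift of sign
  \<open>(-1) ^ (p - 1)\<close>; for \<open>k = 0\<close> it is the reversal.\<close>

lemma sign_lead_perm:
  assumes "1 \<le> p"
  shows "sign (lead_perm p k) = (-1) ^ ((p choose 2) + k * (p - 1))"
proof (induction k)
  case 0
  have "lead_perm p 0 = (\<lambda>i. if i < p then p - 1 - i else i)"
    using assms by (auto simp: lead_perm_def fun_eq_iff)
  then show ?case using sign_reversal[of p] by simp
next
  case (Suc k)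
  let ?c = "\<lambda>i. if i < p then (i + 1) mod p else i"
  have "lead_perm p (Suc k) = ?c \<circ> lead_perm p k"
  proof
    fix i
    have "Suc k + p - 1 - i = Suc (k + p - 1 - i)" if "i < p" using that by simp
    then show "lead_perm p (Suc k) i = (?c \<circ> lead_perm p k) i"
      using lead_perm_lt[of i p k] by (simp add: lead_perm_def mod_Suc_eq)
  qed
  moreover have "sign (?c \<circ> lead_perm p k) = sign ?c * sign (lead_perm p k)"
    using sign_cyclic_shift[OF assms] lead_perm_permutes[of p k]
    by (intro sign_compose) (auto intro: permutes_imp_permutation)
  ultimately have "sign (lead_perm p (Suc k)) = (-1) ^ (p - 1) * (-1) ^ ((p choose 2) + k * (p - 1))"
    using sign_cyclic_shift[OF assms] Suc by metis
  then show ?case by (simp add: power_add)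
qed

lemma sign_lead_perm_cong:
  assumes "1 \<le> p" "[k = r] (mod p)"
  shows "sign (lead_perm p k) = (-1) ^ ((p choose 2) + r * (p - 1))"
proof -
  have "lead_perm p k i = lead_perm p r i" for i
  proof -
    have "(k + p - 1 - i) mod p = (r + p - 1 - i) mod p" if "i < p"
    proof -
      have "[k + (p - 1 - i) = r + (p - 1 - i)] (mod p)"
        using assms(2) by (rule cong_add) simp
      then show ?thesis using that by (simp add: cong_def)
    qed
    then show ?thesis by (simp add: lead_perm_def)
  qed
  then have "lead_perm p k = lead_perm p r" by blast
  then show ?thesis using sign_lead_perm[OF assms(1)] by simp
qed

text \<open>The entries of an increasing tuple are distinct, so only one pair of a permutation and a
  distribution of \<open>k\<close> produces this monomial. Nothing cancels, and the coefficient is a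
  single sign.\<close>

lemma D_coeff_leading:
  assumes p: "1 \<le> p" and I: "I \<in> increasing_tuples p n"
  shows "leading_monom (gen_monom p (I, k)) (D_coeff p I k)"
    and "Poly_Mapping.lookup (D_coeff p I k) (gen_monom p (I, k)) = of_int (sign (lead_perm p k))"
proof -
  have len: "length I = p" and sorted: "sorted_wrt (<) I"
    using I by (auto simp: increasing_tuples_def tuples_def)
  have inj: "I ! a = I ! b \<longleftrightarrow> a = b" if "a < p" "b < p" for a b
    using that len sorted by (metis linorder_neqE_nat order.irrefl sorted_wrt_nth_less)
  have lk: "Poly_Mapping.lookup (D_coeff p I k) m =
    (\<Sum>\<tau> | \<tau> permutes {0..<p}. of_int (sign \<tau>) *
      (\<Sum>v\<in>natpermute k p. if row_monom p (\<lambda>i. I ! \<tau> i) ((!) v) = m then 1 else 0))" for m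
    unfolding D_coeff_coldet by (rule lookup_coldet[OF p])
  define v0 where "v0 = map (lead_exp p k) [0..<p]"
  have v0: "v0 \<in> natpermute k p"
    using sum_lead_exp[OF p, of k] by (simp add: natpermute_def v0_def interv_sum_list_conv_sum_set_nat)
  have fin: "finite (natpermute k p)" by (rule natpermute_finite)
  have uniq: "row_monom p (\<lambda>i. I ! \<tau> i) ((!) v) = gen_monom p (I, k) \<longleftrightarrow> \<tau> = lead_perm p k \<and> v = v0"
    if \<tau>: "\<tau> permutes {0..<p}" and v: "v \<in> natpermute k p" for \<tau> v
  proof
    assume eq: "row_monom p (\<lambda>i. I ! \<tau> i) ((!) v) = gen_monom p (I, k)"
    have *: "\<tau> i = lead_perm p k i" "v ! i = lead_exp p k i" if "i < p" for i
    proof -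
      have "I ! \<tau> i = I ! lead_perm p k i" "v ! i = lead_exp p k i"
        using row_monom_inj[OF eq[unfolded gen_monom_def prod.case] that] .
      moreover have "\<tau> i < p" using permutes_in_image[OF \<tau>, of i] that by simp
      ultimately show "\<tau> i = lead_perm p k i" "v ! i = lead_exp p k i"
        using inj lead_perm_lt[OF that] by auto
    qed
    have "\<tau> i = lead_perm p k i" for i
      using *(1)[of i] permutes_not_in[OF \<tau>, of i] by (cases "i < p") (auto simp: lead_perm_def)
    moreover have "v = v0"
      using v * by (intro nth_equalityI) (auto simp: natpermute_def v0_def)
    ultimately show "\<tau> = lead_perm p k \<and> v = v0" by blast
  next
    assume "\<tau> = lead_perm p k \<and> v = v0"
    then show "row_monom p (\<lambda>i. I ! \<tau> i) ((!) v) = gen_monom p (I, k)"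
      by (auto simp: gen_monom_def row_monom_def v0_def)
  qed
  have "Poly_Mapping.lookup (D_coeff p I k) (gen_monom p (I, k)) =
    (\<Sum>\<tau> | \<tau> permutes {0..<p}. of_int (sign \<tau>) *
      (\<Sum>v\<in>natpermute k p. if \<tau> = lead_perm p k \<and> v = v0 then 1 else 0))"
    unfolding lk using uniq by (intro sum.cong refl arg_cong2[where f = "(*)"]) auto
  also have "\<dots> = (\<Sum>\<tau> | \<tau> permutes {0..<p}. if \<tau> = lead_perm p k then of_int (sign \<tau>) else 0)"
    using v0 fin by (intro sum.cong refl) auto
  also have "\<dots> = of_int (sign (lead_perm p k))"
    using lead_perm_permutes by (simp add: finite_permutations)
  finally show eq: "Poly_Mapping.lookup (D_coeff p I k) (gen_monom p (I, k)) = of_int (sign (lead_perm p k))" .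
  have "m = gen_monom p (I, k) \<or> ss_less m (gen_monom p (I, k))"
    if "m \<in> Poly_Mapping.keys (D_coeff p I k)" for m
  proof -
    have "Poly_Mapping.lookup (D_coeff p I k) m \<noteq> 0" using that by (simp add: in_keys_iff)
    then obtain \<tau> where \<tau>: "\<tau> permutes {0..<p}"
      "(\<Sum>v\<in>natpermute k p. if row_monom p (\<lambda>i. I ! \<tau> i) ((!) v) = m then 1 else 0) \<noteq> (0::complex)"
      unfolding lk by (elim sum.not_neutral_contains_not_neutral) auto
    from \<tau>(2) obtain v where v: "v \<in> natpermute k p" "row_monom p (\<lambda>i. I ! \<tau> i) ((!) v) = m"
      by (elim sum.not_neutral_contains_not_neutral) (auto split: if_splits)
    have "(\<Sum>i = 0..<p. v ! i) = k"
      using v(1) by (auto simp: natpermute_def sum_list_sum_nth)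
    then show ?thesis using row_monom_le_gen_monom[OF p len sorted \<tau>(1), of "(!) v" k] v(2) by simp
  qed
  moreover have "gen_monom p (I, k) \<in> Poly_Mapping.keys (D_coeff p I k)"
    using eq by (simp add: in_keys_iff)
  ultimately show "leading_monom (gen_monom p (I, k)) (D_coeff p I k)"
    by (auto simp: leading_monom_def)
qed

section \<open>Exchange relations\<close>

lemma eq_uminus_imp_zero:
  assumes "(f :: 'v mpoly fps) = - f"
  shows "f = 0"
proof (intro fps_ext poly_mapping_eqI)
  fix n m
  have "Poly_Mapping.lookup (fps_nth f n) m = - Poly_Mapping.lookup (fps_nth f n) m"
    using arg_cong[OF assms, of "\<lambda>f. Poly_Mapping.lookup (fps_nth f n) m"] by simp
  then show "Poly_Mapping.lookup (fps_nth f n) m = Poly_Mapping.lookup (fps_nth 0 n) m" by simp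
qed

lemma coldet_cong: "(\<And>j. j < p \<Longrightarrow> c j = c' j) \<Longrightarrow> coldet p c = coldet p c'"
  unfolding coldet_def by (intro arg_cong[where f = Determinant.det] eq_matI) auto

lemma coldet_permute:
  assumes \<pi>: "\<pi> permutes {0..<p}"
  shows "coldet p (\<lambda>j. c (\<pi> j)) = of_int (sign \<pi>) * coldet p c"
proof -
  have "coldet p c = (\<Sum>\<tau> | \<tau> permutes {0..<p}.
      of_int (sign (\<pi> \<circ> \<tau>)) * (\<Prod>i = 0..<p. z_series (i + 1) (c ((\<pi> \<circ> \<tau>) i))))"
    unfolding coldet_expand by (rule setum_permutations_compose_left[OF \<pi>])
  also have "\<dots> = (\<Sum>\<tau> | \<tau> permutes {0..<p}. of_int (sign \<pi>) * (of_int (sign \<tau>) *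
      (\<Prod>i = 0..<p. z_series (i + 1) (c (\<pi> (\<tau> i))))))"
    using \<pi> by (intro sum.cong refl)
      (auto simp: sign_compose permutes_imp_permutation[of "{0..<p}"] mult.assoc)
  also have "\<dots> = of_int (sign \<pi>) * coldet p (\<lambda>j. c (\<pi> j))"
    by (simp add: coldet_expand sum_distrib_left)
  finally have "of_int (sign \<pi>) * coldet p c =
      of_int (sign \<pi> * sign \<pi>) * coldet p (\<lambda>j. c (\<pi> j))"
    by (simp only: of_int_mult mult.assoc)
  then show ?thesis by simp
qed

text \<open>A repeated column makes the determinant its own negative. The column sum is carried
  along because it enters the weight that controls straightening.\<close>

lemma coldet_sort:
  assumes g: "\<And>i. i < p \<Longrightarrow> g i \<in> {1..n}"
  shows "coldet p g = 0 \<or> (\<exists>I\<in>increasing_tuples p n. \<exists>\<epsilon>::int.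
    sum_list I = (\<Sum>i = 0..<p. g i) \<and> coldet p g = of_int \<epsilon> * coldet p ((!) I))"
proof (cases "inj_on g {0..<p}")
  case True
  define xs where "xs = map g [0..<p]"
  define I where "I = sort xs"
  have len: "length xs = p" "length I = p" by (simp_all add: xs_def I_def)
  have "distinct xs" using True by (simp add: xs_def distinct_map)
  then have sorted: "sorted_wrt (<) I" by (simp add: I_def strict_sorted_iff)
  have ms: "mset xs = mset I" by (simp add: I_def)
  obtain \<pi> where \<pi>: "\<pi> permutes {..<length I}" "permute_list \<pi> I = xs"
    by (rule mset_eq_permutation[OF ms])
  have \<pi>': "\<pi> permutes {0..<p}" using \<pi>(1) len by (simp add: lessThan_atLeast0)
  have "g i = I ! \<pi> i" if "i < p" for i
  proof -
    have "xs ! i = I ! \<pi> i" unfolding \<pi>(2)[symmetric] using that \<pi>(1) len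
      by (intro permute_list_nth) auto
    then show ?thesis using that by (simp add: xs_def)
  qed
  then have "coldet p g = of_int (sign \<pi>) * coldet p ((!) I)"
    using coldet_cong[of p g "\<lambda>j. I ! \<pi> j"] coldet_permute[OF \<pi>', of "(!) I"] by simp
  moreover have "I \<in> increasing_tuples p n"
    using sorted g len by (auto simp: increasing_tuples_def tuples_def I_def xs_def)
  moreover have "sum_list I = (\<Sum>i = 0..<p. g i)"
  proof -
    have "sum_list I = sum_list xs" using ms by (metis sum_mset_sum_list)
    then show ?thesis by (simp add: xs_def interv_sum_list_conv_sum_set_nat)
  qed
  ultimately show ?thesis by blast
next
  case False
  then obtain a b where ab: "a < p" "b < p" "a \<noteq> b" "g a = g b" by (auto simp: inj_on_def)
  have t: "transpose a b permutes {0..<p}" using ab by (intro permutes_swap_id) auto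
  have "(\<lambda>j. g (transpose a b j)) = g" using ab(4) by (auto simp: transpose_def fun_eq_iff)
  then have "coldet p g = - coldet p g"
    using coldet_permute[OF t, of g] ab(3) by (simp add: sign_swap_id)
  then show ?thesis using eq_uminus_imp_zero by blast
qed

section \<open>The Euler operator on products of power series\<close>

lemma funpow_XD_nth: "fps_nth ((fps_XD ^^ s) f) n = of_nat n ^ s * fps_nth f n"
  by (induction s) (simp_all add: mult.assoc)

lemma funpow_XD_sum: "(fps_XD ^^ s) (\<Sum>i\<in>A. f i) = (\<Sum>i\<in>A. (fps_XD ^^ s) (f i))"
  by (rule fps_ext) (simp add: funpow_XD_nth fps_sum_nth sum_distrib_left)

lemma funpow_XD_of_int_mult:
  "(fps_XD ^^ s) (of_int a * f :: 'a::comm_ring_1 fps) = of_int a * (fps_XD ^^ s) f"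
  by (rule fps_ext) (simp add: funpow_XD_nth mult_ac flip: fps_of_int)

lemma XD_mult: "fps_XD (f * g :: 'a::comm_ring_1 fps) = fps_XD f * g + f * fps_XD g"
  by (simp add: fps_XD_def algebra_simps)

lemma XD_prod:
  fixes g :: "'i \<Rightarrow> 'a::comm_ring_1 fps"
  assumes "finite A"
  shows "fps_XD (\<Prod>i\<in>A. g i) = (\<Sum>j\<in>A. \<Prod>i\<in>A. if i = j then fps_XD (g i) else g i)"
  using assms
proof (induction A)
  case empty
  then show ?case by (rule_tac fps_ext) simp
next
  case (insert x A)
  have "(\<Prod>i\<in>A. if i = x then fps_XD (g i) else g i) = (\<Prod>i\<in>A. g i)"
    using insert.hyps by (intro prod.cong) auto
  moreover have "(\<Sum>j\<in>A. \<Prod>i\<in>insert x A. if i = j then fps_XD (g i) else g i) =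
      g x * (\<Sum>j\<in>A. \<Prod>i\<in>A. if i = j then fps_XD (g i) else g i)"
    unfolding sum_distrib_left using insert.hyps by (intro sum.cong) auto
  ultimately show ?case using insert by (simp add: XD_mult)
qed

text \<open>The word \<open>w\<close> lists the factors hit by the successive derivations.\<close>

lemma funpow_XD_prod:
  fixes g :: "'i \<Rightarrow> 'a::comm_ring_1 fps"
  assumes "finite A"
  shows "(fps_XD ^^ s) (\<Prod>i\<in>A. g i) =
    (\<Sum>w | set w \<subseteq> A \<and> length w = s. \<Prod>i\<in>A. (fps_XD ^^ count_list w i) (g i))"
proof (induction s)
  case 0
  have "{w. set w \<subseteq> A \<and> length w = 0} = {[]}" by auto
  then show ?case by simp
next
  case (Suc s)
  let ?W = "\<lambda>s. {w. set w \<subseteq> A \<and> length w = s}"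
  have fin: "finite (?W s)" using assms by (rule finite_lists_length_eq)
  have "(fps_XD ^^ Suc s) (\<Prod>i\<in>A. g i) = fps_XD (\<Sum>w\<in>?W s. \<Prod>i\<in>A. (fps_XD ^^ count_list w i) (g i))"
    using Suc by simp
  also have "\<dots> = (\<Sum>w\<in>?W s. fps_XD (\<Prod>i\<in>A. (fps_XD ^^ count_list w i) (g i)))"
    using funpow_XD_sum[of 1] by simp
  also have "\<dots> = (\<Sum>w\<in>?W s. \<Sum>j\<in>A. \<Prod>i\<in>A. (fps_XD ^^ count_list (j # w) i) (g i))"
    unfolding XD_prod[OF assms] by (intro sum.cong prod.cong refl) auto
  also have "\<dots> = (\<Sum>x\<in>?W s \<times> A. \<Prod>i\<in>A. (fps_XD ^^ count_list (snd x # fst x) i) (g i))"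
    by (simp add: sum.cartesian_product case_prod_beta)
  also have "\<dots> = (\<Sum>w\<in>(\<lambda>(w, j). j # w) ` (?W s \<times> A). \<Prod>i\<in>A. (fps_XD ^^ count_list w i) (g i))"
    by (subst sum.reindex) (auto simp: inj_on_def case_prod_beta)
  finally show ?case unfolding lists_length_Suc_eq .
qed

text \<open>Antisymmetrising over \<open>p + d + 1\<close> columns forces \<open>d + 1\<close> rows to occur in both
  determinants. At most \<open>d\<close> derivations leave one of them underived, and exchanging its two
  columns changes the sign.\<close>

lemma exchange_relation:
  assumes x: "x + d < p" and "s \<le> d"
  shows "(\<Sum>\<sigma> | \<sigma> permutes {x..<p + x + d + 1}. of_int (sign \<sigma>) *
    ((fps_XD ^^ s) (coldet p (\<lambda>j. c (\<sigma> j))) * coldet p (\<lambda>j. c (\<sigma> (p + j))))) = 0"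
proof -
  let ?P = "{x..<p + x + d + 1}"
  define W where "W = {w. set w \<subseteq> {0..<p} \<and> length w = s}"
  define T where "T = {\<tau>. \<tau> permutes {0..<p}}"
  \<comment> \<open>Positions below \<open>p\<close> are the columns of the first determinant, the
    next \<open>p\<close> those of the second; \<open>?P\<close> is a tail of the first followed by
    a head of the second. \<open>F\<close> is one term of the two expansions, and \<open>w\<close>
    records the rows that are derived.\<close>
  define F where "F \<tau> w \<rho> \<sigma> =
      (\<Prod>i = 0..<p. (fps_XD ^^ count_list w i) (z_series (i + 1) (c (\<sigma> (\<tau> i))))) *
      (\<Prod>i = 0..<p. z_series (i + 1) (c (\<sigma> (p + \<rho> i))))" for \<tau> w \<rho> \<sigma>
  have key: "(\<Sum>\<sigma> | \<sigma> permutes ?P. of_int (sign \<sigma>) * F \<tau> w \<rho> \<sigma>) = 0"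
    if \<tau>: "\<tau> \<in> T" and \<rho>: "\<rho> \<in> T" and w: "w \<in> W" for \<tau> w \<rho>
  proof -
    have \<tau>p: "\<tau> permutes {0..<p}" and \<rho>p: "\<rho> permutes {0..<p}" using \<tau> \<rho> by (auto simp: T_def)
    obtain i where i: "i < p" "x \<le> \<tau> i" "\<rho> i < x + d + 1" "count_list w i = 0"
    proof -
      \<comment> \<open>\<open>?A\<close> and \<open>?B\<close> are the rows that use a position of
        \<open>?P\<close> in the first and in the second determinant; their sizes
        \<open>p - x\<close> and \<open>x + d + 1\<close> exceed \<open>p\<close> by
        \<open>d + 1\<close> together.\<close>
      let ?A = "{i \<in> {0..<p}. \<tau> i \<in> {x..<p}}" and ?B = "{i \<in> {0..<p}. \<rho> i \<in> {0..<x + d + 1}}"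
      have card: "card {i \<in> {0..<p}. q i \<in> Y} = card Y" if "q permutes {0..<p}" "Y \<subseteq> {0..<p}" for q Y
      proof -
        have "q ` {i \<in> {0..<p}. q i \<in> Y} = q ` {0..<p} \<inter> Y" by blast
        also have "\<dots> = Y" using that permutes_image[OF that(1)] by auto
        finally show ?thesis
          using card_image[OF inj_on_subset[OF permutes_inj[OF that(1)]]] by (metis subset_UNIV)
      qed
      have A: "?A \<subseteq> {0..<p}" "card ?A = p - x"
        using card[OF \<tau>p, of "{x..<p}"] by auto
      have B: "?B \<subseteq> {0..<p}" "card ?B = x + d + 1"
        using card[OF \<rho>p, of "{0..<x + d + 1}"] x by auto
      have "card ?A + card ?B = card (?A \<union> ?B) + card (?A \<inter> ?B)"
        by (rule card_Un_Int) auto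
      moreover have "card (?A \<union> ?B) \<le> p"
        using A B card_mono[of "{0..<p}" "?A \<union> ?B"] by simp
      ultimately have "card (?A \<inter> ?B) \<ge> d + 1" using A B x by simp
      moreover have "card (set w) \<le> d" using w \<open>s \<le> d\<close> card_length[of w] by (simp add: W_def)
      ultimately have "\<not> ?A \<inter> ?B \<subseteq> set w"
        using card_mono[of "set w" "?A \<inter> ?B"] by auto
      then obtain i where "i \<in> ?A" "i \<in> ?B" "i \<notin> set w" by blast
      then show thesis
        using that[of i] by (auto simp: count_list_0_iff)
    qed
    let ?u = "\<tau> i" and ?v = "p + \<rho> i"
    let ?t = "transpose ?u ?v"
    have up: "\<tau> j < p" if "j < p" for j using permutes_in_image[OF \<tau>p, of j] that by simp
    have uv: "?u \<noteq> ?v" using up[OF i(1)] by simp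
    have t: "?t permutes ?P"
      using i up[OF i(1)] by (intro permutes_swap_id) auto
    have tj: "?t (\<tau> j) = \<tau> j" if "j < p" "j \<noteq> i" for j
      using that up[OF that(1)] permutes_inj[OF \<tau>p] by (auto simp: transpose_def dest: injD)
    have tj': "?t (p + \<rho> j) = p + \<rho> j" if "j < p" "j \<noteq> i" for j
      using that up[OF i(1)] permutes_inj[OF \<rho>p] by (auto simp: transpose_def dest: injD)
    have F: "F \<tau> w \<rho> (\<sigma> \<circ> ?t) = F \<tau> w \<rho> \<sigma>" for \<sigma>
    proof -
      have split: "F \<tau> w \<rho> \<sigma> = (z_series (i + 1) (c (\<sigma> ?u)) *
          (\<Prod>j\<in>{0..<p} - {i}. (fps_XD ^^ count_list w j) (z_series (j + 1) (c (\<sigma> (\<tau> j)))))) *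
          (z_series (i + 1) (c (\<sigma> ?v)) * (\<Prod>j\<in>{0..<p} - {i}. z_series (j + 1) (c (\<sigma> (p + \<rho> j)))))"
        for \<sigma>
        unfolding F_def using i by (simp add: prod.remove[of "{0..<p}" i])
      have 1: "(\<Prod>j\<in>{0..<p} - {i}. (fps_XD ^^ count_list w j) (z_series (j + 1) (c ((\<sigma> \<circ> ?t) (\<tau> j))))) =
          (\<Prod>j\<in>{0..<p} - {i}. (fps_XD ^^ count_list w j) (z_series (j + 1) (c (\<sigma> (\<tau> j)))))"
        by (rule prod.cong) (auto simp: tj)
      have 2: "(\<Prod>j\<in>{0..<p} - {i}. z_series (j + 1) (c ((\<sigma> \<circ> ?t) (p + \<rho> j)))) =
          (\<Prod>j\<in>{0..<p} - {i}. z_series (j + 1) (c (\<sigma> (p + \<rho> j))))"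
        by (rule prod.cong) (auto simp: tj')
      show ?thesis unfolding split[of "\<sigma> \<circ> ?t"] split[of \<sigma>] 1 2 by (simp add: mult_ac)
    qed
    have "(\<Sum>\<sigma> | \<sigma> permutes ?P. of_int (sign \<sigma>) * F \<tau> w \<rho> \<sigma>) =
        (\<Sum>\<sigma> | \<sigma> permutes ?P. of_int (sign (\<sigma> \<circ> ?t)) * F \<tau> w \<rho> (\<sigma> \<circ> ?t))"
      by (rule sum_permutations_compose_right[OF t])
    also have "\<dots> = (\<Sum>\<sigma> | \<sigma> permutes ?P. - (of_int (sign \<sigma>) * F \<tau> w \<rho> \<sigma>))"
    proof (rule sum.cong[OF refl])
      fix \<sigma> assume "\<sigma> \<in> {\<sigma>. \<sigma> permutes ?P}"
      then have "sign (\<sigma> \<circ> ?t) = - sign \<sigma>"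
        using t uv by (subst sign_compose) (auto simp: sign_swap_id permutes_imp_permutation[of ?P])
      then show "of_int (sign (\<sigma> \<circ> ?t)) * F \<tau> w \<rho> (\<sigma> \<circ> ?t) = - (of_int (sign \<sigma>) * F \<tau> w \<rho> \<sigma>)"
        unfolding F by simp
    qed
    also have "\<dots> = - (\<Sum>\<sigma> | \<sigma> permutes ?P. of_int (sign \<sigma>) * F \<tau> w \<rho> \<sigma>)"
      by (rule sum_negf)
    finally show ?thesis by (rule eq_uminus_imp_zero)
  qed
  have "(fps_XD ^^ s) (coldet p (\<lambda>j. c (\<sigma> j))) * coldet p (\<lambda>j. c (\<sigma> (p + j))) =
      (\<Sum>\<tau>\<in>T. \<Sum>w\<in>W. \<Sum>\<rho>\<in>T. of_int (sign \<tau>) * of_int (sign \<rho>) * F \<tau> w \<rho> \<sigma>)" for \<sigma>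
    unfolding coldet_expand funpow_XD_sum funpow_XD_of_int_mult funpow_XD_prod[OF finite_atLeastLessThan]
      F_def W_def[symmetric] T_def[symmetric]
    by (simp add: sum_distrib_left sum_distrib_right mult_ac)
  then have "(\<Sum>\<sigma> | \<sigma> permutes ?P. of_int (sign \<sigma>) *
      ((fps_XD ^^ s) (coldet p (\<lambda>j. c (\<sigma> j))) * coldet p (\<lambda>j. c (\<sigma> (p + j))))) =
    (\<Sum>\<sigma> | \<sigma> permutes ?P. \<Sum>\<tau>\<in>T. \<Sum>w\<in>W. \<Sum>\<rho>\<in>T.
      of_int (sign \<tau>) * of_int (sign \<rho>) * (of_int (sign \<sigma>) * F \<tau> w \<rho> \<sigma>))"
    by (simp add: sum_distrib_left mult_ac)
  also have "\<dots> = (\<Sum>\<tau>\<in>T. \<Sum>w\<in>W. \<Sum>\<rho>\<in>T. \<Sum>\<sigma> | \<sigma> permutes ?P.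
      of_int (sign \<tau>) * of_int (sign \<rho>) * (of_int (sign \<sigma>) * F \<tau> w \<rho> \<sigma>))"
    by (rule trans[OF sum.swap], rule sum.cong[OF refl], rule trans[OF sum.swap],
      rule sum.cong[OF refl], rule sum.swap)
  also have "\<dots> = 0"
    unfolding sum_distrib_left[symmetric] using key by simp
  finally show ?thesis .
qed

lemma mpoly_scale_of_nat_power: "of_nat a ^ s * f = mpoly_scale (of_nat a ^ s) (f :: 'v mpoly)"
proof -
  have "(of_nat (a ^ s) :: 'v mpoly) = const (of_nat (a ^ s))"
    unfolding const_def by (simp flip: single_of_nat)
  then show ?thesis by (simp add: mpoly_scale_def)
qed

lemma mpoly_scale_of_int: "of_int a * f = mpoly_scale (of_int a) (f :: 'v mpoly)"
  by (rule poly_mapping_eqI) (simp add: lookup_of_int_mult)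

text \<open>Linear combinations of the relations replace the weights \<open>a ^ s\<close> by any
  polynomial in \<open>a\<close> of degree at most \<open>d\<close>. The polynomial
  \<open>h B\<close> vanishes exactly on \<open>B\<close>, so the summands at \<open>B\<close>
  disappear and the one at \<open>k\<close> can be solved for.\<close>

lemma moment_relations:
  fixes e :: "nat \<Rightarrow> 'v mpoly"
  assumes rel: "\<And>s. s \<le> d \<Longrightarrow> (\<Sum>a\<in>A. mpoly_scale (of_nat a ^ s) (e a)) = 0"
    and A: "finite A" and B: "finite B" "card B \<le> d" and k: "k \<in> A" "k \<notin> B"
  shows "e k \<in> mpoly.span (e ` (A - B - {k}))"
proof -
  define h where "h B a = (\<Prod>b\<in>B. of_nat a - of_nat b :: complex)" for B and a :: nat
  \<comment> \<open>Each root uses up one degree: the factor \<open>a - b\<close> combines the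
    relations for \<open>Suc s\<close> and \<open>s\<close>, so the induction keeps \<open>s\<close>
    general.\<close>
  have "(\<Sum>a\<in>A. mpoly_scale (of_nat a ^ s * h B a) (e a)) = 0" if "s + card B \<le> d" for s
    using B(1) that
  proof (induction B arbitrary: s)
    case empty
    then show ?case using rel by (simp add: h_def)
  next
    case (insert b B)
    have "(\<Sum>a\<in>A. mpoly_scale (of_nat a ^ s * h (insert b B) a) (e a)) =
        (\<Sum>a\<in>A. mpoly_scale (of_nat a ^ Suc s * h B a) (e a) -
          mpoly_scale (of_nat b) (mpoly_scale (of_nat a ^ s * h B a) (e a)))"
      using insert.hyps
      by (intro sum.cong refl poly_mapping_eqI) (simp add: h_def lookup_minus algebra_simps)
    also have "\<dots> = (\<Sum>a\<in>A. mpoly_scale (of_nat a ^ Suc s * h B a) (e a)) -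
        mpoly_scale (of_nat b) (\<Sum>a\<in>A. mpoly_scale (of_nat a ^ s * h B a) (e a))"
      by (simp add: sum_subtractf mpoly.scale_sum_right)
    also have "\<dots> = 0"
      using insert.IH[of "Suc s"] insert.IH[of s] insert.prems insert.hyps by simp
    finally show ?case .
  qed
  from this[of 0] have "0 = (\<Sum>a\<in>A. mpoly_scale (h B a) (e a))" using B(2) by simp
  also have "\<dots> = (\<Sum>a\<in>A - B. mpoly_scale (h B a) (e a))"
    by (rule sum.mono_neutral_right) (use A B(1) in \<open>auto simp: h_def\<close>)
  also have "\<dots> = mpoly_scale (h B k) (e k) + (\<Sum>a\<in>A - B - {k}. mpoly_scale (h B a) (e a))"
    using A k by (intro sum.remove) auto
  finally have "mpoly_scale (h B k) (e k) = - (\<Sum>a\<in>A - B - {k}. mpoly_scale (h B a) (e a))"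
    by (simp add: eq_neg_iff_add_eq_0)
  moreover have "- (\<Sum>a\<in>A - B - {k}. mpoly_scale (h B a) (e a)) \<in> mpoly.span (e ` (A - B - {k}))"
    by (intro mpoly.span_neg mpoly.span_sum mpoly.span_scale mpoly.span_base) auto
  ultimately have "mpoly_scale (inverse (h B k)) (mpoly_scale (h B k) (e k)) \<in> mpoly.span (e ` (A - B - {k}))"
    using mpoly.span_scale by metis
  moreover have "h B k \<noteq> 0" using k(2) B(1) by (auto simp: h_def)
  ultimately show ?thesis by simp
qed

section \<open>Straightening\<close>

definition gens :: "nat \<Rightarrow> nat \<Rightarrow> (nat list \<times> nat) set"
  where "gens p n = increasing_tuples p n \<times> UNIV"

definition gen_poly :: "nat \<Rightarrow> nat list \<times> nat \<Rightarrow> zvar mpoly"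
  where "gen_poly p = (\<lambda>(I, k). D_coeff p I k)"

text \<open>The coefficient \<open>p * n + 1\<close> exceeds the sum of the entries of a tuple, so the weight orders
  generators primarily by \<open>k\<close>.\<close>

definition weight :: "nat \<Rightarrow> nat \<Rightarrow> nat list \<times> nat \<Rightarrow> nat"
  where "weight p n = (\<lambda>(I, k). (p * n + 1) * k + sum_list I)"

lemma increasing_tuplesD:
  assumes "I \<in> increasing_tuples p n"
  shows "length I = p" "\<And>i. i < p \<Longrightarrow> I ! i \<in> {1..n}" "\<And>i j. i < j \<Longrightarrow> j < p \<Longrightarrow> I ! i < I ! j"
    "sum_list I \<le> p * n"
proof -
  show len: "length I = p" using assms by (simp add: increasing_tuples_def tuples_def)
  show mem: "I ! i \<in> {1..n}" if "i < p" for i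
    using assms that len nth_mem by (fastforce simp: increasing_tuples_def tuples_def)
  show "I ! i < I ! j" if "i < j" "j < p" for i j
    using assms that len by (auto simp: increasing_tuples_def sorted_wrt_iff_nth_less)
  have "sum_list I = (\<Sum>i = 0..<p. I ! i)" using len by (simp add: sum_list_sum_nth)
  also have "\<dots> \<le> (\<Sum>i = 0..<p. n)" using mem by (intro sum_mono) auto
  finally show "sum_list I \<le> p * n" by simp
qed

lemma fps_nth_of_int_mult: "fps_nth (of_int b * f :: 'a::comm_ring_1 fps) m = of_int b * fps_nth f m"
  by (simp flip: fps_of_int)

text \<open>Equally many elements leave and enter, and \<open>v\<close> separates their values. This
  bounds the column sum after columns of one factor are traded for smaller ones of the
  other.\<close>

lemma sum_exchange_less:
  fixes f :: "'a \<Rightarrow> nat"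
  assumes fin: "finite A" "finite T" and card: "card A = card T" and ne: "A \<noteq> T"
    and lt: "\<And>a. a \<in> A - T \<Longrightarrow> f a < v" and ge: "\<And>t. t \<in> T - A \<Longrightarrow> v \<le> f t"
  shows "sum f A < sum f T"
proof -
  have c: "card (A - T) = card (T - A)"
    using card fin card_Int_Diff[of A T] card_Int_Diff[of T A] by (simp add: Int_commute)
  have "A - T \<noteq> {}"
  proof
    assume "A - T = {}"
    moreover have "T - A = {}" using c fin \<open>A - T = {}\<close> by (metis card_0_eq card.empty finite_Diff)
    ultimately have "A - T = {}" "T - A = {}" .
    then show False using ne by blast
  qed
  then have "sum f (A - T) < sum (\<lambda>_. v) (A - T)"
    using lt fin by (intro sum_strict_mono) auto
  also have "\<dots> = sum (\<lambda>_. v) (T - A)" using c by simp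
  also have "\<dots> \<le> sum f (T - A)" using ge by (intro sum_mono)
  finally have "sum f (A - T) < sum f (T - A)" .
  moreover have "sum f A = sum f (A \<inter> T) + sum f (A - T)" "sum f T = sum f (A \<inter> T) + sum f (T - A)"
    using fin sum.Int_Diff[of A f T] sum.Int_Diff[of T f A] by (simp_all add: Int_commute)
  ultimately show ?thesis by simp
qed

lemma coldet_shift_permute:
  assumes \<sigma>: "\<sigma> permutes {p..<p + p}"
  shows "coldet p (\<lambda>j. c (\<sigma> (p + j))) = of_int (sign \<sigma>) * coldet p (\<lambda>j. c (p + j))"
proof -
  have bij: "bij_betw (\<lambda>x. x - p) {p..<p + p} {0..<p}"
    by (rule bij_betwI[of _ _ _ "\<lambda>x. x + p"]) auto
  define \<pi> where "\<pi> = map_permutation {p..<p + p} (\<lambda>x. x - p) \<sigma>"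
  have \<pi>: "\<pi> permutes {0..<p}"
    unfolding \<pi>_def using bij \<sigma> by (rule map_permutation_permutes)
  have sgn: "sign \<pi> = sign \<sigma>"
    unfolding \<pi>_def using bij \<sigma> by (intro sign_map_permutation) (auto simp: bij_betw_def)
  have "c (\<sigma> (p + j)) = c (p + \<pi> j)" if "j < p" for j
  proof -
    have "\<pi> (p + j - p) = \<sigma> (p + j) - p"
      unfolding \<pi>_def using bij that by (intro map_permutation_apply) (auto simp: bij_betw_def)
    moreover have "\<sigma> (p + j) \<ge> p" using permutes_in_image[OF \<sigma>, of "p + j"] that by simp
    ultimately show ?thesis by simp
  qed
  then have "coldet p (\<lambda>j. c (\<sigma> (p + j))) = coldet p (\<lambda>j. c (p + \<pi> j))"
    by (rule coldet_cong)
  also have "\<dots> = of_int (sign \<sigma>) * coldet p (\<lambda>j. c (p + j))"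
    using coldet_permute[OF \<pi>, of "\<lambda>j. c (p + j)"] sgn by simp
  finally show ?thesis .
qed

text \<open>Such a permutation acts on the columns of the two determinants separately. The two signs
  it produces cancel against \<open>sign \<sigma>\<close>, so all these terms of an
  antisymmetrisation coincide.\<close>

lemma coldet_block_permute:
  assumes \<sigma>: "\<sigma> permutes {x..<p + y}" and le: "x \<le> p" "y \<le> p" and img: "\<sigma> ` {x..<p} = {x..<p}"
  obtains \<epsilon> \<delta> :: int where "sign \<sigma> * \<epsilon> * \<delta> = 1"
    "coldet p (\<lambda>j. c (\<sigma> j)) = of_int \<epsilon> * coldet p c"
    "coldet p (\<lambda>j. c (\<sigma> (p + j))) = of_int \<delta> * coldet p (\<lambda>j. c (p + j))"
proof -
  have inj: "inj \<sigma>" using \<sigma> by (rule permutes_inj)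
  have lo: "\<sigma> j < p \<longleftrightarrow> j < p" for j
  proof (cases "j \<in> {x..<p + y}")
    case True
    then have "\<sigma> j \<in> {x..<p + y}" using permutes_in_image[OF \<sigma>] by simp
    moreover have "\<sigma> j \<in> {x..<p} \<longleftrightarrow> j \<in> {x..<p}" using img inj by (metis inj_image_mem_iff)
    ultimately show ?thesis using True by auto
  qed (use permutes_not_in[OF \<sigma>, of j] in auto)
  define \<sigma>1 where "\<sigma>1 j = (if j < p then \<sigma> j else j)" for j
  define \<sigma>2 where "\<sigma>2 j = (if j < p then j else \<sigma> j)" for j
  have id: "\<sigma> j = j" if "j \<ge> p + p" for j using permutes_not_in[OF \<sigma>, of j] that le by simp
  have \<sigma>1: "\<sigma>1 permutes {0..<p}"
  proof (rule inj_on_nat_permutes)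
    show "inj_on \<sigma>1 {0..<p}" using inj by (auto simp: \<sigma>1_def inj_on_def)
    show "\<sigma>1 \<in> {0..<p} \<rightarrow> {0..<p}" using lo by (auto simp: \<sigma>1_def)
  qed (auto simp: \<sigma>1_def)
  have ran: "\<sigma> j < p + p \<longleftrightarrow> j < p + p" for j
    using id inj by (metis injD linorder_not_less)
  have \<sigma>2: "\<sigma>2 permutes {p..<p + p}"
  proof (rule inj_on_nat_permutes)
    show "inj_on \<sigma>2 {p..<p + p}" using inj by (auto simp: \<sigma>2_def inj_on_def)
    show "\<sigma>2 \<in> {p..<p + p} \<rightarrow> {p..<p + p}" using lo ran by (auto simp: \<sigma>2_def not_less[symmetric])
  qed (auto simp: \<sigma>2_def id)
  have "\<sigma> = \<sigma>1 \<circ> \<sigma>2" using lo by (auto simp: \<sigma>1_def \<sigma>2_def fun_eq_iff)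
  then have "sign \<sigma> = sign \<sigma>1 * sign \<sigma>2"
    using \<sigma>1 \<sigma>2 by (simp add: sign_compose permutes_imp_permutation[OF finite_atLeastLessThan])
  moreover have "coldet p (\<lambda>j. c (\<sigma> j)) = coldet p (\<lambda>j. c (\<sigma>1 j))"
    by (rule coldet_cong) (simp add: \<sigma>1_def)
  moreover have "coldet p (\<lambda>j. c (\<sigma> (p + j))) = coldet p (\<lambda>j. c (\<sigma>2 (p + j)))"
    by (rule coldet_cong) (simp add: \<sigma>2_def)
  ultimately show thesis
    using that[of "sign \<sigma>1" "sign \<sigma>2"] coldet_permute[OF \<sigma>1] coldet_shift_permute[OF \<sigma>2]
    by (simp add: sign_def)
qed

text \<open>If \<open>A\<close> is the lighter factor, a smaller weight of \<open>A'\<close> with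
  the same total means that the two weights lie strictly further apart.\<close>

definition spread_products :: "nat \<Rightarrow> nat \<Rightarrow> nat list \<times> nat \<Rightarrow> nat list \<times> nat \<Rightarrow> zvar mpoly set"
  where "spread_products p n A B = {gen_poly p A' * gen_poly p B' | A' B'.
    A' \<in> gens p n \<and> B' \<in> gens p n \<and> weight p n A' < weight p n A \<and>
    weight p n A' + weight p n B' = weight p n A + weight p n B}"

text \<open>The antisymmetrised coefficient at \<open>(k, l)\<close> has two kinds of terms.
  Permutations that preserve \<open>{x..<p}\<close> all reproduce the given product; any other one
  replaces columns of the first factor that are at least \<open>I ! x\<close> by columns below
  \<open>I ! x\<close>, which lowers its weight. The whole coefficient is a combination of
  coefficients in which one exponent is below \<open>k\<close>.\<close>

lemma straighten_pair:
  assumes I: "I \<in> increasing_tuples p n" and J: "J \<in> increasing_tuples p n"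
    and kl: "k \<le> l" and x: "x + (l - k) < p" and viol: "J ! (x + (l - k)) < I ! x"
  shows "gen_poly p (I, k) * gen_poly p (J, l) \<in> mpoly.span (spread_products p n (I, k) (J, l))"
proof -
  define d where "d = l - k"
  define N where "N = k + l"
  define c where "c j = (if j < p then I ! j else J ! (j - p))" for j
  let ?P = "{x..<p + x + d + 1}" and ?V = "mpoly.span (spread_products p n (I, k) (J, l))"
  define S where "S = {\<sigma>. \<sigma> permutes ?P}"
  define E where "E \<sigma> a = of_int (sign \<sigma>) * (fps_nth (coldet p (\<lambda>j. c (\<sigma> j))) a *
    fps_nth (coldet p (\<lambda>j. c (\<sigma> (p + j)))) (N - a))" for \<sigma> and a :: nat
  note ID = increasing_tuplesD[OF I] and JD = increasing_tuplesD[OF J]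
  have xd: "x + d < p" using x by (simp add: d_def)
  have finS: "finite S" by (simp add: S_def finite_permutations)
  have cran: "c j \<in> {1..n}" if "j < p + p" for j
    using ID(2)[of j] JD(2)[of "j - p"] that by (auto simp: c_def)
  have \<sigma>ran: "\<sigma> j < p + p" if "\<sigma> \<in> S" "j < p + p" for \<sigma> j
  proof (cases "j \<in> ?P")
    case True
    then have "\<sigma> j \<in> ?P" using that(1) permutes_in_image[of \<sigma> ?P j] by (simp add: S_def)
    then show ?thesis using xd by auto
  qed (use that permutes_not_in[of \<sigma> ?P j] in \<open>auto simp: S_def\<close>)
  have sumc: "(\<Sum>j = 0..<p. c j) = sum_list I" "(\<Sum>j = 0..<p. c (p + j)) = sum_list J"
    using ID(1) JD(1) by (simp_all add: c_def sum_list_sum_nth)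
  have sum\<sigma>: "(\<Sum>j = 0..<p. c (\<sigma> j)) + (\<Sum>j = 0..<p. c (\<sigma> (p + j))) = sum_list I + sum_list J"
    if "\<sigma> \<in> S" for \<sigma>
  proof -
    have split: "(\<Sum>j = 0..<p + p. f j) = (\<Sum>j = 0..<p. f j) + (\<Sum>j = 0..<p. f (p + j))" for f :: "nat \<Rightarrow> nat"
      using sum.atLeastLessThan_concat[of 0 p "p + p" f] sum.shift_bounds_nat_ivl[of f 0 p p]
      by (simp add: add.commute)
    have "\<sigma> permutes {0..<p + p}"
      using that xd by (auto simp: S_def intro: permutes_subset)
    then have "(\<Sum>j = 0..<p + p. c (\<sigma> j)) = (\<Sum>j = 0..<p + p. c j)"
      using sum.permute[of \<sigma> "{0..<p + p}" c] by (simp add: o_def)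
    then show ?thesis by (simp add: split sumc)
  qed
  have in_span: "E \<sigma> a \<in> ?V"
    if \<sigma>: "\<sigma> \<in> S" and a: "a < k \<or> l < a \<or> a = k \<and> (\<Sum>j = 0..<p. c (\<sigma> j)) < sum_list I" and "a \<le> N"
    for \<sigma> a
  proof -
    consider "coldet p (\<lambda>j. c (\<sigma> j)) = 0" | "coldet p (\<lambda>j. c (\<sigma> (p + j))) = 0"
      | I' J' \<epsilon> \<delta> where "I' \<in> increasing_tuples p n" "J' \<in> increasing_tuples p n"
        "sum_list I' = (\<Sum>j = 0..<p. c (\<sigma> j))" "sum_list J' = (\<Sum>j = 0..<p. c (\<sigma> (p + j)))"
        "coldet p (\<lambda>j. c (\<sigma> j)) = of_int \<epsilon> * coldet p ((!) I')"
        "coldet p (\<lambda>j. c (\<sigma> (p + j))) = of_int \<delta> * coldet p ((!) J')"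
      using coldet_sort[of p "\<lambda>j. c (\<sigma> j)" n] coldet_sort[of p "\<lambda>j. c (\<sigma> (p + j))" n] cran \<sigma>ran[OF \<sigma>]
      by (metis add_strict_left_mono trans_less_add1)
    then show ?thesis
    proof cases
      case 3
      have E: "E \<sigma> a = of_int (sign \<sigma> * \<epsilon> * \<delta>) * (gen_poly p (I', a) * gen_poly p (J', N - a))"
        by (simp add: E_def 3 fps_nth_of_int_mult gen_poly_def D_coeff_coldet mult_ac)
      have sums: "sum_list I' + sum_list J' = sum_list I + sum_list J"
        using 3 sum\<sigma>[OF \<sigma>] by simp
      have M: "(p * n + 1) * b + s < (p * n + 1) * k + t" if "b < k" "s \<le> p * n" for b s t
      proof -
        have "(p * n + 1) * Suc b \<le> (p * n + 1) * k" using that(1) by (intro mult_le_mono2) simp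
        then show ?thesis using that(2) by simp
      qed
      have tot: "(p * n + 1) * a + (p * n + 1) * (N - a) = (p * n + 1) * k + (p * n + 1) * l"
        using \<open>a \<le> N\<close> by (simp add: N_def flip: distrib_left)
      have "gen_poly p (I', a) * gen_poly p (J', N - a) \<in> spread_products p n (I, k) (J, l)"
      proof (cases "l < a")
        case True
        \<comment> \<open>Beyond \<open>l\<close> the lighter factor is the second one, so the two
          change places.\<close>
        then have "N - a < k" using \<open>a \<le> N\<close> by (auto simp: N_def)
        then have "weight p n (J', N - a) < weight p n (I, k)"
          using M increasing_tuplesD(4)[OF 3(2)] by (simp add: weight_def)
        moreover have "weight p n (J', N - a) + weight p n (I', a) = weight p n (I, k) + weight p n (J, l)"
          using tot sums by (simp add: weight_def)
        moreover have "gen_poly p (I', a) * gen_poly p (J', N - a) = gen_poly p (J', N - a) * gen_poly p (I', a)"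
          by (rule mult.commute)
        ultimately show ?thesis unfolding spread_products_def using 3(1,2)
          by (intro CollectI exI[of _ "(J', N - a)"] exI[of _ "(I', a)"]) (simp add: gens_def)
      next
        case False
        then have "weight p n (I', a) < weight p n (I, k)"
          using a M[of a "sum_list I'" "sum_list I"] increasing_tuplesD(4)[OF 3(1)] 3(3)
          by (auto simp: weight_def)
        moreover have "weight p n (I', a) + weight p n (J', N - a) = weight p n (I, k) + weight p n (J, l)"
          using tot sums by (simp add: weight_def)
        ultimately show ?thesis unfolding spread_products_def using 3(1,2)
          by (intro CollectI exI[of _ "(I', a)"] exI[of _ "(J', N - a)"]) (simp add: gens_def)
      qed
      then show ?thesis unfolding E mpoly_scale_of_int by (intro mpoly.span_scale mpoly.span_base)
    qed (simp_all add: E_def mpoly.span_zero)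
  qed
  define e where "e a = (\<Sum>\<sigma>\<in>S. E \<sigma> a)" for a
  have rel: "(\<Sum>a\<in>{..N}. mpoly_scale (of_nat a ^ s) (e a)) = 0" if "s \<le> d" for s
  proof -
    have "fps_nth (\<Sum>\<sigma>\<in>S. of_int (sign \<sigma>) *
        ((fps_XD ^^ s) (coldet p (\<lambda>j. c (\<sigma> j))) * coldet p (\<lambda>j. c (\<sigma> (p + j))))) N = 0"
      unfolding S_def using exchange_relation[OF xd that, of c] by simp
    then have "(\<Sum>\<sigma>\<in>S. of_int (sign \<sigma>) * (\<Sum>a = 0..N.
        of_nat a ^ s * fps_nth (coldet p (\<lambda>j. c (\<sigma> j))) a *
        fps_nth (coldet p (\<lambda>j. c (\<sigma> (p + j)))) (N - a))) = 0"
      unfolding fps_sum_nth fps_nth_of_int_mult unfolding fps_mult_nth funpow_XD_nth .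
    then have "(\<Sum>\<sigma>\<in>S. \<Sum>a\<in>{..N}. of_nat a ^ s * E \<sigma> a) = 0"
      by (simp add: sum_distrib_left E_def mult_ac atLeast0AtMost)
    then show ?thesis
      unfolding e_def by (subst (asm) sum.swap) (simp add: mpoly_scale_of_nat_power mpoly.scale_sum_right)
  qed
  \<comment> \<open>The eliminated set \<open>{k<..l}\<close> has exactly \<open>d\<close> elements;
    the positions left over lie below \<open>k\<close> or above \<open>l\<close>.\<close>
  have "e k \<in> mpoly.span (e ` ({..N} - {k<..l} - {k}))"
    by (rule moment_relations[of d]) (use rel kl in \<open>auto simp: d_def N_def\<close>)
  moreover have "e ` ({..N} - {k<..l} - {k}) \<subseteq> ?V"
    unfolding e_def by (auto intro!: mpoly.span_sum in_span)
  ultimately have ek: "e k \<in> ?V"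
    by (metis mpoly.span_mono mpoly.span_span subsetD)
  let ?G = "{\<sigma> \<in> S. \<sigma> ` {x..<p} = {x..<p}}"
  have good: "E \<sigma> k = gen_poly p (I, k) * gen_poly p (J, l)" if "\<sigma> \<in> ?G" for \<sigma>
  proof -
    have \<sigma>: "\<sigma> permutes {x..<p + (x + d + 1)}" "\<sigma> ` {x..<p} = {x..<p}"
      using that by (simp_all add: S_def add.assoc)
    obtain \<epsilon> \<delta> where eq: "sign \<sigma> * \<epsilon> * \<delta> = 1"
      "coldet p (\<lambda>j. c (\<sigma> j)) = of_int \<epsilon> * coldet p c"
      "coldet p (\<lambda>j. c (\<sigma> (p + j))) = of_int \<delta> * coldet p (\<lambda>j. c (p + j))"
      using coldet_block_permute[OF \<sigma>(1) _ _ \<sigma>(2), of c] xd by auto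
    have "coldet p c = coldet p ((!) I)" "coldet p (\<lambda>j. c (p + j)) = coldet p ((!) J)"
      by (rule coldet_cong, simp add: c_def)+
    then have "E \<sigma> k = of_int (sign \<sigma> * \<epsilon> * \<delta>) * (gen_poly p (I, k) * gen_poly p (J, l))"
      by (simp add: E_def eq(2,3) fps_nth_of_int_mult gen_poly_def D_coeff_coldet mult_ac N_def)
    then show ?thesis unfolding eq(1) by simp
  qed
  have bad: "E \<sigma> k \<in> ?V" if "\<sigma> \<in> S - ?G" for \<sigma>
  proof (rule in_span)
    show "\<sigma> \<in> S" using that by simp
    have \<sigma>: "\<sigma> permutes ?P" using that by (simp add: S_def)
    have "sum c (\<sigma> ` {x..<p}) < sum c {x..<p}"
    proof (rule sum_exchange_less[where v = "I ! x"])
      show "card (\<sigma> ` {x..<p}) = card {x..<p}"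
        by (rule card_image) (rule inj_on_subset[OF permutes_inj[OF \<sigma>]], simp)
      show "\<sigma> ` {x..<p} \<noteq> {x..<p}" using that by simp
      fix a assume a: "a \<in> \<sigma> ` {x..<p} - {x..<p}"
      then obtain j where j: "a = \<sigma> j" "j \<in> {x..<p}" by blast
      have "a \<in> ?P" using j permutes_in_image[OF \<sigma>, of j] by simp
      then have "a - p \<le> x + d" "\<not> a < p" using a by auto
      then have "c a \<le> J ! (x + d)" using JD(3)[of "a - p" "x + d"] xd
        by (cases "a - p = x + d") (auto simp: c_def)
      then show "c a < I ! x" using viol by (simp add: d_def)
    next
      fix t assume "t \<in> {x..<p} - \<sigma> ` {x..<p}"
      then show "I ! x \<le> c t" using ID(3)[of x t] by (cases "t = x") (auto simp: c_def)
    qed simp_all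
    also have "sum c (\<sigma> ` {x..<p}) = (\<Sum>j = x..<p. c (\<sigma> j))"
      by (subst sum.reindex) (auto intro: inj_on_subset[OF permutes_inj[OF \<sigma>]])
    finally have "(\<Sum>j = x..<p. c (\<sigma> j)) < (\<Sum>j = x..<p. c j)" .
    moreover have "(\<Sum>j = 0..<x. c (\<sigma> j)) = (\<Sum>j = 0..<x. c j)"
      using permutes_not_in[OF \<sigma>] by (intro sum.cong) auto
    moreover have "(\<Sum>j = 0..<p. f j) = (\<Sum>j = 0..<x. f j) + (\<Sum>j = x..<p. f j)" for f :: "nat \<Rightarrow> nat"
      using xd sum.atLeastLessThan_concat[of 0 x p f] by simp
    ultimately show "k < k \<or> l < k \<or> k = k \<and> (\<Sum>j = 0..<p. c (\<sigma> j)) < sum_list I"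
      by (simp flip: sumc)
    show "k \<le> N" by (simp add: N_def)
  qed
  have "e k = (\<Sum>\<sigma>\<in>?G. E \<sigma> k) + (\<Sum>\<sigma>\<in>S - ?G. E \<sigma> k)"
    unfolding e_def using finS sum.subset_diff[of ?G S "\<lambda>\<sigma>. E \<sigma> k"] by (simp add: add.commute)
  also have "(\<Sum>\<sigma>\<in>?G. E \<sigma> k) = of_nat (card ?G) * (gen_poly p (I, k) * gen_poly p (J, l))"
    using good by simp
  finally have "of_nat (card ?G) * (gen_poly p (I, k) * gen_poly p (J, l)) = e k - (\<Sum>\<sigma>\<in>S - ?G. E \<sigma> k)"
    by simp
  also have "\<dots> \<in> ?V" using ek bad by (intro mpoly.span_diff mpoly.span_sum) auto
  finally have "mpoly_scale (of_nat (card ?G)) (gen_poly p (I, k) * gen_poly p (J, l)) \<in> ?V"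
    using mpoly_scale_of_nat_power[of "card ?G" 1 "gen_poly p (I, k) * gen_poly p (J, l)"]
    by (simp only: power_one_right)
  then have "mpoly_scale (inverse (of_nat (card ?G))) (mpoly_scale (of_nat (card ?G))
      (gen_poly p (I, k) * gen_poly p (J, l))) \<in> ?V"
    by (rule mpoly.span_scale)
  \<comment> \<open>The identity preserves the block, so the multiplicity of the product can be
    divided out.\<close>
  moreover have "card ?G \<noteq> 0"
  proof -
    have "id \<in> ?G" by (simp add: S_def permutes_id)
    moreover have "finite ?G" using finS by simp
    ultimately show ?thesis by (auto simp del: mem_Collect_eq)
  qed
  ultimately show ?thesis by simp
qed

section \<open>Heights and standard products\<close>

definition height :: "nat \<Rightarrow> nat \<Rightarrow> nat list \<times> nat \<Rightarrow> nat \<Rightarrow> nat"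
  where "height p n = (\<lambda>(I, k) i. if i \<le> k then n else if i \<le> k + p then I ! (p - (i - k)) else 0)"

definition gen_ideal :: "nat \<Rightarrow> nat \<Rightarrow> nat list \<times> nat \<Rightarrow> (nat \<times> nat) set"
  where "gen_ideal p n = (\<lambda>(I, k). phi_ss p n I k)"

text \<open>Heights are measured from the diagonal \<open>j = i\<close>, also in rows
  \<open>i \<le> p\<close>, whose poset elements begin only at column \<open>p + 1\<close>. In this
  convention a full row has height \<open>n\<close>, and the rows of the window have the tuple
  entries as heights, in reverse order.\<close>

lemma gen_ideal_height:
  assumes "A \<in> gens p n"
  shows "gen_ideal p n A = {(i, j) \<in> Q_set p n. j < i + height p n A i}"
proof -
  obtain I k where A: "A = (I, k)" "I \<in> increasing_tuples p n" using assms by (auto simp: gens_def)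
  have pos: "I ! (p - (i - k)) \<ge> 1" if "k < i" "i \<le> k + p" for i
    using increasing_tuplesD(2)[OF A(2), of "p - (i - k)"] that by force
  show ?thesis
    unfolding A gen_ideal_def phi_ss_def height_def Q_set_def
    using pos by (fastforce simp: not_le split: if_splits)
qed

text \<open>In rows common to both windows the heights are tuple entries at positions that differ by
  \<open>l - k\<close>; in all other rows the inclusion is automatic. Read contrapositively,
  incomparable ideals yield the inequality from which straightening starts.\<close>

lemma phi_ss_mono:
  assumes A: "(I, k) \<in> gens p n" and B: "(J, l) \<in> gens p n" and "k \<le> l"
    and le: "\<And>x. x + (l - k) < p \<Longrightarrow> I ! x \<le> J ! (x + (l - k))"
  shows "gen_ideal p n (I, k) \<subseteq> gen_ideal p n (J, l)"
proof -
  have I: "I \<in> increasing_tuples p n" using A by (simp add: gens_def)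
  have "height p n (I, k) i \<le> height p n (J, l) i" for i
  proof -
    consider "i \<le> k" | "k < i" "i \<le> l" "i \<le> k + p" | "l < i" "i \<le> k + p" | "k + p < i" by linarith
    then show ?thesis
    proof cases
      case 2
      then show ?thesis using increasing_tuplesD(2)[OF I, of "p - (i - k)"] by (simp add: height_def)
    next
      case 3
      then have "p - (i - k) + (l - k) = p - (i - l)" "p - (i - l) < p" using \<open>k \<le> l\<close> by linarith+
      then have "I ! (p - (i - k)) \<le> J ! (p - (i - l))" using le[of "p - (i - k)"] by (simp only:)
      then show ?thesis using 3 \<open>k \<le> l\<close> by (simp add: height_def)
    qed (use \<open>k \<le> l\<close> in \<open>simp_all add: height_def\<close>)
  qed
  then show ?thesis unfolding gen_ideal_height[OF A] gen_ideal_height[OF B]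
    by (auto intro: less_le_trans)
qed

definition standard :: "nat \<Rightarrow> nat \<Rightarrow> (nat list \<times> nat) multiset \<Rightarrow> bool"
  where "standard p n S \<longleftrightarrow> (\<forall>A\<in>#S. \<forall>B\<in>#S. gen_ideal p n A \<subseteq> gen_ideal p n B \<or> gen_ideal p n B \<subseteq> gen_ideal p n A)"

definition prod_poly :: "nat \<Rightarrow> (nat list \<times> nat) multiset \<Rightarrow> zvar mpoly"
  where "prod_poly p S = (\<Prod>A\<in>#S. gen_poly p A)"

lemma mpoly_span_mult_right:
  assumes "f \<in> mpoly.span Z"
  shows "f * r \<in> mpoly.span ((\<lambda>z. z * r) ` Z)"
  using assms
proof (induction rule: mpoly.span_induct_alt)
  case base
  then show ?case by (simp add: mpoly.span_zero)
next
  case (step c x y)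
  have "(mpoly_scale c x + y) * r = mpoly_scale c (x * r) + y * r"
    by (simp add: distrib_right mpoly_scale_mult_left)
  moreover have "x * r \<in> mpoly.span ((\<lambda>z. z * r) ` Z)" using step by (intro mpoly.span_base imageI)
  ultimately show ?case using step by (simp only:) (intro mpoly.span_add mpoly.span_scale)
qed

lemma incomparable_straighten:
  assumes A: "A \<in> gens p n" and B: "B \<in> gens p n" and le: "weight p n A \<le> weight p n B"
    and incomp: "\<not> gen_ideal p n A \<subseteq> gen_ideal p n B"
  shows "gen_poly p A * gen_poly p B \<in> mpoly.span (spread_products p n A B)"
proof -
  obtain I k J l where AB: "A = (I, k)" "B = (J, l)" by (cases A, cases B)
  have I: "I \<in> increasing_tuples p n" and J: "J \<in> increasing_tuples p n"
    using A B by (simp_all add: AB gens_def)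
  have "k \<le> l"
  proof (rule ccontr)
    assume "\<not> k \<le> l"
    then have "(p * n + 1) * Suc l \<le> (p * n + 1) * k" by (intro mult_le_mono2) simp
    then show False using le increasing_tuplesD(4)[OF J] by (simp add: AB weight_def)
  qed
  then obtain x where "x + (l - k) < p" "J ! (x + (l - k)) < I ! x"
    using phi_ss_mono[of I k p n J l] A B incomp by (force simp: AB not_le)
  then show ?thesis unfolding AB using straighten_pair[OF I J \<open>k \<le> l\<close>] by blast
qed

lemma sum_mset_square_le: "(\<Sum>x\<in>#S. f x ^ 2) \<le> (\<Sum>x\<in>#S. f x :: nat) ^ 2"
  by (induction S) (simp_all add: power2_sum)

lemma square_spread:
  fixes a b a' b' :: nat
  assumes "a' < a" "a \<le> b" "a' + b' = a + b"
  shows "a ^ 2 + b ^ 2 < a' ^ 2 + b' ^ 2"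
proof -
  obtain c where c: "c > 0" "a = a' + c" "b' = b + c"
    using assms by (metis add.assoc add.commute add_left_cancel less_imp_add_positive)
  have "a' * c < b * c" using assms c by simp
  moreover have "(a' + c) ^ 2 + b ^ 2 = a' ^ 2 + b ^ 2 + c ^ 2 + 2 * (a' * c)"
    "a' ^ 2 + (b + c) ^ 2 = a' ^ 2 + b ^ 2 + c ^ 2 + 2 * (b * c)"
    by (simp_all add: power2_eq_square algebra_simps)
  ultimately show ?thesis unfolding c by linarith
qed

text \<open>Straightening an incomparable pair keeps the total weight and raises the sum of squared
  weights. That sum is bounded by the square of the total, and \<open>\<mu>\<close> is the remaining
  gap.\<close>

lemma prod_poly_standard:
  assumes "set_mset S \<subseteq> gens p n"
  shows "prod_poly p S \<in> mpoly.span (prod_poly p ` {T. set_mset T \<subseteq> gens p n \<and> standard p n T})"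
    (is "_ \<in> ?V")
proof -
  let ?w = "weight p n"
  define \<mu> where "\<mu> S = (\<Sum>A\<in>#S. ?w A) ^ 2 - (\<Sum>A\<in>#S. ?w A ^ 2)" for S
  show ?thesis
    using assms
  proof (induction "\<mu> S" arbitrary: S rule: less_induct)
    case less
    show ?case
    proof (cases "standard p n S")
      case True
      then show ?thesis using less.prems by (intro mpoly.span_base) auto
    next
      case False
      then obtain A B where AB: "A \<in># S" "B \<in># S" "\<not> gen_ideal p n A \<subseteq> gen_ideal p n B"
          "\<not> gen_ideal p n B \<subseteq> gen_ideal p n A" "?w A \<le> ?w B"
        unfolding standard_def by (metis nat_le_linear)
      then have "A \<noteq> B" by auto
      then obtain R where R: "S = add_mset A (add_mset B R)"
        using AB(1,2) by (metis insert_DiffM insert_noteq_member)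
      have gens: "A \<in> gens p n" "B \<in> gens p n" using AB less.prems by auto
      have "prod_poly p S = gen_poly p A * gen_poly p B * prod_poly p R"
        by (simp add: R prod_poly_def mult.assoc)
      also have "\<dots> \<in> mpoly.span ((\<lambda>z. z * prod_poly p R) ` spread_products p n A B)"
        using incomparable_straighten[OF gens AB(5,3)] by (rule mpoly_span_mult_right)
      also have "\<dots> \<subseteq> ?V"
      proof (rule mpoly.span_minimal)
        show "(\<lambda>z. z * prod_poly p R) ` spread_products p n A B \<subseteq> ?V"
        proof
          fix f assume "f \<in> (\<lambda>z. z * prod_poly p R) ` spread_products p n A B"
          then obtain A' B' where f: "f = gen_poly p A' * gen_poly p B' * prod_poly p R"
            "A' \<in> gens p n" "B' \<in> gens p n" "?w A' < ?w A" "?w A' + ?w B' = ?w A + ?w B"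
            by (auto simp: spread_products_def)
          define S' where "S' = add_mset A' (add_mset B' R)"
          have "(\<Sum>A\<in>#S. ?w A ^ 2) < (\<Sum>A\<in>#S'. ?w A ^ 2)"
            using square_spread[OF f(4) AB(5) f(5)] by (simp add: R S'_def)
          moreover have "(\<Sum>A\<in>#S. ?w A) = (\<Sum>A\<in>#S'. ?w A)"
            using f(5) by (simp add: R S'_def)
          moreover have "(\<Sum>A\<in>#S'. ?w A ^ 2) \<le> (\<Sum>A\<in>#S'. ?w A) ^ 2"
            by (rule sum_mset_square_le)
          ultimately have "\<mu> S' < \<mu> S" unfolding \<mu>_def by simp
          moreover have "set_mset S' \<subseteq> gens p n" using less.prems f by (auto simp: S'_def R)
          moreover have "f = prod_poly p S'" by (simp add: f S'_def prod_poly_def mult.assoc)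
          ultimately show "f \<in> ?V" using less.hyps by simp
        qed
      qed (rule mpoly.subspace_span)
      finally show ?thesis .
    qed
  qed
qed

section \<open>Heights and order ideals\<close>

lemma increasing_tuple_gap:
  assumes "I \<in> increasing_tuples p n" "x \<le> y" "y < p"
  shows "I ! x + (y - x) \<le> I ! y"
  using assms(2,3)
proof (induction y rule: dec_induct)
  case (step m)
  then show ?case using increasing_tuplesD(3)[OF assms(1), of m "Suc m"] by simp
qed simp

text \<open>These are the inequalities that the disjuncts of \<open>Q_le\<close> call for. By the
  fourth and the sixth, the ideal contains every poset element in a column up to
  \<open>k + p\<close> and none beyond column \<open>n + k\<close>, which settles the third
  disjunct. The last one says that right ends \<open>i + height\<close> do not increase towards
  later rows, up to truncation at the end \<open>i + n\<close> of the row.\<close>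

lemma height_facts:
  assumes A: "(I, k) \<in> gens p n" and p: "1 \<le> p" "p < n" and i: "1 \<le> i"
  shows "height p n (I, k) i \<le> n"
    and "1 \<le> height p n (I, k) i \<longleftrightarrow> i \<le> k + p"
    and "i \<le> k \<Longrightarrow> height p n (I, k) i = n"
    and "i \<le> k + p \<Longrightarrow> k + p + 1 - i \<le> height p n (I, k) i \<or> i \<le> k"
    and "p + 1 - i \<le> height p n (I, k) i"
    and "i \<le> k + p \<Longrightarrow> i + height p n (I, k) i \<le> n + k + 1"
    and "i \<le> i' \<Longrightarrow> i' \<le> k + p \<Longrightarrow>
      min (i' + height p n (I, k) i') (i + n) \<le> i + height p n (I, k) i"
proof -
  have I: "I \<in> increasing_tuples p n" using A by (simp add: gens_def)
  have ran: "1 \<le> I ! x \<and> I ! x \<le> n" if "x < p" for x using increasing_tuplesD(2)[OF I that] by simp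
  have lo: "x + 1 \<le> I ! x" if "x < p" for x
    using increasing_tuple_gap[OF I, of 0 x] ran[of 0] that by simp
  have hi: "I ! x + (p - 1 - x) \<le> n" if "x < p" for x
  proof -
    have "x \<le> p - 1" "p - 1 < p" using that by auto
    then show ?thesis using increasing_tuple_gap[OF I, of x "p - 1"] ran[of "p - 1"] by linarith
  qed
  have w: "p - (i - k) < p" if "k < i" "i \<le> k + p" for i using that p by linarith
  show "height p n (I, k) i \<le> n" using ran[OF w] by (simp add: height_def)
  show "1 \<le> height p n (I, k) i \<longleftrightarrow> i \<le> k + p"
    using ran[OF w] p by (simp add: height_def)
  show "i \<le> k \<Longrightarrow> height p n (I, k) i = n" by (simp add: height_def)
  show "i \<le> k + p \<Longrightarrow> k + p + 1 - i \<le> height p n (I, k) i \<or> i \<le> k"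
    using lo[OF w, of i] by (cases "i \<le> k") (auto simp: height_def)
  show "p + 1 - i \<le> height p n (I, k) i"
  proof -
    consider "i \<le> k" | "k < i" "i \<le> k + p" | "k + p < i" by linarith
    then show ?thesis
      using lo[OF w, of i] p i by cases (auto simp: height_def)
  qed
  show "i + height p n (I, k) i \<le> n + k + 1" if "i \<le> k + p"
    using hi[OF w, of i] that by (cases "i \<le> k") (auto simp: height_def)
  show "min (i' + height p n (I, k) i') (i + n) \<le> i + height p n (I, k) i"
    if "i \<le> i'" "i' \<le> k + p"
  proof (cases "i \<le> k")
    case True
    then show ?thesis by (simp add: height_def)
  next
    case False
    then have "I ! (p - (i' - k)) + (p - (i - k) - (p - (i' - k))) \<le> I ! (p - (i - k))"
      using that w[of i] by (intro increasing_tuple_gap[OF I]) auto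
    moreover have "p - (i - k) - (p - (i' - k)) = i' - i" using that False by linarith
    ultimately show ?thesis using that False by (simp add: height_def)
  qed
qed

lemma gen_ideal_finite_order_ideal:
  assumes A: "A \<in> gens p n" and p: "1 \<le> p" "p < n"
  shows "gen_ideal p n A \<in> finite_order_ideals (Q_set p n) (Q_le p n)"
proof -
  obtain I k where Ik: "A = (I, k)" by (cases A)
  note h = height_facts[OF A[unfolded Ik] p, folded Ik]
  note G = gen_ideal_height[OF A]
  have le: "i \<le> k + p \<and> j < k + p + n" if "(i, j) \<in> gen_ideal p n A" for i j
  proof -
    have *: "1 \<le> i" "i \<le> j" "j < i + height p n A i" using that by (auto simp: G Q_set_def)
    then have "1 \<le> height p n A i" by simp
    then show ?thesis using h(1,2)[OF *(1)] *(3) by auto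
  qed
  have "finite (gen_ideal p n A)"
    by (rule finite_subset[of _ "{..k + p} \<times> {..<k + p + n}"]) (use le in auto)
  moreover have "(i1, j1) \<in> gen_ideal p n A"
    if 2: "(i2, j2) \<in> gen_ideal p n A" and 1: "(i1, j1) \<in> Q_set p n" and Q: "Q_le p n (i1, j1) (i2, j2)"
    for i1 j1 i2 j2
  proof -
    have i1: "1 \<le> i1" "i1 \<le> j1" "j1 < i1 + n" "p + 1 \<le> j1" using 1 by (auto simp: Q_set_def)
    have i2: "1 \<le> i2" "j2 < i2 + height p n A i2" "i2 \<le> k + p"
      using 2 le[OF 2] by (auto simp: G Q_set_def)
    consider "i1 \<le> i2" "j1 \<le> j2" | "i1 + p \<le> i2" | "int j1 + int n - int p \<le> int j2"
      using Q by (auto simp: Q_le_def)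
    then have "j1 < i1 + height p n A i1"
    proof cases
      case 1
      then show ?thesis using h(7)[OF i1(1) 1(1) i2(3)] i1 i2 by (auto simp: min_def split: if_splits)
    next
      case 2
      then show ?thesis using h(3)[OF i1(1)] i1 i2 by simp
    next
      case 3
      have "j1 \<le> k + p" using 3 h(6)[OF i2(1,3)] i2(2) by linarith
      then show ?thesis using h(3)[OF i1(1)] h(4)[OF i1(1)] i1 by (cases "i1 \<le> k") auto
    qed
    then show ?thesis using 1 by (simp add: G)
  qed
  moreover have "gen_ideal p n A \<subseteq> Q_set p n" by (auto simp: G)
  ultimately show ?thesis unfolding finite_order_ideals_def by fast
qed

section \<open>Tuples from order ideals\<close>

lemma initial_segment_eq:
  fixes R :: "nat set"
  assumes "finite R" "\<And>j. j \<in> R \<Longrightarrow> m \<le> j" "\<And>i j. j \<in> R \<Longrightarrow> m \<le> i \<Longrightarrow> i \<le> j \<Longrightarrow> i \<in> R"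
  shows "R = {m..<m + card R}"
proof (cases "R = {}")
  case False
  then have M: "Max R \<in> R" using assms(1) by (rule_tac Max_in)
  have "R \<subseteq> {m..Max R}" using assms(1,2) by auto
  moreover have "{m..Max R} \<subseteq> R" using assms(3)[OF M] by auto
  ultimately have R: "R = {m..Max R}" by (rule subset_antisym)
  have "card R = card {m..Max R}" using R by (rule arg_cong)
  then have "{m..Max R} = {m..<m + card R}" using assms(2)[OF M] by auto
  then show ?thesis using R by (rule trans[rotated])
qed simp

text \<open>The tuple is read off from the row heights. By the first disjunct of \<open>Q_le\<close>
  each row is an initial segment. If the last row \<open>K\<close> of positive height exceeds
  \<open>p\<close>, the element \<open>(K, K)\<close> fills the rows up to \<open>K - p\<close> by
  the second disjunct. The third one keeps rows after \<open>K - p + 1\<close> from being full, so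
  heights strictly decrease in the window.\<close>

lemma finite_order_ideal_gen_ideal:
  assumes J: "J \<in> finite_order_ideals (Q_set p n) (Q_le p n)" and p: "1 \<le> p" "p < n"
  shows "\<exists>A\<in>gens p n. gen_ideal p n A = J"
proof -
  have sub: "J \<subseteq> Q_set p n" and fin: "finite J"
    and dc: "\<And>x y. x \<in> J \<Longrightarrow> y \<in> Q_set p n \<Longrightarrow> Q_le p n y x \<Longrightarrow> y \<in> J"
    using J by (auto simp: finite_order_ideals_def)
  have Q: "(i, j) \<in> Q_set p n \<longleftrightarrow> 1 \<le> i \<and> i \<le> j \<and> p + 1 \<le> j \<and> j < i + n" for i j
    by (auto simp: Q_set_def)
  \<comment> \<open>The summand \<open>p + 1 - i\<close> accounts for the columns from
    \<open>i\<close> to \<open>p\<close>, which carry no poset element.\<close>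
  define b where "b i = card {j. (i, j) \<in> J} + (p + 1 - i)" for i
  have finr: "finite {j. (i, j) \<in> J}" for i
    using finite_subset[OF _ finite_imageI[OF fin, of snd], of "{j. (i, j) \<in> J}"] by force
  have seg: "{j. (i, j) \<in> J} = {i + (p + 1 - i)..<i + (p + 1 - i) + card {j. (i, j) \<in> J}}" for i
  proof (rule initial_segment_eq[OF finr])
    show "i + (p + 1 - i) \<le> j" if "j \<in> {j. (i, j) \<in> J}" for j
      using that sub Q[of i j] by auto
    show "j' \<in> {j. (i, j) \<in> J}" if "j \<in> {j. (i, j) \<in> J}" "i + (p + 1 - i) \<le> j'" "j' \<le> j" for j j'
    proof -
      have "(i, j) \<in> Q_set p n" using that sub by auto
      then have "(i, j') \<in> Q_set p n" using that Q by auto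
      then show ?thesis using dc[of "(i, j)" "(i, j')"] that by (simp add: Q_le_def)
    qed
  qed
  have mem: "(i, j) \<in> J \<longleftrightarrow> (i, j) \<in> Q_set p n \<and> j < i + b i" for i j
  proof
    assume ij: "(i, j) \<in> J"
    then have "j \<in> {i + (p + 1 - i)..<i + (p + 1 - i) + card {j. (i, j) \<in> J}}" using seg[of i] by blast
    then show "(i, j) \<in> Q_set p n \<and> j < i + b i" using ij sub by (auto simp: b_def)
  next
    assume ij: "(i, j) \<in> Q_set p n \<and> j < i + b i"
    then have "j \<in> {i + (p + 1 - i)..<i + (p + 1 - i) + card {j. (i, j) \<in> J}}" using Q by (auto simp: b_def)
    then show "(i, j) \<in> J" using seg[of i] by blast
  qed
  have bn: "b i \<le> n" if i: "1 \<le> i" for i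
  proof (rule ccontr)
    assume "\<not> b i \<le> n"
    then have "i + n \<in> {i + (p + 1 - i)..<i + b i}" using p i by auto
    then have "(i, i + n) \<in> J" using seg[of i] by (auto simp: b_def)
    then show False using sub Q[of i "i + n"] by auto
  qed
  define K where "K = Max {i. 1 \<le> i \<and> 1 \<le> b i}"
  have finK: "finite {i. 1 \<le> i \<and> 1 \<le> b i}"
  proof (rule finite_subset)
    show "{i. 1 \<le> i \<and> 1 \<le> b i} \<subseteq> {..p} \<union> fst ` J"
    proof
      fix i assume i: "i \<in> {i. 1 \<le> i \<and> 1 \<le> b i}"
      show "i \<in> {..p} \<union> fst ` J"
      proof (cases "i \<le> p")
        case False
        then have "(i, i) \<in> J" using mem[of i i] Q[of i i] i p by simp
        then show ?thesis by force
      qed simp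
    qed
  qed (use fin in simp)
  \<comment> \<open>Row \<open>p\<close> has positive height in any case, so the subtraction
    \<open>K - p\<close> does not truncate.\<close>
  have "b p \<ge> 1" by (simp add: b_def)
  then have Kp: "p \<le> K" unfolding K_def using finK p by (intro Max_ge) auto
  have Kin: "1 \<le> K" "1 \<le> b K"
    using Max_in[OF finK] \<open>b p \<ge> 1\<close> p unfolding K_def by auto
  have Kout: "b i = 0" if "K < i" for i
    using Max_ge[OF finK, of i] that Kin unfolding K_def by (metis (mono_tags, lifting) le_trans less_imp_le_nat linorder_not_less mem_Collect_eq less_one)
  define k where "k = K - p"
  have KK: "K \<le> p \<or> (K, K) \<in> J"
    using mem[of K K] Q[of K K] Kin p by auto
  have full: "b i = n" if "1 \<le> i" "i \<le> k" for i
  proof -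
    have "(K, K) \<in> J" using KK that by (auto simp: k_def)
    moreover have "(i, i + n - 1) \<in> Q_set p n" using Q that p by auto
    moreover have "i + p \<le> K" using that by (simp add: k_def)
    ultimately have "(i, i + n - 1) \<in> J" using dc by (auto simp: Q_le_def)
    then show ?thesis using mem bn[OF that(1)] by fastforce
  qed
  have pos: "1 \<le> b i" if "1 \<le> i" "i \<le> K" for i
  proof (cases "i \<le> p")
    case False
    then have "(K, K) \<in> J" using KK that by auto
    moreover have "(i, i) \<in> Q_set p n" using Q False that p by auto
    ultimately have "(i, i) \<in> J" using dc that by (auto simp: Q_le_def)
    then show ?thesis using mem by fastforce
  qed (simp add: b_def)
  have dec: "b (Suc i) < b i" if i: "1 \<le> i" "k < i" "Suc i \<le> K" for i
  proof -
    \<comment> \<open>A full row \<open>Suc i\<close> would end in an element that lies above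
      \<open>(Suc K, Suc K)\<close> in the poset, against the maximality of
      \<open>K\<close>.\<close>
    have "b (Suc i) \<noteq> n"
    proof
      assume "b (Suc i) = n"
      then have "(Suc i, i + n) \<in> J" using mem Q p i by auto
      moreover have "(Suc K, Suc K) \<in> Q_set p n" using Q Kp p by auto
      moreover have "int (Suc K) + int n - int p \<le> int (i + n)" using i by (simp add: k_def)
      ultimately have "(Suc K, Suc K) \<in> J" using dc by (auto simp: Q_le_def)
      then show False using mem Kout[of "Suc K"] by auto
    qed
    then have lt: "b (Suc i) < n" using bn[of "Suc i"] by simp
    show ?thesis
    proof (cases "p + 1 \<le> i + b (Suc i)")
      case True
      then have "(Suc i, i + b (Suc i)) \<in> J" using mem Q pos[of "Suc i"] lt i by auto
      moreover have "(i, i + b (Suc i)) \<in> Q_set p n" using Q True lt i by auto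
      ultimately have "(i, i + b (Suc i)) \<in> J" using dc by (auto simp: Q_le_def)
      then show ?thesis using mem by auto
    next
      case False
      then show ?thesis by (simp add: b_def)
    qed
  qed
  have dec': "b i' < b i" if "k < i" "i < i'" "i' \<le> K" for i i'
    using that(2,3)
  proof (induction i')
    case (Suc m)
    then show ?case using dec[of m] that(1) by (cases "m = i") auto
  qed simp
  define I where "I = map (\<lambda>x. b (K - x)) [0..<p]"
  have I: "I \<in> increasing_tuples p n"
  proof -
    have "sorted_wrt (<) I"
      unfolding I_def sorted_wrt_iff_nth_less using dec' Kp by (auto simp: k_def)
    moreover have "b (K - x) \<in> {1..n}" if "x < p" for x
      using pos[of "K - x"] bn[of "K - x"] that Kp by auto
    ultimately show ?thesis by (auto simp: increasing_tuples_def tuples_def I_def)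
  qed
  have ht: "height p n (I, k) i = b i" if "1 \<le> i" for i
  proof -
    have "K - (p - (i - k)) = i" if "k < i" "i \<le> k + p" using that Kp by (simp add: k_def)
    then show ?thesis using full[OF that] Kout[of i] Kp that
      by (auto simp: height_def I_def k_def)
  qed
  have A: "(I, k) \<in> gens p n" using I by (simp add: gens_def)
  have "gen_ideal p n (I, k) = J"
    unfolding gen_ideal_height[OF A] using mem ht Q by auto
  then show ?thesis using A by blast
qed

section \<open>Toric relations\<close>

text \<open>For fixed \<open>i\<close> these numbers encode the multiset of heights of row
  \<open>i\<close>. Upper counts are used because the exponent of a variable \<open>y\<close> in a
  product of ideal monomials is exactly such a count.\<close>

definition hcount :: "nat \<Rightarrow> nat \<Rightarrow> (nat list \<times> nat) multiset \<Rightarrow> nat \<Rightarrow> nat \<Rightarrow> nat"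
  where "hcount p n S i a = size {#A \<in># S. a \<le> height p n A i#}"

lemma hcount_add_mset:
  "hcount p n (add_mset A S) i a = (if a \<le> height p n A i then 1 else 0) + hcount p n S i a"
  by (simp add: hcount_def)

definition same_heights :: "nat \<Rightarrow> nat \<Rightarrow> (nat list \<times> nat) multiset \<Rightarrow> (nat list \<times> nat) multiset \<Rightarrow> bool"
  where "same_heights p n S T \<longleftrightarrow> (\<forall>i\<ge>1. \<forall>a. hcount p n S i a = hcount p n T i a)"

definition ideal_monom :: "nat \<Rightarrow> nat \<Rightarrow> nat list \<times> nat \<Rightarrow> (nat \<times> nat) monom"
  where "ideal_monom p n A = indicator_monom (gen_ideal p n A)"

lemma size_filter_split:
  assumes "\<And>A. A \<in># S \<Longrightarrow> P A \<longleftrightarrow> Q A \<or> R A" "\<And>A. A \<in># S \<Longrightarrow> \<not> (Q A \<and> R A)"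
  shows "size (filter_mset P S) = size (filter_mset Q S) + size (filter_mset R S)"
  using assms by (induction S) auto

lemma lookup_sum_mset_indicator:
  assumes "\<And>A. A \<in># S \<Longrightarrow> Poly_Mapping.lookup (f A) v = (if P A then 1 else (0::nat))"
  shows "Poly_Mapping.lookup (\<Sum>A\<in>#S. f A) v = size (filter_mset P S)"
  using assms by (induction S) (auto simp: lookup_add)

text \<open>A row \<open>g\<close> lies in the window iff its height is positive and that of row
  \<open>g + p\<close> is zero. This expresses exponents through heights alone, without reference to
  \<open>k\<close>.\<close>

lemma lookup_gen_monom:
  assumes A: "A \<in> gens p n" and p: "1 \<le> p" "p < n" and i: "i < p"
  shows "Poly_Mapping.lookup (gen_monom p A) (i + 1, a, \<kappa>) =
    (if height p n A (p * \<kappa> + i + 1) = a \<and> height p n A (p * \<kappa> + i + 1 + p) = 0 \<and> 1 \<le> a then 1 else 0)"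
proof -
  obtain I k where Ik: "A = (I, k)" by (cases A)
  let ?g = "p * \<kappa> + i + 1"
  have I: "I \<in> increasing_tuples p n" using A by (simp add: Ik gens_def)
  note h = height_facts[OF A[unfolded Ik] p]
  have "a = I ! lead_perm p k i \<and> \<kappa> = lead_exp p k i \<longleftrightarrow>
    height p n (I, k) ?g = a \<and> height p n (I, k) (?g + p) = 0 \<and> 1 \<le> a"
  proof
    assume L: "a = I ! lead_perm p k i \<and> \<kappa> = lead_exp p k i"
    then have g: "?g = k + p - lead_perm p k i"
      using lead_perm_exp[OF i, of k] lead_perm_lt[OF i, of k] i by simp
    then have "k < ?g" "?g \<le> k + p" "p - (?g - k) = lead_perm p k i"
      using lead_perm_lt[OF i, of k] by simp_all
    then show "height p n (I, k) ?g = a \<and> height p n (I, k) (?g + p) = 0 \<and> 1 \<le> a"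
      using L increasing_tuplesD(2)[OF I lead_perm_lt[OF i]] by (simp add: height_def)
  next
    assume R: "height p n (I, k) ?g = a \<and> height p n (I, k) (?g + p) = 0 \<and> 1 \<le> a"
    then have g: "?g \<le> k + p" "k < ?g" using h(2)[of ?g] h(2)[of "?g + p"] by auto
    define x where "x = k + p - ?g"
    have x: "x < p" "k + p - 1 - i = p * \<kappa> + x" using g by (auto simp: x_def)
    then have "lead_exp p k i = \<kappa>" "lead_perm p k i = x"
      using i by (simp_all add: lead_exp_def lead_perm_def)
    moreover have "p - (?g - k) = x" using g by (simp add: x_def)
    ultimately show "a = I ! lead_perm p k i \<and> \<kappa> = lead_exp p k i"
      using R g by (auto simp: height_def)
  qed
  moreover have "Poly_Mapping.lookup (gen_monom p A) (i + 1, a, \<kappa>) =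
      (if a = I ! lead_perm p k i \<and> \<kappa> = lead_exp p k i then 1 else 0)"
    using i by (auto simp: gen_monom_def Ik lookup_row_monom)
  ultimately show ?thesis by (simp add: Ik)
qed

lemma lookup_gen_monom_outside:
  assumes "\<not> (\<exists>i<p. r = i + 1)"
  shows "Poly_Mapping.lookup (gen_monom p A) (r, a, \<kappa>) = 0"
  using assms by (cases A) (auto simp: gen_monom_def lookup_row_monom)

definition window_count :: "nat \<Rightarrow> nat \<Rightarrow> (nat list \<times> nat) multiset \<Rightarrow> nat \<Rightarrow> nat \<Rightarrow> nat"
  where "window_count p n S g a = size {#A \<in># S. height p n A g = a \<and> height p n A (g + p) = 0 \<and> 1 \<le> a#}"

lemma lookup_sum_gen_monom:
  assumes S: "set_mset S \<subseteq> gens p n" and p: "1 \<le> p" "p < n" and i: "i < p"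
  shows "Poly_Mapping.lookup (\<Sum>A\<in>#S. gen_monom p A) (i + 1, a, \<kappa>) = window_count p n S (p * \<kappa> + i + 1) a"
  unfolding window_count_def
  by (rule lookup_sum_mset_indicator, rule lookup_gen_monom[OF _ p i]) (use S in blast)

lemma sum_gen_monom_eq_iff_window:
  assumes S: "set_mset S \<subseteq> gens p n" and T: "set_mset T \<subseteq> gens p n" and p: "1 \<le> p" "p < n"
  shows "(\<Sum>A\<in>#S. gen_monom p A) = (\<Sum>A\<in>#T. gen_monom p A) \<longleftrightarrow>
    (\<forall>g\<ge>1. \<forall>a. window_count p n S g a = window_count p n T g a)"
proof
  assume eq: "(\<Sum>A\<in>#S. gen_monom p A) = (\<Sum>A\<in>#T. gen_monom p A)"
  show "\<forall>g\<ge>1. \<forall>a. window_count p n S g a = window_count p n T g a"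
  proof (intro allI impI)
    fix g a :: nat assume "1 \<le> g"
    define \<kappa> i where "\<kappa> = (g - 1) div p" and "i = (g - 1) mod p"
    have "p * \<kappa> + i + 1 = g" "i < p" using \<open>1 \<le> g\<close> p by (simp_all add: \<kappa>_def i_def)
    then show "window_count p n S g a = window_count p n T g a"
      using lookup_sum_gen_monom[OF S p, of i a \<kappa>] lookup_sum_gen_monom[OF T p, of i a \<kappa>] eq by simp
  qed
next
  assume eq: "\<forall>g\<ge>1. \<forall>a. window_count p n S g a = window_count p n T g a"
  show "(\<Sum>A\<in>#S. gen_monom p A) = (\<Sum>A\<in>#T. gen_monom p A)"
  proof (rule poly_mapping_eqI)
    fix v :: zvar
    obtain r a \<kappa> where v: "v = (r, a, \<kappa>)" by (cases v)
    show "Poly_Mapping.lookup (\<Sum>A\<in>#S. gen_monom p A) v = Poly_Mapping.lookup (\<Sum>A\<in>#T. gen_monom p A) v"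
    proof (cases "\<exists>i<p. r = i + 1")
      case True
      then obtain i where "i < p" "r = i + 1" by blast
      then show ?thesis unfolding v using lookup_sum_gen_monom[OF S p] lookup_sum_gen_monom[OF T p] eq by simp
    next
      case False
      have "Poly_Mapping.lookup (\<Sum>A\<in>#U. gen_monom p A) v = 0" for U
        by (induction U) (simp_all add: lookup_add v lookup_gen_monom_outside[OF False])
      then show ?thesis by simp
    qed
  qed
qed

lemma hcount_zero [simp]: "hcount p n S i 0 = size S"
  by (simp add: hcount_def)

text \<open>Heights strictly between \<open>0\<close> and \<open>n\<close> occur only in the window,
  so passing from \<open>a\<close> to \<open>a + 1\<close> loses a window count. Height
  \<open>n\<close> occurs in the window or in the rows before it, and the latter are those whose
  translate by \<open>p\<close> has positive height.\<close>

lemma hcount_facts: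
  assumes S: "set_mset S \<subseteq> gens p n" and p: "1 \<le> p" "p < n" and i: "1 \<le> i"
  shows "n < a \<Longrightarrow> hcount p n S i a = 0"
    and "i + a \<le> p + 1 \<Longrightarrow> hcount p n S i a = size S"
    and "1 \<le> a \<Longrightarrow> a < n \<Longrightarrow> hcount p n S i a = window_count p n S i a + hcount p n S i (a + 1)"
    and "hcount p n S i n = window_count p n S i n + hcount p n S (i + p) 1"
proof -
  have h: "height p n A i \<le> n" "p + 1 - i \<le> height p n A i"
    "height p n A (i + p) \<noteq> 0 \<Longrightarrow> height p n A i = n" if A: "A \<in># S" for A
  proof -
    obtain I k where Ik: "A = (I, k)" "(I, k) \<in> gens p n" using A S by (cases A) auto
    note h = height_facts[OF Ik(2) p]
    show "height p n A i \<le> n" "p + 1 - i \<le> height p n A i" using h(1,5)[OF i] by (simp_all add: Ik)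
    show "height p n A (i + p) \<noteq> 0 \<Longrightarrow> height p n A i = n"
      using h(2)[of "i + p"] h(3)[OF i] i by (simp add: Ik)
  qed
  show "n < a \<Longrightarrow> hcount p n S i a = 0"
    unfolding hcount_def using h(1) by fastforce
  show "hcount p n S i a = size S" if "i + a \<le> p + 1"
  proof -
    have "{#A \<in># S. a \<le> height p n A i#} = S"
      using h(2) that by (intro filter_mset_eq_conv[THEN iffD2]) fastforce
    then show ?thesis by (simp add: hcount_def)
  qed
  show "hcount p n S i a = window_count p n S i a + hcount p n S i (a + 1)" if "1 \<le> a" "a < n"
    unfolding hcount_def window_count_def
    by (rule size_filter_split) (use h(3) that in fastforce)+
  show "hcount p n S i n = window_count p n S i n + hcount p n S (i + p) 1"
    unfolding hcount_def window_count_def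
    by (rule size_filter_split) (use h p in fastforce)+
qed

lemma size_gen_monom:
  "total_degree (\<Sum>A\<in>#S. gen_monom p A) = p * size S"
  by (induction S) (auto simp: total_degree_add gen_monom_def total_degree_row_monom split: prod.split)

text \<open>Window counts omit the full rows. For equal window counts the difference of the two
  \<open>hcount\<close> values in row \<open>g\<close> is the same for all \<open>a\<close> from
  \<open>1\<close> to \<open>n\<close> and equals the difference in row \<open>g + p\<close> at
  height \<open>1\<close>, so agreement at height \<open>1\<close> passes from \<open>g\<close> to
  \<open>g + p\<close>. It starts in the rows up to \<open>p\<close>, where every height is positive
  and the count is the number of factors, known from the degree.\<close>

lemma sum_gen_monom_eq_iff:
  assumes S: "set_mset S \<subseteq> gens p n" and T: "set_mset T \<subseteq> gens p n" and p: "1 \<le> p" "p < n"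
  shows "(\<Sum>A\<in>#S. gen_monom p A) = (\<Sum>A\<in>#T. gen_monom p A) \<longleftrightarrow> same_heights p n S T"
proof
  note hS = hcount_facts[OF S p] and hT = hcount_facts[OF T p]
  have win0: "window_count p n U g 0 = 0" for U g by (simp add: window_count_def)
  have winn: "window_count p n U g a = 0" if "set_mset U \<subseteq> gens p n" "1 \<le> g" "n < a" for U g a
  proof -
    have "window_count p n U g a \<le> hcount p n U g a"
      unfolding window_count_def hcount_def by (induction U) auto
    then show ?thesis using hcount_facts(1)[OF that(1) p that(2,3)] by simp
  qed
  {
    assume same: "same_heights p n S T"
    have "window_count p n S g a = window_count p n T g a" if g: "1 \<le> g" for g a
    proof -
      have eq: "hcount p n S i b = hcount p n T i b" if "1 \<le> i" for i b
        using same that by (simp add: same_heights_def)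
      consider "a = 0" | "1 \<le> a" "a < n" | "a = n" | "n < a" by linarith
      then show ?thesis
      proof cases
        case 2
        then show ?thesis using hS(3)[OF g 2] hT(3)[OF g 2] eq[OF g] by simp
      next
        case 3
        then show ?thesis using hS(4)[OF g] hT(4)[OF g] eq[OF g, of n] eq[of "g + p" 1] g by simp
      qed (use win0 winn[OF S g] winn[OF T g] in simp_all)
    qed
    then show "(\<Sum>A\<in>#S. gen_monom p A) = (\<Sum>A\<in>#T. gen_monom p A)"
      using sum_gen_monom_eq_iff_window[OF S T p] by blast
  }
  assume eq: "(\<Sum>A\<in>#S. gen_monom p A) = (\<Sum>A\<in>#T. gen_monom p A)"
  then have win: "window_count p n S g a = window_count p n T g a" if "1 \<le> g" for g a
    using sum_gen_monom_eq_iff_window[OF S T p] that by blast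
  have size: "size S = size T"
    using arg_cong[OF eq, of total_degree] p by (simp add: size_gen_monom)
  have diff: "int (hcount p n S g a) - int (hcount p n T g a) =
      int (hcount p n S (g + p) 1) - int (hcount p n T (g + p) 1)" if g: "1 \<le> g" and a: "a \<le> n" "1 \<le> a" for g a
    using a
  proof (induction a rule: inc_induct)
    case base
    then show ?case using hS(4)[OF g] hT(4)[OF g] win[OF g, of n] by simp
  next
    case (step m)
    then show ?case using hS(3)[OF g, of m] hT(3)[OF g, of m] win[OF g, of m] by simp
  qed
  have one: "hcount p n S g 1 = hcount p n T g 1" if "1 \<le> g" for g
    using that
  proof (induction g rule: less_induct)
    case (less g)
    show ?case
    proof (cases "g \<le> p")
      case True
      then show ?thesis using hS(2)[OF less.prems, of 1] hT(2)[OF less.prems, of 1] size by simp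
    next
      case False
      then have "1 \<le> g - p" "g - p < g" "g - p + p = g" using p by auto
      then show ?thesis using diff[of "g - p" 1] less.IH[of "g - p"] p by simp
    qed
  qed
  have "hcount p n S g a = hcount p n T g a" if g: "1 \<le> g" for g a
  proof -
    consider "a = 0" | "1 \<le> a" "a \<le> n" | "n < a" by linarith
    then show ?thesis
    proof cases
      case 2
      then show ?thesis using diff[OF g 2(2,1)] one[of "g + p"] g by simp
    qed (use size hS(1)[OF g] hT(1)[OF g] in simp_all)
  qed
  then show "same_heights p n S T" by (simp add: same_heights_def)
qed

lemma lookup_sum_ideal_monom:
  assumes S: "set_mset S \<subseteq> gens p n" and p: "1 \<le> p" "p < n"
  shows "Poly_Mapping.lookup (\<Sum>A\<in>#S. ideal_monom p n A) (i, j) =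
    (if (i, j) \<in> Q_set p n then hcount p n S i (j + 1 - i) else 0)"
proof -
  have "Poly_Mapping.lookup (ideal_monom p n A) (i, j) =
      (if (i, j) \<in> Q_set p n \<and> j + 1 - i \<le> height p n A i then 1 else 0)" if "A \<in># S" for A
  proof -
    have A: "A \<in> gens p n" using that S by blast
    have "finite (gen_ideal p n A)"
      using gen_ideal_finite_order_ideal[OF A p] by (simp add: finite_order_ideals_def)
    then have "Poly_Mapping.lookup (ideal_monom p n A) (i, j) = indicator (gen_ideal p n A) (i, j)"
      by (simp add: ideal_monom_def lookup_indicator_monom)
    then show ?thesis
      unfolding gen_ideal_height[OF A] by (auto simp: indicator_def Q_set_def)
  qed
  then have "Poly_Mapping.lookup (\<Sum>A\<in>#S. ideal_monom p n A) (i, j) =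
      size {#A \<in># S. (i, j) \<in> Q_set p n \<and> j + 1 - i \<le> height p n A i#}"
    by (rule lookup_sum_mset_indicator)
  then show ?thesis by (auto simp: hcount_def)
qed

text \<open>Heights \<open>a\<close> with \<open>i + a \<le> p + 1\<close> are reached by every
  generator and leave no trace in the \<open>y\<close> variables. Their counts equal the number of
  factors, so this number, the exponent of \<open>s\<close>, has to be compared as well.\<close>

lemma sum_ideal_monom_eq_iff:
  assumes S: "set_mset S \<subseteq> gens p n" and T: "set_mset T \<subseteq> gens p n" and p: "1 \<le> p" "p < n"
  shows "size S = size T \<and> (\<Sum>A\<in>#S. ideal_monom p n A) = (\<Sum>A\<in>#T. ideal_monom p n A) \<longleftrightarrow>
    same_heights p n S T"
proof
  assume same: "same_heights p n S T"
  then have "hcount p n S 1 0 = hcount p n T 1 0" unfolding same_heights_def by blast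
  moreover have "(\<Sum>A\<in>#S. ideal_monom p n A) = (\<Sum>A\<in>#T. ideal_monom p n A)"
  proof (rule poly_mapping_eqI)
    fix q :: "nat \<times> nat"
    obtain i j where q: "q = (i, j)" by (cases q)
    show "Poly_Mapping.lookup (\<Sum>A\<in>#S. ideal_monom p n A) q = Poly_Mapping.lookup (\<Sum>A\<in>#T. ideal_monom p n A) q"
      using same unfolding q lookup_sum_ideal_monom[OF S p] lookup_sum_ideal_monom[OF T p]
      by (auto simp: same_heights_def Q_set_def)
  qed
  ultimately show "size S = size T \<and> (\<Sum>A\<in>#S. ideal_monom p n A) = (\<Sum>A\<in>#T. ideal_monom p n A)" by simp
next
  assume eq: "size S = size T \<and> (\<Sum>A\<in>#S. ideal_monom p n A) = (\<Sum>A\<in>#T. ideal_monom p n A)"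
  have "hcount p n S i a = hcount p n T i a" if i: "1 \<le> i" for i a
  proof -
    consider "n < a" | "i + a \<le> p + 1" | "a \<le> n" "p + 1 \<le> i + a - 1" "1 \<le> a" | "a = 0" by linarith
    then show ?thesis
    proof cases
      case 3
      then have "(i, i + a - 1) \<in> Q_set p n" "i + a - 1 + 1 - i = a" using i by (auto simp: Q_set_def)
      then show ?thesis
        using lookup_sum_ideal_monom[OF S p, of i "i + a - 1"] lookup_sum_ideal_monom[OF T p, of i "i + a - 1"] eq
        by simp
    qed (use hcount_facts(1,2)[OF S p i] hcount_facts(1,2)[OF T p i] eq in simp_all)
  qed
  then show "same_heights p n S T" by (simp add: same_heights_def)
qed

section \<open>Uniqueness of multichains with given height counts\<close>

lemma gen_ideal_inj:
  assumes A: "A \<in> gens p n" and B: "B \<in> gens p n" and p: "1 \<le> p" "p < n"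
    and eq: "gen_ideal p n A = gen_ideal p n B"
  shows "A = B"
proof -
  obtain I k J l where AB: "A = (I, k)" "B = (J, l)" by (cases A, cases B)
  have "same_heights p n {#A#} {#B#}"
    using sum_ideal_monom_eq_iff[of "{#A#}" p n "{#B#}"] A B p eq by (simp add: ideal_monom_def)
  then have "a \<le> height p n A i \<longleftrightarrow> a \<le> height p n B i" if "1 \<le> i" for i a
    using that unfolding same_heights_def hcount_def by (auto split: if_splits)
  then have h: "height p n A i = height p n B i" if "1 \<le> i" for i
    using that by (metis le_antisym order_refl)
  have "i \<le> k + p \<longleftrightarrow> i \<le> l + p" if "1 \<le> i" for i
    using h[OF that] height_facts(2)[OF A[unfolded AB] p that] height_facts(2)[OF B[unfolded AB] p that]
    by (simp add: AB)
  from this[of "k + p"] this[of "l + p"] have kl: "k = l" using p by simp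
  have I: "length I = p" "length J = p"
    using A B by (auto simp: AB gens_def increasing_tuples_def tuples_def)
  have "I = J"
  proof (rule nth_equalityI)
    fix x assume "x < length I"
    then have "1 \<le> l + p - x" "\<not> l + p - x \<le> l" "l + p - x \<le> l + p" "p - (l + p - x - l) = x"
      using I by auto
    then show "I ! x = J ! x" using h[of "l + p - x"] by (simp add: height_def AB kl)
  qed (simp add: I)
  then show ?thesis by (simp add: AB kl)
qed

text \<open>The largest ideal of a multichain is the union of all its members, and an element lies
  in the union iff its count is positive. So the counts determine the top member, and it can be
  removed from two multichains at once.\<close>

lemma standard_top:
  assumes "standard p n S" "S \<noteq> {#}" "set_mset S \<subseteq> gens p n"
  shows "\<exists>A\<in>#S. gen_ideal p n A = {(i, j) \<in> Q_set p n. 0 < hcount p n S i (j + 1 - i)}"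
proof -
  have "finite (gen_ideal p n ` set_mset S)" "gen_ideal p n ` set_mset S \<noteq> {}" using assms by auto
  then obtain M where M: "M \<in> gen_ideal p n ` set_mset S"
    "\<And>X. X \<in> gen_ideal p n ` set_mset S \<Longrightarrow> M \<subseteq> X \<Longrightarrow> M = X"
    using finite_has_maximal by metis
  then obtain A where A: "A \<in># S" "M = gen_ideal p n A" by auto
  have max: "gen_ideal p n B \<subseteq> gen_ideal p n A" if "B \<in># S" for B
    using M(2)[of "gen_ideal p n B"] A that assms(1) unfolding standard_def by blast
  have pos: "0 < hcount p n S i (j + 1 - i) \<longleftrightarrow> (\<exists>B\<in>#S. j < i + height p n B i)" if "(i, j) \<in> Q_set p n" for i j
  proof -
    have "0 < hcount p n S i (j + 1 - i) \<longleftrightarrow> (\<exists>B\<in>#S. j + 1 - i \<le> height p n B i)"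
      by (auto simp: hcount_def simp flip: nonempty_has_size)
    moreover have "j + 1 - i \<le> h \<longleftrightarrow> j < i + h" for h using that by (auto simp: Q_set_def)
    ultimately show ?thesis by simp
  qed
  have "gen_ideal p n A = (\<Union>B\<in>set_mset S. gen_ideal p n B)" using max A(1) by blast
  also have "\<dots> = (\<Union>B\<in>set_mset S. {(i, j) \<in> Q_set p n. j < i + height p n B i})"
    using assms(3) by (intro SUP_cong refl gen_ideal_height) auto
  also have "\<dots> = {(i, j) \<in> Q_set p n. \<exists>B\<in>#S. j < i + height p n B i}" by blast
  also have "\<dots> = {(i, j) \<in> Q_set p n. 0 < hcount p n S i (j + 1 - i)}"
    using pos by auto
  finally show ?thesis using A(1) by blast
qed

lemma standard_unique:
  assumes "standard p n S" "standard p n T" "set_mset S \<subseteq> gens p n" "set_mset T \<subseteq> gens p n"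
    "same_heights p n S T" and p: "1 \<le> p" "p < n"
  shows "S = T"
  using assms(1-5)
proof (induction "size S" arbitrary: S T)
  case 0
  then have "hcount p n S 1 0 = hcount p n T 1 0" unfolding same_heights_def by blast
  then show ?case using 0 by simp
next
  case (Suc m)
  have "hcount p n S 1 0 = hcount p n T 1 0" using Suc.prems(5) unfolding same_heights_def by blast
  then have ne: "S \<noteq> {#}" "T \<noteq> {#}" using Suc.hyps(2) by auto
  obtain A where A: "A \<in># S" "gen_ideal p n A = {(i, j) \<in> Q_set p n. 0 < hcount p n S i (j + 1 - i)}"
    using standard_top[OF Suc.prems(1) ne(1) Suc.prems(3)] by blast
  obtain B where B: "B \<in># T" "gen_ideal p n B = {(i, j) \<in> Q_set p n. 0 < hcount p n T i (j + 1 - i)}"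
    using standard_top[OF Suc.prems(2) ne(2) Suc.prems(4)] by blast
  have "gen_ideal p n A = gen_ideal p n B"
    unfolding A(2) B(2) using Suc.prems(5) by (auto simp: same_heights_def Q_set_def)
  then have "A = B" using gen_ideal_inj[OF _ _ p] A(1) B(1) Suc.prems(3,4) by blast
  obtain S' where S': "S = add_mset A S'" using A(1) by (metis insert_DiffM)
  obtain T' where T': "T = add_mset A T'" using B(1) \<open>A = B\<close> by (metis insert_DiffM)
  have "same_heights p n S' T'"
    using Suc.prems(5) unfolding same_heights_def S' T' hcount_add_mset by simp
  then have "S' = T'"
    using Suc.hyps Suc.prems(1-4) by (intro Suc.hyps(1)) (auto simp: S' T' standard_def)
  then show ?case by (simp add: S' T')
qed

section \<open>The initial subalgebra and the isomorphism\<close>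

definition prod_monom :: "nat \<Rightarrow> (nat list \<times> nat) multiset \<Rightarrow> zvar monom"
  where "prod_monom p S = (\<Sum>A\<in>#S. gen_monom p A)"

definition prod_ideal_monom :: "nat \<Rightarrow> nat \<Rightarrow> (nat list \<times> nat) multiset \<Rightarrow> (nat \<times> nat) monom"
  where "prod_ideal_monom p n S = (\<Sum>A\<in>#S. ideal_monom p n A)"

definition gen_monoid :: "nat \<Rightarrow> nat \<Rightarrow> zvar monom set"
  where "gen_monoid p n = prod_monom p ` {S. set_mset S \<subseteq> gens p n}"

lemma subspace_keys: "mpoly.subspace {f :: 'v mpoly. Poly_Mapping.keys f \<subseteq> M}"
proof (rule mpoly.subspaceI)
  fix x y :: "'v mpoly" and c
  assume "x \<in> {f. Poly_Mapping.keys f \<subseteq> M}" "y \<in> {f. Poly_Mapping.keys f \<subseteq> M}"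
  then show "x + y \<in> {f. Poly_Mapping.keys f \<subseteq> M}"
    using Poly_Mapping.keys_add[of x y] by blast
next
  fix x :: "'v mpoly" and c
  assume "x \<in> {f. Poly_Mapping.keys f \<subseteq> M}"
  then show "mpoly_scale c x \<in> {f. Poly_Mapping.keys f \<subseteq> M}" by (auto simp: in_keys_iff)
qed simp

lemma poly_mapping_sum_single:
  "(f :: 'v \<Rightarrow>\<^sub>0 'b::comm_monoid_add) = (\<Sum>m\<in>Poly_Mapping.keys f. Poly_Mapping.single m (Poly_Mapping.lookup f m))"
proof (rule poly_mapping_eqI)
  fix m
  have "Poly_Mapping.lookup (\<Sum>m\<in>Poly_Mapping.keys f. Poly_Mapping.single m (Poly_Mapping.lookup f m)) m =
      (\<Sum>m'\<in>Poly_Mapping.keys f. if m' = m then Poly_Mapping.lookup f m' else 0)"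
    by (simp add: lookup_sum lookup_single when_def)
  then show "Poly_Mapping.lookup f m =
      Poly_Mapping.lookup (\<Sum>m\<in>Poly_Mapping.keys f. Poly_Mapping.single m (Poly_Mapping.lookup f m)) m"
    by (auto simp: in_keys_iff)
qed

lemma mpoly_scale_single: "mpoly_scale c (Poly_Mapping.single m d) = Poly_Mapping.single m (c * d)"
  by (simp add: mpoly_scale_def const_def mult_single)

lemma monom_sum: "(\<Sum>i\<in>A. Polynomial.monom (f i) d) = Polynomial.monom (\<Sum>i\<in>A. f i) d"
  by (rule poly_eqI) (simp add: coeff_sum)

lemma subalgebra_generated_sum:
  assumes zero: "\<And>x. scale 0 x = 0" and f: "\<And>i. i \<in> A \<Longrightarrow> f i \<in> subalgebra_generated scale S"
  shows "(\<Sum>i\<in>A. f i) \<in> subalgebra_generated scale S"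
proof -
  have "0 \<in> subalgebra_generated scale S"
    using subalgebra_generated.scale[OF subalgebra_generated.one, of scale 0] zero by metis
  then show ?thesis using f
    by (induction A rule: infinite_finite_induct) (auto intro: subalgebra_generated.add)
qed

context
  fixes p n :: nat
  assumes p: "1 \<le> p" and pn: "p < n"
begin

section \<open>Leading monomials of the Pluecker algebra\<close>

lemma prod_poly_leading:
  assumes "set_mset S \<subseteq> gens p n"
  shows "leading_monom (prod_monom p S) (prod_poly p S)"
  using assms
proof (induction S)
  case empty
  then show ?case by (simp add: prod_monom_def prod_poly_def leading_monom_def)
next
  case (add A S)
  obtain I k where A: "A = (I, k)" "I \<in> increasing_tuples p n" using add.prems by (auto simp: gens_def)
  have "leading_monom (gen_monom p A) (gen_poly p A)"
    using D_coeff_leading(1)[OF p A(2), of k] by (simp add: A gen_poly_def)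
  then show ?case
    using leading_monom_mult(1) add by (simp add: prod_monom_def prod_poly_def)
qed

lemma prod_poly_pluecker:
  assumes "set_mset S \<subseteq> gens p n"
  shows "prod_poly p S \<in> pluecker_algebra p n"
  using assms
proof (induction S)
  case empty
  then show ?case by (simp add: prod_poly_def pluecker_algebra_def subalgebra_generated.one)
next
  case (add A S)
  obtain I k where A: "A = (I, k)" "I \<in> tuples p n"
    using add.prems by (auto simp: gens_def increasing_tuples_def)
  have "gen_poly p A \<in> pluecker_algebra p n"
    unfolding pluecker_algebra_def A gen_poly_def prod.case
    by (rule subalgebra_generated.gen) (use A in blast)
  then show ?case
    using add unfolding pluecker_algebra_def by (simp add: prod_poly_def subalgebra_generated.mult)
qed

lemma pluecker_algebra_span:
  assumes "f \<in> pluecker_algebra p n"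
  shows "f \<in> mpoly.span (prod_poly p ` {S. set_mset S \<subseteq> gens p n \<and> standard p n S})" (is "_ \<in> ?V")
proof -
  let ?Z = "prod_poly p ` {S. set_mset S \<subseteq> gens p n}"
  have "f \<in> mpoly.span ?Z"
    using assms unfolding pluecker_algebra_def
  proof (induction rule: subalgebra_generated.induct)
    case (gen x)
    then obtain I k where x: "x = D_coeff p I k" "I \<in> tuples p n" by blast
    have "I ! i \<in> {1..n}" if "i < p" for i
      using x(2) that nth_mem by (fastforce simp: tuples_def)
    then consider "coldet p ((!) I) = 0" | I' \<epsilon> where "I' \<in> increasing_tuples p n"
        "coldet p ((!) I) = of_int \<epsilon> * coldet p ((!) I')"
      using coldet_sort[of p "(!) I" n] by blast
    then show ?case
    proof cases
      case 1
      then show ?thesis by (simp add: x D_coeff_coldet mpoly.span_zero)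
    next
      case 2
      have "x = mpoly_scale (of_int \<epsilon>) (prod_poly p {#(I', k)#})"
        by (simp add: x D_coeff_coldet 2 fps_nth_of_int_mult prod_poly_def gen_poly_def mpoly_scale_of_int)
      moreover have "prod_poly p {#(I', k)#} \<in> ?Z" using 2(1) by (intro imageI) (simp add: gens_def)
      ultimately show ?thesis by (simp add: mpoly.span_scale mpoly.span_base)
    qed
  next
    case one
    have "(1 :: zvar mpoly) = prod_poly p {#}" by (simp add: prod_poly_def)
    then show ?case by (intro mpoly.span_base) (auto intro!: image_eqI[of _ _ "{#}"])
  next
    case (mult x y)
    have "x * y \<in> mpoly.span ((\<lambda>z. z * y) ` ?Z)" using mult.IH(1) by (rule mpoly_span_mult_right)
    also have "\<dots> \<subseteq> mpoly.span ?Z"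
    proof (rule mpoly.span_minimal)
      show "(\<lambda>z. z * y) ` ?Z \<subseteq> mpoly.span ?Z"
      proof clarify
        fix S assume S: "set_mset S \<subseteq> gens p n"
        have "y * prod_poly p S \<in> mpoly.span ((\<lambda>z. z * prod_poly p S) ` ?Z)"
          using mult.IH(2) by (rule mpoly_span_mult_right)
        moreover have "(\<lambda>z. z * prod_poly p S) ` ?Z \<subseteq> ?Z"
        proof clarify
          fix T assume T: "set_mset T \<subseteq> gens p n"
          have "prod_poly p T * prod_poly p S = prod_poly p (T + S)" by (simp add: prod_poly_def)
          then show "prod_poly p T * prod_poly p S \<in> ?Z" using S T by (intro image_eqI[of _ _ "T + S"]) auto
        qed
        ultimately show "prod_poly p S * y \<in> mpoly.span ?Z"
          using mpoly.span_mono[of "(\<lambda>z. z * prod_poly p S) ` ?Z" ?Z] by (auto simp: mult.commute)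
      qed
    qed (rule mpoly.subspace_span)
    finally show ?case .
  qed (auto intro: mpoly.span_add mpoly.span_scale)
  also have "mpoly.span ?Z \<subseteq> ?V"
    by (rule mpoly.span_minimal) (use prod_poly_standard in \<open>auto simp: mpoly.subspace_span\<close>)
  finally show ?thesis .
qed

lemma standard_prod_monom_inj:
  "inj_on (prod_monom p) {S. set_mset S \<subseteq> gens p n \<and> standard p n S}"
proof (rule inj_onI)
  fix S T
  assume S: "S \<in> {S. set_mset S \<subseteq> gens p n \<and> standard p n S}"
    and T: "T \<in> {S. set_mset S \<subseteq> gens p n \<and> standard p n S}" and eq: "prod_monom p S = prod_monom p T"
  have "same_heights p n S T"
    using sum_gen_monom_eq_iff[OF _ _ p pn, of S T] S T eq by (simp add: prod_monom_def)
  then show "S = T" using standard_unique[OF _ _ _ _ _ p pn] S T by blast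
qed

text \<open>This is the SAGBI property: a nonzero element is a combination of standard products with
  distinct leading monomials, one of which must lead it.\<close>

lemma pluecker_leading_monom:
  assumes f: "f \<in> pluecker_algebra p n" "leading_monom m f"
  shows "m \<in> gen_monoid p n"
proof -
  let ?Y = "{S. set_mset S \<subseteq> gens p n \<and> standard p n S}"
  obtain t r where t: "finite t" "t \<subseteq> prod_poly p ` ?Y" "f = (\<Sum>x\<in>t. mpoly_scale (r x) x)"
    using pluecker_algebra_span[OF f(1)] unfolding mpoly.span_explicit by blast
  \<comment> \<open>One multiset is chosen for each polynomial of the combination; zero coefficients
    are discarded afterwards, as \<open>leading_monom_sum\<close> requires.\<close>
  obtain X where X: "X \<subseteq> ?Y" "inj_on (prod_poly p) X" "t = prod_poly p ` X"
    using t(2) by (auto simp: subset_image_inj)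
  have finX: "finite X" using t(1) X finite_image_iff by blast
  define X' where "X' = {S \<in> X. r (prod_poly p S) \<noteq> 0}"
  have "f = (\<Sum>S\<in>X. mpoly_scale (r (prod_poly p S)) (prod_poly p S))"
    unfolding t(3) X(3) by (simp add: sum.reindex[OF X(2)])
  also have "\<dots> = (\<Sum>S\<in>X'. mpoly_scale (r (prod_poly p S)) (prod_poly p S))"
    unfolding X'_def using finX by (intro sum.mono_neutral_right) auto
  finally have f_sum: "f = (\<Sum>S\<in>X'. mpoly_scale (r (prod_poly p S)) (prod_poly p S))" .
  have "f \<noteq> 0" using f(2) by (auto simp: leading_monom_def)
  then have "X' \<noteq> {}" using f_sum by auto
  have sub: "X' \<subseteq> ?Y" using X(1) by (auto simp: X'_def)
  have "\<exists>S\<in>X'. leading_monom (prod_monom p S) f"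
    unfolding f_sum
  proof (rule leading_monom_sum)
    show "finite X'" using finX by (simp add: X'_def)
    show "inj_on (prod_monom p) X'" using inj_on_subset[OF standard_prod_monom_inj sub] .
    show "leading_monom (prod_monom p S) (prod_poly p S)" if "S \<in> X'" for S
      using prod_poly_leading sub that by blast
  qed (use \<open>X' \<noteq> {}\<close> in \<open>auto simp: X'_def\<close>)
  then obtain S where S: "S \<in> X'" "leading_monom (prod_monom p S) f" by blast
  have "m = prod_monom p S"
    using S(2) f(2) ss_less_irrefl ss_less_trans unfolding leading_monom_def by metis
  then show ?thesis using S(1) X(1) unfolding gen_monoid_def X'_def by blast
qed

text \<open>Each monomial of \<open>gen_monoid\<close> is, up to a nonzero scalar, the initial term
  of a product of generators, so the span of the initial terms is the full monoid algebra.\<close>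

lemma initial_subalgebra_eq:
  "initial_subalgebra ss_less (pluecker_algebra p n) = {f. Poly_Mapping.keys f \<subseteq> gen_monoid p n}"
proof
  show "initial_subalgebra ss_less (pluecker_algebra p n) \<subseteq> {f. Poly_Mapping.keys f \<subseteq> gen_monoid p n}"
    unfolding initial_subalgebra_def
  proof (rule mpoly.span_minimal[OF _ subspace_keys], rule image_subsetI)
    fix f assume f: "f \<in> pluecker_algebra p n"
    show "initial_term ss_less f \<in> {f. Poly_Mapping.keys f \<subseteq> gen_monoid p n}"
    proof (cases "f = 0")
      case False
      then obtain m where m: "leading_monom m f" using leading_monom_exists by blast
      then show ?thesis
        using pluecker_leading_monom[OF f m] by (simp add: initial_term_leading)
    qed (simp add: initial_term_def)
  qed
next
  let ?W = "initial_subalgebra ss_less (pluecker_algebra p n)"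
  show "{f. Poly_Mapping.keys f \<subseteq> gen_monoid p n} \<subseteq> ?W"
  proof
    fix f :: "zvar mpoly" assume f: "f \<in> {f. Poly_Mapping.keys f \<subseteq> gen_monoid p n}"
    have "Poly_Mapping.single m c \<in> ?W" if "m \<in> gen_monoid p n" for m c
    proof -
      obtain S where S: "set_mset S \<subseteq> gens p n" "m = prod_monom p S"
        using \<open>m \<in> gen_monoid p n\<close> by (auto simp: gen_monoid_def)
      let ?a = "Poly_Mapping.lookup (prod_poly p S) m"
      have lead: "leading_monom m (prod_poly p S)" using prod_poly_leading S by simp
      have "initial_term ss_less (prod_poly p S) \<in> ?W"
        unfolding initial_subalgebra_def using prod_poly_pluecker[OF S(1)] by (intro mpoly.span_base imageI)
      then have "mpoly_scale (c / ?a) (initial_term ss_less (prod_poly p S)) \<in> ?W"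
        unfolding initial_subalgebra_def by (rule mpoly.span_scale)
      moreover have "?a \<noteq> 0" using lead by (simp add: leading_monom_def in_keys_iff)
      ultimately show ?thesis by (simp add: initial_term_leading[OF lead] mpoly_scale_single)
    qed
    then have "(\<Sum>m\<in>Poly_Mapping.keys f. Poly_Mapping.single m (Poly_Mapping.lookup f m)) \<in> ?W"
      unfolding initial_subalgebra_def using f by (intro mpoly.span_sum) auto
    then show "f \<in> ?W" using poly_mapping_sum_single[of f] by simp
  qed
qed

section \<open>The order ideal algebra as a monomial algebra\<close>

lemma prod_ideal_monom_in_algebra:
  assumes "set_mset S \<subseteq> gens p n"
  shows "Polynomial.monom (Poly_Mapping.single (prod_ideal_monom p n S) 1) (size S) \<in>
    order_ideal_algebra (Q_set p n) (Q_le p n)"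
  using assms
proof (induction S)
  case empty
  then show ?case
    by (simp add: prod_ideal_monom_def order_ideal_algebra_def subalgebra_generated.one)
next
  case (add A S)
  have "s_y_monom (gen_ideal p n A) \<in> order_ideal_algebra (Q_set p n) (Q_le p n)"
    unfolding order_ideal_algebra_def
    using gen_ideal_finite_order_ideal[OF _ p pn, of A] add.prems by (intro subalgebra_generated.gen) auto
  moreover have "Polynomial.monom (Poly_Mapping.single (prod_ideal_monom p n (add_mset A S)) 1) (size (add_mset A S)) =
      s_y_monom (gen_ideal p n A) * Polynomial.monom (Poly_Mapping.single (prod_ideal_monom p n S) 1) (size S)"
    by (simp add: s_y_monom_def prod_ideal_monom_def ideal_monom_def mult_monom mult_single)
  ultimately show ?case
    using add unfolding order_ideal_algebra_def by (auto intro: subalgebra_generated.mult)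
qed

lemma order_ideal_algebra_eq:
  "order_ideal_algebra (Q_set p n) (Q_le p n) =
    {F. \<forall>d. \<forall>y\<in>Poly_Mapping.keys (Polynomial.coeff F d).
      \<exists>S. set_mset S \<subseteq> gens p n \<and> size S = d \<and> prod_ideal_monom p n S = y}" (is "?B = ?C")
proof
  show "?B \<subseteq> ?C"
  proof
    fix F assume "F \<in> ?B"
    then show "F \<in> ?C"
      unfolding order_ideal_algebra_def
    proof (induction rule: subalgebra_generated.induct)
      case (gen F)
      then obtain J where J: "J \<in> finite_order_ideals (Q_set p n) (Q_le p n)" "F = s_y_monom J" by blast
      then obtain A where A: "A \<in> gens p n" "gen_ideal p n A = J"
        using finite_order_ideal_gen_ideal[OF _ p pn] by blast
      show ?case
      proof (intro CollectI allI ballI)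
        fix d y assume "y \<in> Poly_Mapping.keys (Polynomial.coeff F d)"
        then have "d = 1" "y = ideal_monom p n A"
          by (auto simp: J s_y_monom_def ideal_monom_def A split: if_splits)
        then show "\<exists>S. set_mset S \<subseteq> gens p n \<and> size S = d \<and> prod_ideal_monom p n S = y"
          using A by (intro exI[of _ "{#A#}"]) (simp add: prod_ideal_monom_def)
      qed
    next
      case one
      show ?case
      proof (intro CollectI allI ballI)
        fix d y assume "y \<in> Poly_Mapping.keys (Polynomial.coeff (1 :: (nat \<times> nat) mpoly poly) d)"
        then have "d = 0" "y = 0" by (cases "d = 0"; simp)+
        then show "\<exists>S. set_mset S \<subseteq> gens p n \<and> size S = d \<and> prod_ideal_monom p n S = y"
          by (intro exI[of _ "{#}"]) (simp add: prod_ideal_monom_def)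
      qed
    next
      case (add F G)
      show ?case
      proof (intro CollectI allI ballI)
        fix d y assume "y \<in> Poly_Mapping.keys (Polynomial.coeff (F + G) d)"
        then have "y \<in> Poly_Mapping.keys (Polynomial.coeff F d) \<or> y \<in> Poly_Mapping.keys (Polynomial.coeff G d)"
          using Poly_Mapping.keys_add by fastforce
        then show "\<exists>S. set_mset S \<subseteq> gens p n \<and> size S = d \<and> prod_ideal_monom p n S = y"
          using add.IH by blast
      qed
    next
      case (mult F G)
      show ?case
      proof (intro CollectI allI ballI)
        fix d y assume "y \<in> Poly_Mapping.keys (Polynomial.coeff (F * G) d)"
        then have "y \<in> (\<Union>i\<in>{..d}. Poly_Mapping.keys (Polynomial.coeff F i * Polynomial.coeff G (d - i)))"
          unfolding coeff_mult using Poly_Mapping.keys_sum by fast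
        then obtain i a b where i: "i \<le> d" "y = a + b" "a \<in> Poly_Mapping.keys (Polynomial.coeff F i)"
            "b \<in> Poly_Mapping.keys (Polynomial.coeff G (d - i))"
          using keys_mult by blast
        obtain S T where "set_mset S \<subseteq> gens p n" "size S = i" "prod_ideal_monom p n S = a"
          "set_mset T \<subseteq> gens p n" "size T = d - i" "prod_ideal_monom p n T = b"
          using mult.IH i(3,4) by blast
        then show "\<exists>S. set_mset S \<subseteq> gens p n \<and> size S = d \<and> prod_ideal_monom p n S = y"
          using i by (intro exI[of _ "S + T"]) (simp add: prod_ideal_monom_def)
      qed
    next
      case (scale F c)
      have "Poly_Mapping.keys (Polynomial.coeff (ys_scale c F) d) \<subseteq> Poly_Mapping.keys (Polynomial.coeff F d)" for d
        by (auto simp: ys_scale_def in_keys_iff simp flip: mpoly_scale_def)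
      then show ?case using scale.IH by blast
    qed
  qed
next
  show "?C \<subseteq> ?B"
  proof
    fix F assume F: "F \<in> ?C"
    have mono: "Polynomial.monom (Poly_Mapping.single y c) d \<in> ?B"
      if y: "y \<in> Poly_Mapping.keys (Polynomial.coeff F d)" for c d y
    proof -
      obtain S where S: "set_mset S \<subseteq> gens p n" "size S = d" "prod_ideal_monom p n S = y" using F y by blast
      have "Polynomial.monom (Poly_Mapping.single y c) d = ys_scale c (Polynomial.monom (Poly_Mapping.single y 1) d)"
        by (simp add: ys_scale_def smult_monom const_def mult_single)
      then show ?thesis
        using prod_ideal_monom_in_algebra[OF S(1)] S(2,3)
        by (simp add: order_ideal_algebra_def subalgebra_generated.scale)
    qed
    have "F = (\<Sum>d\<le>degree F. Polynomial.monom (Polynomial.coeff F d) d)"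
      by (rule poly_as_sum_of_monoms[symmetric])
    also have "\<dots> = (\<Sum>d\<le>degree F. \<Sum>y\<in>Poly_Mapping.keys (Polynomial.coeff F d).
        Polynomial.monom (Poly_Mapping.single y (Poly_Mapping.lookup (Polynomial.coeff F d) y)) d)"
      unfolding monom_sum poly_mapping_sum_single[symmetric] by (rule refl)
    also have "\<dots> \<in> ?B"
      using mono unfolding order_ideal_algebra_def
      by (intro subalgebra_generated_sum) (auto simp: ys_scale_def const_def)
    finally show "F \<in> ?B" .
  qed
qed

section \<open>The monomial isomorphism\<close>

definition repr :: "zvar monom \<Rightarrow> (nat list \<times> nat) multiset"
  where "repr m = (SOME S. set_mset S \<subseteq> gens p n \<and> prod_monom p S = m)"

text \<open>The image of a monomial is formed from a chosen factorisation;
  \<open>repr_prod_monom\<close> shows independence of the choice. The map is linear on all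
  polynomials, but its values on monomials outside \<open>gen_monoid\<close> are arbitrary, so
  multiplicativity is claimed only for polynomials supported there.\<close>

definition toric_iso :: "zvar mpoly \<Rightarrow> (nat \<times> nat) mpoly poly"
  where "toric_iso f = (\<Sum>m\<in>Poly_Mapping.keys f.
    Polynomial.monom (Poly_Mapping.single (prod_ideal_monom p n (repr m)) (Poly_Mapping.lookup f m)) (size (repr m)))"

lemma repr:
  assumes "m \<in> gen_monoid p n"
  shows "set_mset (repr m) \<subseteq> gens p n" "prod_monom p (repr m) = m"
proof -
  have "\<exists>S. set_mset S \<subseteq> gens p n \<and> prod_monom p S = m" using assms by (auto simp: gen_monoid_def)
  from someI_ex[OF this] show "set_mset (repr m) \<subseteq> gens p n" "prod_monom p (repr m) = m"
    unfolding repr_def by blast+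
qed

text \<open>Both sides say that the two multisets have equal height counts. One direction makes
  \<open>toric_iso\<close> well defined, the other makes it injective.\<close>

lemma prod_monom_eq_iff:
  assumes "set_mset S \<subseteq> gens p n" "set_mset T \<subseteq> gens p n"
  shows "prod_monom p S = prod_monom p T \<longleftrightarrow>
    size S = size T \<and> prod_ideal_monom p n S = prod_ideal_monom p n T"
  unfolding prod_monom_def prod_ideal_monom_def
  using sum_gen_monom_eq_iff[OF assms p pn] sum_ideal_monom_eq_iff[OF assms p pn] by simp

lemma repr_prod_monom:
  assumes S: "set_mset S \<subseteq> gens p n"
  shows "size (repr (prod_monom p S)) = size S"
    "prod_ideal_monom p n (repr (prod_monom p S)) = prod_ideal_monom p n S"
proof -
  have "prod_monom p S \<in> gen_monoid p n" using S by (auto simp: gen_monoid_def)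
  then show "size (repr (prod_monom p S)) = size S"
    "prod_ideal_monom p n (repr (prod_monom p S)) = prod_ideal_monom p n S"
    using prod_monom_eq_iff[OF repr(1) S] repr(2) by auto
qed

lemma toric_iso_superset:
  assumes "finite K" "Poly_Mapping.keys f \<subseteq> K"
  shows "toric_iso f = (\<Sum>m\<in>K.
    Polynomial.monom (Poly_Mapping.single (prod_ideal_monom p n (repr m)) (Poly_Mapping.lookup f m)) (size (repr m)))"
  unfolding toric_iso_def
  by (rule sum.mono_neutral_left) (use assms in \<open>auto simp: in_keys_iff\<close>)

lemma toric_iso_single:
  "toric_iso (Poly_Mapping.single m c) =
    Polynomial.monom (Poly_Mapping.single (prod_ideal_monom p n (repr m)) c) (size (repr m))"
  by (subst toric_iso_superset[of "{m}"]) auto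

lemma toric_iso_prod_monom:
  assumes "set_mset S \<subseteq> gens p n"
  shows "toric_iso (Poly_Mapping.single (prod_monom p S) c) =
    Polynomial.monom (Poly_Mapping.single (prod_ideal_monom p n S) c) (size S)"
  by (simp add: toric_iso_single repr_prod_monom[OF assms])

lemma toric_iso_add: "toric_iso (f + g) = toric_iso f + toric_iso g"
proof -
  let ?K = "Poly_Mapping.keys f \<union> Poly_Mapping.keys g"
  have *: "toric_iso h = (\<Sum>m\<in>?K. Polynomial.monom
      (Poly_Mapping.single (prod_ideal_monom p n (repr m)) (Poly_Mapping.lookup h m)) (size (repr m)))"
    if "Poly_Mapping.keys h \<subseteq> ?K" for h
    by (rule toric_iso_superset) (use that in auto)
  show ?thesis
    using *[of f] *[of g] *[OF Poly_Mapping.keys_add]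
    by (simp add: lookup_add single_add add_monom[symmetric] sum.distrib)
qed

lemma toric_iso_sum: "toric_iso (\<Sum>i\<in>A. f i) = (\<Sum>i\<in>A. toric_iso (f i))"
  by (induction A rule: infinite_finite_induct) (auto simp: toric_iso_add, auto simp: toric_iso_def)

lemma toric_iso_scale: "toric_iso (mpoly_scale c f) = ys_scale c (toric_iso f)"
proof -
  have "Poly_Mapping.keys (mpoly_scale c f) \<subseteq> Poly_Mapping.keys f" by (auto simp: in_keys_iff)
  then have "toric_iso (mpoly_scale c f) = (\<Sum>m\<in>Poly_Mapping.keys f. Polynomial.monom
      (Poly_Mapping.single (prod_ideal_monom p n (repr m)) (c * Poly_Mapping.lookup f m)) (size (repr m)))"
    by (subst toric_iso_superset) auto
  also have "\<dots> = ys_scale c (toric_iso f)"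
    unfolding toric_iso_def ys_scale_def
    by (rule poly_eqI) (auto simp: coeff_sum sum_distrib_left const_def mult_single intro!: sum.cong)
  finally show ?thesis .
qed

lemma toric_iso_mult:
  assumes f: "Poly_Mapping.keys f \<subseteq> gen_monoid p n" and g: "Poly_Mapping.keys g \<subseteq> gen_monoid p n"
  shows "toric_iso (f * g) = toric_iso f * toric_iso g"
proof -
  have single: "toric_iso (Poly_Mapping.single a c * Poly_Mapping.single b d) =
      toric_iso (Poly_Mapping.single a c) * toric_iso (Poly_Mapping.single b d)"
    if a: "a \<in> gen_monoid p n" and b: "b \<in> gen_monoid p n" for a b c d
  proof -
    have sub: "set_mset (repr a + repr b) \<subseteq> gens p n" using repr(1)[OF a] repr(1)[OF b] by auto
    have ab: "a + b = prod_monom p (repr a + repr b)"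
      using repr(2)[OF a] repr(2)[OF b] by (simp add: prod_monom_def)
    have "toric_iso (Poly_Mapping.single a c * Poly_Mapping.single b d) =
        Polynomial.monom (Poly_Mapping.single (prod_ideal_monom p n (repr a + repr b)) (c * d)) (size (repr a + repr b))"
      unfolding mult_single ab by (rule toric_iso_prod_monom[OF sub])
    also have "\<dots> = toric_iso (Poly_Mapping.single a c) * toric_iso (Poly_Mapping.single b d)"
      by (simp add: toric_iso_single mult_monom mult_single prod_ideal_monom_def)
    finally show ?thesis .
  qed
  let ?s = "\<lambda>f m. Poly_Mapping.single m (Poly_Mapping.lookup f m)"
  have "f * g = (\<Sum>a\<in>Poly_Mapping.keys f. ?s f a) * (\<Sum>b\<in>Poly_Mapping.keys g. ?s g b)"
    using poly_mapping_sum_single[of f] poly_mapping_sum_single[of g] by simp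
  also have "toric_iso \<dots> = (\<Sum>a\<in>Poly_Mapping.keys f. \<Sum>b\<in>Poly_Mapping.keys g.
      toric_iso (?s f a) * toric_iso (?s g b))"
    unfolding sum_product toric_iso_sum using f g by (intro sum.cong refl single) auto
  also have "\<dots> = toric_iso f * toric_iso g"
    unfolding sum_product[symmetric] toric_iso_sum[symmetric]
    using poly_mapping_sum_single[of f] poly_mapping_sum_single[of g] by simp
  finally show ?thesis .
qed

text \<open>Distinct monomials of \<open>gen_monoid\<close> have distinct images, so every
  coefficient can be read back. This gives injectivity and lets degrees be traced back to the
  source.\<close>

lemma lookup_toric_iso:
  assumes f: "Poly_Mapping.keys f \<subseteq> gen_monoid p n" and m: "m \<in> gen_monoid p n"
  shows "Poly_Mapping.lookup (Polynomial.coeff (toric_iso f) (size (repr m))) (prod_ideal_monom p n (repr m)) =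
    Poly_Mapping.lookup f m"
proof -
  have iff: "size (repr m') = size (repr m) \<and> prod_ideal_monom p n (repr m') = prod_ideal_monom p n (repr m) \<longleftrightarrow>
      m' = m" if "m' \<in> Poly_Mapping.keys f" for m'
    using prod_monom_eq_iff[OF repr(1) repr(1), of m' m] repr(2)[of m'] repr(2)[of m] that f m by auto
  have "Poly_Mapping.lookup (Polynomial.coeff (toric_iso f) (size (repr m))) (prod_ideal_monom p n (repr m)) =
      (\<Sum>m'\<in>Poly_Mapping.keys f. if size (repr m') = size (repr m) \<and>
        prod_ideal_monom p n (repr m') = prod_ideal_monom p n (repr m) then Poly_Mapping.lookup f m' else 0)"
    unfolding toric_iso_def coeff_sum lookup_sum
    by (intro sum.cong refl) (auto simp: lookup_single when_def)
  also have "\<dots> = (\<Sum>m'\<in>Poly_Mapping.keys f. if m' = m then Poly_Mapping.lookup f m' else 0)"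
    using iff by (intro sum.cong refl) auto
  also have "\<dots> = Poly_Mapping.lookup f m" by (auto simp: in_keys_iff)
  finally show ?thesis .
qed

lemma toric_iso_in_algebra:
  assumes f: "Poly_Mapping.keys f \<subseteq> gen_monoid p n"
  shows "toric_iso f \<in> order_ideal_algebra (Q_set p n) (Q_le p n)"
  unfolding order_ideal_algebra_eq
proof (intro CollectI allI ballI)
  fix d y assume "y \<in> Poly_Mapping.keys (Polynomial.coeff (toric_iso f) d)"
  then have "y \<in> (\<Union>m\<in>Poly_Mapping.keys f. Poly_Mapping.keys (Polynomial.coeff (Polynomial.monom
      (Poly_Mapping.single (prod_ideal_monom p n (repr m)) (Poly_Mapping.lookup f m)) (size (repr m))) d))"
    unfolding toric_iso_def coeff_sum using Poly_Mapping.keys_sum by fast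
  then obtain m where "m \<in> Poly_Mapping.keys f" "size (repr m) = d" "prod_ideal_monom p n (repr m) = y"
    by (auto split: if_splits)
  then show "\<exists>S. set_mset S \<subseteq> gens p n \<and> size S = d \<and> prod_ideal_monom p n S = y"
    using repr(1) f by blast
qed

lemma toric_iso_surj:
  assumes F: "F \<in> order_ideal_algebra (Q_set p n) (Q_le p n)"
  shows "\<exists>f. Poly_Mapping.keys f \<subseteq> gen_monoid p n \<and> toric_iso f = F"
proof -
  have "\<forall>d. \<forall>y\<in>Poly_Mapping.keys (Polynomial.coeff F d).
      \<exists>S. set_mset S \<subseteq> gens p n \<and> size S = d \<and> prod_ideal_monom p n S = y"
    using F unfolding order_ideal_algebra_eq by blast
  then obtain R where R: "\<And>d y. y \<in> Poly_Mapping.keys (Polynomial.coeff F d) \<Longrightarrow>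
      set_mset (R d y) \<subseteq> gens p n \<and> size (R d y) = d \<and> prod_ideal_monom p n (R d y) = y"
    by metis
  define f where "f = (\<Sum>d\<le>degree F. \<Sum>y\<in>Poly_Mapping.keys (Polynomial.coeff F d).
    Poly_Mapping.single (prod_monom p (R d y)) (Poly_Mapping.lookup (Polynomial.coeff F d) y))"
  have "f \<in> {f. Poly_Mapping.keys f \<subseteq> gen_monoid p n}"
    unfolding f_def using R
    by (intro mpoly.subspace_sum[OF subspace_keys]) (auto simp: gen_monoid_def)
  moreover have "toric_iso f = F"
  proof -
    have "toric_iso f = (\<Sum>d\<le>degree F. \<Sum>y\<in>Poly_Mapping.keys (Polynomial.coeff F d).
        Polynomial.monom (Poly_Mapping.single y (Poly_Mapping.lookup (Polynomial.coeff F d) y)) d)"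
      unfolding f_def toric_iso_sum using R by (intro sum.cong refl) (simp add: toric_iso_prod_monom)
    also have "\<dots> = (\<Sum>d\<le>degree F. Polynomial.monom (Polynomial.coeff F d) d)"
      unfolding monom_sum poly_mapping_sum_single[symmetric] by (rule refl)
    also have "\<dots> = F" by (rule poly_as_sum_of_monoms)
    finally show ?thesis .
  qed
  ultimately show ?thesis by blast
qed

lemma total_degree_gen_monoid:
  assumes "m \<in> gen_monoid p n"
  shows "total_degree m = p * size (repr m)"
  using size_gen_monom[where S = "repr m" and p = p] repr(2)[OF assms] by (simp add: prod_monom_def)

lemma toric_iso_graded:
  "toric_iso ` ({f. Poly_Mapping.keys f \<subseteq> gen_monoid p n} \<inter> pluecker_degree p d) =
    order_ideal_algebra (Q_set p n) (Q_le p n) \<inter> s_degree d"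
proof (intro equalityI subsetI)
  fix F assume "F \<in> toric_iso ` ({f. Poly_Mapping.keys f \<subseteq> gen_monoid p n} \<inter> pluecker_degree p d)"
  then obtain f where f: "Poly_Mapping.keys f \<subseteq> gen_monoid p n" "F = toric_iso f"
    "\<And>m. m \<in> Poly_Mapping.keys f \<Longrightarrow> total_degree m = p * d"
    by (auto simp: pluecker_degree_def homogeneous_def)
  have "size (repr m) = d" if "m \<in> Poly_Mapping.keys f" for m
    using total_degree_gen_monoid[of m] f(1,3) that p by auto
  then have "F = Polynomial.monom (\<Sum>m\<in>Poly_Mapping.keys f.
      Poly_Mapping.single (prod_ideal_monom p n (repr m)) (Poly_Mapping.lookup f m)) d"
    unfolding f(2) toric_iso_def monom_sum[symmetric] by (intro sum.cong) auto
  then show "F \<in> order_ideal_algebra (Q_set p n) (Q_le p n) \<inter> s_degree d"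
    using toric_iso_in_algebra[OF f(1)] f(2) by (auto simp: s_degree_def)
next
  fix F assume F: "F \<in> order_ideal_algebra (Q_set p n) (Q_le p n) \<inter> s_degree d"
  then obtain f where f: "Poly_Mapping.keys f \<subseteq> gen_monoid p n" "toric_iso f = F"
    using toric_iso_surj by blast
  obtain a where a: "F = Polynomial.monom a d" using F by (auto simp: s_degree_def)
  have "total_degree m = p * d" if m: "m \<in> Poly_Mapping.keys f" for m
  proof -
    have "Poly_Mapping.lookup (Polynomial.coeff F (size (repr m))) (prod_ideal_monom p n (repr m)) \<noteq> 0"
      using lookup_toric_iso[OF f(1)] f m by (auto simp: in_keys_iff)
    then have "size (repr m) = d" by (auto simp: a split: if_splits)
    then show ?thesis using total_degree_gen_monoid m f(1) by auto
  qed
  then show "F \<in> toric_iso ` ({f. Poly_Mapping.keys f \<subseteq> gen_monoid p n} \<inter> pluecker_degree p d)"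
    using f by (auto simp: pluecker_degree_def homogeneous_def)
qed

lemma toric_iso_graded_algebra_iso:
  "graded_algebra_iso
    mpoly_scale (pluecker_degree p) (initial_subalgebra ss_less (pluecker_algebra p n))
    ys_scale s_degree (order_ideal_algebra (Q_set p n) (Q_le p n)) toric_iso"
proof -
  let ?A = "{f. Poly_Mapping.keys f \<subseteq> gen_monoid p n}"
  have "inj_on toric_iso ?A"
  proof (rule inj_onI, rule poly_mapping_eqI)
    fix f g m assume f: "f \<in> ?A" and g: "g \<in> ?A" and eq: "toric_iso f = toric_iso g"
    show "Poly_Mapping.lookup f m = Poly_Mapping.lookup g m"
    proof (cases "m \<in> gen_monoid p n")
      case True
      then show ?thesis using lookup_toric_iso[of f m] lookup_toric_iso[of g m] f g eq by simp
    next
      case False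
      then have "m \<notin> Poly_Mapping.keys f" "m \<notin> Poly_Mapping.keys g" using f g by auto
      then show ?thesis by (simp add: in_keys_iff)
    qed
  qed
  moreover have "toric_iso ` ?A = order_ideal_algebra (Q_set p n) (Q_le p n)"
    using toric_iso_in_algebra toric_iso_surj by blast
  moreover have "toric_iso 1 = 1"
    using toric_iso_prod_monom[of "{#}" 1] by (simp add: prod_monom_def prod_ideal_monom_def)
  ultimately show ?thesis
    unfolding graded_algebra_iso_def initial_subalgebra_eq
    using toric_iso_add toric_iso_mult toric_iso_scale toric_iso_graded by (simp add: bij_betw_def)
qed

text \<open>The map itself introduces no signs: the sign is the coefficient of the initial term,
  that is, the sign of the leading permutation, which depends only on \<open>k\<close> modulo
  \<open>p\<close>.\<close>

lemma toric_iso_initial_term: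
  assumes I: "I \<in> increasing_tuples p n" and "[k = r] (mod p)"
  shows "toric_iso (initial_term ss_less (D_coeff p I k)) =
    (-1) ^ ((p choose 2) + r * (p - 1)) * s_y_monom (phi_ss p n I k)"
proof -
  let ?e = "(p choose 2) + r * (p - 1)"
  have "initial_term ss_less (D_coeff p I k) = Poly_Mapping.single (prod_monom p {#(I, k)#}) ((-1) ^ ?e)"
    using initial_term_leading[OF D_coeff_leading(1)[OF p I]] D_coeff_leading(2)[OF p I]
      sign_lead_perm_cong[OF p assms(2)] by (simp add: prod_monom_def)
  then have "toric_iso (initial_term ss_less (D_coeff p I k)) =
      Polynomial.monom (Poly_Mapping.single (indicator_monom (phi_ss p n I k)) ((-1) ^ ?e)) 1"
    using toric_iso_prod_monom[of "{#(I, k)#}"] I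
    by (simp add: gens_def prod_ideal_monom_def ideal_monom_def gen_ideal_def)
  also have "\<dots> = (-1) ^ ?e * s_y_monom (phi_ss p n I k)"
    by (cases "even ?e") (simp_all add: s_y_monom_def single_uminus minus_monom)
  finally show ?thesis .
qed

end

theorem lemma4p9:
  fixes p n :: nat
  assumes "1 \<le> p" and "p < n"
  shows "\<exists>\<psi> :: zvar mpoly \<Rightarrow> (nat \<times> nat) mpoly poly.
    graded_algebra_iso
      mpoly_scale (pluecker_degree p) (initial_subalgebra ss_less (pluecker_algebra p n))
      ys_scale s_degree (order_ideal_algebra (Q_set p n) (Q_le p n)) \<psi> \<and>
    (\<forall>I\<in>increasing_tuples p n. \<forall>k r. r \<in> {0..p - 1} \<longrightarrow> [k = r] (mod p) \<longrightarrow>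
      \<psi> (initial_term ss_less (D_coeff p I k)) =
        (-1) ^ ((p choose 2) + r * (p - 1)) * s_y_monom (phi_ss p n I k))"
  using toric_iso_graded_algebra_iso[OF assms] toric_iso_initial_term[OF assms] by blast

end
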